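(* Let $f\in C_b(\mathbb{R}^N)$, $\lambda>0$ and $s\in(0,1)$. Consider the equation $$\lambda u+(-\Delta)^su=f\quad\text{in }\mathbb{R}^N.\qquad( * )$$ (a) If $s\ne1/2$, equation $( * )$ has a unique solution $u\in C^{2s}_b(\mathbb{R}^N)$, and there is $C>0$, independent of $f$, such that $\|u\|_{C^{2s}_b(\mathbb{R}^N)}\le C\|f\|_\infty$. (b) If $s=1/2$, equation $( * )$ has a unique solution in $Z^1_b(\mathbb{R}^N)$, and there is $C>0$, independent of $f$, such that $\|u\|_{Z^1_b(\mathbb{R}^N)}\le C\|f\|_\infty$. (c) If in addition $f\in C^\alpha_b(\mathbb{R}^N)$ with $\alpha\in(0,1)$ and $\alpha+2s\notin\{1,2\}$, then $u\in C^{\alpha+2s}_b(\mathbb{R}^N)$, and there is $C>0$, independent of $f$, such that $\|u\|_{C^{\alpha+2s}_b(\mathbb{R}^N)}\le C\|f\|_{C^\alpha_b(\mathbb{R}^N)}$. (d) If in addition $f\in C^\alpha_b(\mathbb{R}^N)$ with $\alpha\in(0,1)$ and $\alpha+2s=k\in\{1,2\}$, then $u\in Z^k_b(\mathbb{R}^N)$, and there is $C>0$, independent of $f$, such that $\|u\|_{Z^k_b(\mathbb{R}^N)}\le C\|f\|_{C^\alpha_b(\mathbb{R}^N)}$.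
   Context: The operator. Let $T_\sigma$ be the heat semigroup on $\mathbb{R}^N$ with kernel $(4\pi\sigma)^{-N/2}e^{-|x|^2/4\sigma}$, and for $t>0$ let $\eta^{(s)}_t:(0,\infty)\to\mathbb{R}$ be the inverse Laplace transform of $\lambda\mapsto e^{-t\lambda^s}$, i.e. $\int_0^\infty e^{-\lambda\sigma}\eta^{(s)}_t(\sigma)\,d\sigma=e^{-t\lambda^s}$. Set $P_tf=e^{-t(-\Delta)^s}f:=\int_0^\infty T_\sigma f\,\eta^{(s)}_t(\sigma)\,d\sigma$, $t>0$, $f\in C_b(\mathbb{R}^N)$, $P_0=I$. Then $-(-\Delta)^s$ denotes the generator $L$ of this semigroup on $C_b(\mathbb{R}^N)$, i.e. the unique closed operator in $C_b(\mathbb{R}^N)$ with $R(\lambda,L)f(x)=\int_0^\infty e^{-\lambda t}P_tf(x)\,dt$ for $\lambda>0$. The solution of $\lambda u+(-\Delta)^su=f$ is $u=R(\lambda,L)f$ (unique in the domain of $L$). Function spaces. $C_b(\mathbb{R}^N)$: bounded continuous functions with sup norm. For $\sigma\in(0,1)$, $C^\sigma_b(\mathbb{R}^N)$: bounded $\sigma$-Hölder continuous functions, norm $\|f\|_\infty+\sup_{x,\,h\ne0}|f(x+h)-f(x)|/|h|^\sigma$. For $n\in\mathbb{N}$, $C^n_b(\mathbb{R}^N)$: functions with bounded continuous derivatives up to order $n$, norm given by sum of sup norms; $C^{n+\sigma}_b(\mathbb{R}^N)$: $f\in C^n_b$ whose $n$-th order derivative is $\sigma$-Hölder, norm $\|f\|_{C^n_b}$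 plus the $\sigma$-Hölder seminorm of $D^nf$. $Z^1_b(\mathbb{R}^N)$: bounded continuous $f$ with $[f]_{Z^1}=\sup_{x,\,h\ne0}|f(x+2h)-2f(x+h)+f(x)|/|h|<\infty$, norm $\|f\|_\infty+[f]_{Z^1}$. $Z^2_b(\mathbb{R}^N)$: $f\in C^1_b$ with $[Df]_{Z^1}<\infty$, norm $\|f\|_{C^1_b}+[Df]_{Z^1}$. *)

theory Defs
  imports "HOL-Analysis.Analysis"
begin

definition heat :: "real \<Rightarrow> ('a::euclidean_space \<Rightarrow> real) \<Rightarrow> 'a \<Rightarrow> real" where
  "heat \<sigma> f x =
     (LINT y|lborel. (4 * pi * \<sigma>) powr (- (real DIM('a) / 2))
        * exp (- ((norm (x - y))\<^sup>2 / (4 * \<sigma>))) * f y)"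

definition is_inverse_laplace :: "(real \<Rightarrow> real) \<Rightarrow> (real \<Rightarrow> real) \<Rightarrow> bool" where
  "is_inverse_laplace F g \<longleftrightarrow>
     continuous_on {0<..} g \<and>
     (\<forall>lam>0. set_integrable lborel {0<..} (\<lambda>\<sigma>. exp (- lam * \<sigma>) * g \<sigma>) \<and>
            (LINT \<sigma>:{0<..}|lborel. exp (- lam * \<sigma>) * g \<sigma>) = F lam)"

text \<open>A Laplace transform determines a continuous function on the open half-line; only the
  irrelevant values at nonpositive arguments are left to the choice operator.\<close>

definition inverse_laplace :: "(real \<Rightarrow> real) \<Rightarrow> real \<Rightarrow> real" where
  "inverse_laplace F = (SOME g. is_inverse_laplace F g)"

definition subord_density :: "real \<Rightarrow> real \<Rightarrow> real \<Rightarrow> real" where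
  "subord_density s t = inverse_laplace (\<lambda>lam. exp (- t * lam powr s))"

definition frac_heat :: "real \<Rightarrow> real \<Rightarrow> ('a::euclidean_space \<Rightarrow> real) \<Rightarrow> 'a \<Rightarrow> real" where
  "frac_heat s t f x =
     (if t = 0 then f x
      else LINT \<sigma>:{0<..}|lborel. heat \<sigma> f x * subord_density s t \<sigma>)"

text \<open>An unbounded operator is represented by its graph.\<close>

definition closed_operator :: "('b::real_normed_vector \<times> 'b) set \<Rightarrow> bool" where
  "closed_operator G \<longleftrightarrow> subspace G \<and> single_valued G \<and> closed G"

definition is_resolvent ::
  "('b::real_normed_vector \<times> 'b) set \<Rightarrow> real \<Rightarrow> ('b \<Rightarrow> 'b) \<Rightarrow> bool" where
  "is_resolvent G lam R \<longleftrightarrow>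
     bounded_linear R \<and>
     (\<forall>f. \<exists>g. (R f, g) \<in> G \<and> lam *\<^sub>R R f - g = f) \<and>
     (\<forall>(u, g) \<in> G. R (lam *\<^sub>R u - g) = u)"

text \<open>The integral over \<open>t\<close> is pointwise; its integrability is demanded so that it is never
  the default value 0 of a non-integrable function.\<close>

definition is_frac_generator ::
  "real \<Rightarrow> (('a::euclidean_space \<Rightarrow>\<^sub>C real) \<times> ('a \<Rightarrow>\<^sub>C real)) set \<Rightarrow> bool" where
  "is_frac_generator s G \<longleftrightarrow>
     closed_operator G \<and>
     (\<forall>lam>0. \<exists>R. is_resolvent G lam R \<and>
        (\<forall>f x. set_integrable lborel {0<..} (\<lambda>t. exp (- lam * t) * frac_heat s t (apply_bcontfun f) x) \<and>
               apply_bcontfun (R f) x =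
                 (LINT t:{0<..}|lborel. exp (- lam * t) * frac_heat s t (apply_bcontfun f) x)))"

definition frac_generator ::
  "real \<Rightarrow> (('a::euclidean_space \<Rightarrow>\<^sub>C real) \<times> ('a \<Rightarrow>\<^sub>C real)) set" where
  "frac_generator s = (THE G. is_frac_generator s G)"

definition frac_laplacian_dom :: "real \<Rightarrow> ('a::euclidean_space \<Rightarrow>\<^sub>C real) set" where
  "frac_laplacian_dom s = Domain (frac_generator s)"

definition frac_laplacian ::
  "real \<Rightarrow> ('a::euclidean_space \<Rightarrow>\<^sub>C real) \<Rightarrow> ('a \<Rightarrow>\<^sub>C real)" where
  "frac_laplacian s u = - (THE g. (u, g) \<in> frac_generator s)"

definition is_solution ::
  "real \<Rightarrow> real \<Rightarrow> ('a::euclidean_space \<Rightarrow>\<^sub>C real) \<Rightarrow> ('a \<Rightarrow>\<^sub>C real) \<Rightarrow> bool" where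
  "is_solution s lam f u \<longleftrightarrow>
     u \<in> frac_laplacian_dom s \<and> lam *\<^sub>R u + frac_laplacian s u = f"

text \<open>The derivative of order \<open>n\<close> at a point is the tensor of all partial derivatives of order
  \<open>n\<close>, indexed by the lists of \<open>n\<close> basis vectors and measured in its Euclidean norm.\<close>

primrec iter_deriv :: "'a::euclidean_space list \<Rightarrow> ('a \<Rightarrow> real) \<Rightarrow> 'a \<Rightarrow> real" where
  "iter_deriv [] f = f"
| "iter_deriv (b # bs) f = (\<lambda>x. frechet_derivative (iter_deriv bs f) (at x) b)"

definition multi_indices :: "nat \<Rightarrow> 'a::euclidean_space list set" where
  "multi_indices n = {bs. set bs \<subseteq> Basis \<and> length bs = n}"

definition tensor_norm :: "nat \<Rightarrow> ('a::euclidean_space list \<Rightarrow> real) \<Rightarrow> real" where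
  "tensor_norm n T = L2_set T (multi_indices n)"

definition Cn_space :: "nat \<Rightarrow> ('a::euclidean_space \<Rightarrow> real) set" where
  "Cn_space n = {f.
     (\<forall>k<n. \<forall>bs \<in> multi_indices k. \<forall>x. iter_deriv bs f differentiable (at x)) \<and>
     (\<forall>k\<le>n. \<forall>bs \<in> multi_indices k.
        continuous_on UNIV (iter_deriv bs f) \<and> bounded (range (iter_deriv bs f)))}"

definition Cn_norm :: "nat \<Rightarrow> ('a::euclidean_space \<Rightarrow> real) \<Rightarrow> real" where
  "Cn_norm n f = (\<Sum>k\<le>n. SUP x. tensor_norm k (\<lambda>bs. iter_deriv bs f x))"

definition holder_quotients :: "nat \<Rightarrow> real \<Rightarrow> ('a::euclidean_space \<Rightarrow> real) \<Rightarrow> real set" where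
  "holder_quotients n \<sigma> f =
     {tensor_norm n (\<lambda>bs. iter_deriv bs f (x + h) - iter_deriv bs f x) / norm h powr \<sigma>
        | x h. h \<noteq> 0}"

text \<open>For noninteger \<open>\<gamma> > 0\<close>, written \<open>\<gamma> = n + \<sigma>\<close> with \<open>n = \<lfloor>\<gamma>\<rfloor>\<close> and \<open>0 < \<sigma> < 1\<close>.
  For integer \<open>\<gamma>\<close> these two definitions carry no meaning.\<close>

definition holder_space :: "real \<Rightarrow> ('a::euclidean_space \<Rightarrow> real) set" where
  "holder_space \<gamma> =
     {f \<in> Cn_space (nat \<lfloor>\<gamma>\<rfloor>). bdd_above (holder_quotients (nat \<lfloor>\<gamma>\<rfloor>) (frac \<gamma>) f)}"

definition holder_norm :: "real \<Rightarrow> ('a::euclidean_space \<Rightarrow> real) \<Rightarrow> real" where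
  "holder_norm \<gamma> f =
     Cn_norm (nat \<lfloor>\<gamma>\<rfloor>) f + Sup (holder_quotients (nat \<lfloor>\<gamma>\<rfloor>) (frac \<gamma>) f)"

definition zygmund_quotients :: "nat \<Rightarrow> ('a::euclidean_space \<Rightarrow> real) \<Rightarrow> real set" where
  "zygmund_quotients n f =
     {tensor_norm n (\<lambda>bs. iter_deriv bs f (x + 2 *\<^sub>R h) - 2 * iter_deriv bs f (x + h)
                            + iter_deriv bs f x) / norm h
        | x h. h \<noteq> 0}"

text \<open>For \<open>k \<ge> 1\<close>.\<close>

definition zygmund_space :: "nat \<Rightarrow> ('a::euclidean_space \<Rightarrow> real) set" where
  "zygmund_space k = {f \<in> Cn_space (k - 1). bdd_above (zygmund_quotients (k - 1) f)}"

definition zygmund_norm :: "nat \<Rightarrow> ('a::euclidean_space \<Rightarrow> real) \<Rightarrow> real" where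
  "zygmund_norm k f = Cn_norm (k - 1) f + Sup (zygmund_quotients (k - 1) f)"

end

theory Submission
  imports Defs "HOL-Complex_Analysis.Complex_Analysis" "HOL-Probability.Distributions" "HOL-Real_Asymp.Real_Asymp"
begin

text \<open>The resolvent is again subordinate to the heat semigroup: \<open>R(\<lambda>)f = \<integral> r\<^sub>\<lambda>(\<sigma>) T\<^sub>\<sigma>f d\<sigma>\<close>, where \<open>r\<^sub>\<lambda>\<close> has the
  Laplace transform \<open>1 / (\<lambda> + m\<^sup>s)\<close>. Inverting this transform along the rays of angle \<open>\<plusminus> pi / (1 + s)\<close>, on
  which both \<open>exp (\<sigma>z)\<close> and \<open>exp (-tz\<^sup>s)\<close> decay, gives \<open>|r\<^sub>\<lambda>(\<sigma>)| \<le> K min (\<sigma>\<^bsup>s-1\<^esup>, \<sigma>\<^bsup>-1-s\<^esup>)\<close>;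
  the same inversion produces the stable density. All identities between the operators (subordination,
  the resolvent identity, injectivity) are identities between Laplace transforms in disguise and
  follow from uniqueness of the transform; positivity of the densities is never needed. Regularity is
  then read off from the smoothing estimate \<open>|D\<^sup>kT\<^sub>\<sigma>f| \<le> C \<sigma>\<^bsup>(\<alpha>-k)/2\<^esup>\<close> by splitting the integral at
  \<open>\<sigma> = |h|\<^sup>2\<close>, with \<open>\<alpha> = 0\<close> covering data that are merely bounded.\<close>

section \<open>Uniqueness of Laplace transforms\<close>

text \<open>The semigroup is not strongly continuous on all bounded continuous functions, so
  Hille-Yosida theory in its usual form does not deliver the generator. It is rebuilt from the
  resolvent instead: a family of operators that satisfies the resolvent identity and is injective is
  the resolvent of exactly one closed operator. Injectivity comes from the pointwise limit of
  \<mu>R(\<mu>)f(x) as \<mu> tends to infinity, which is f(x) because \<mu>r(\<mu>) is a dilation of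
  the density at \<mu> = 1.

  The two power bounds on the density have different tasks. The singularity \<sigma>^(s-1) is the
  source of the gain of 2s derivatives: its integral up to |h|^2 is of size |h|^(2s). The decay
  \<sigma>^(-1-s) secures integrability at infinity; it appears once the value of the transform at 0
  is subtracted, whose contributions on the two conjugate rays cancel.

  At integer \<alpha> + 2s the estimate of first differences diverges logarithmically at large
  \<sigma>. Second differences decay faster there by a factor \<sigma>^(-1/2), which is how the
  Zygmund spaces enter.\<close>

lemma norm_integral_le:
  fixes f :: "'m \<Rightarrow> 'b::{banach,second_countable_topology}" and g :: "'m \<Rightarrow> real"
  assumes g: "integrable M g" and le: "\<And>x. x \<in> space M \<Longrightarrow> norm (f x) \<le> g x"
  shows "norm (LINT x|M. f x) \<le> (LINT x|M. g x)"
proof (cases "integrable M f")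
  case True
  have "norm (LINT x|M. f x) \<le> (LINT x|M. norm (f x))" by (rule integral_norm_bound)
  also have "\<dots> \<le> (LINT x|M. g x)" using True g le by (intro integral_mono) auto
  finally show ?thesis .
next
  case False
  \<comment> \<open>A non-integrable \<open>f\<close> has integral 0 by default, and
    \<open>g\<close> dominates a norm, so its integral is at least 0. Later estimates can therefore
    bound an integral without first proving its integrand integrable.\<close>
  have "0 \<le> g x" if "x \<in> space M" for x using norm_ge_zero le[OF that] by (rule order_trans)
  then show ?thesis using False by (simp add: not_integrable_integral_eq)
qed

text \<open>The bound on \<open>g\<close> is asked only where \<open>h\<close> is nonzero because
  the typical factor \<open>exp (- m * S x)\<close> is bounded only for \<open>S x\<close>
  nonnegative, that is on the support of the densities.\<close>

lemma integrable_bounded_mult: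
  fixes h g :: "'m \<Rightarrow> real"
  assumes "integrable M h" "g \<in> borel_measurable M" "\<And>x. x \<in> space M \<Longrightarrow> h x \<noteq> 0 \<Longrightarrow> \<bar>g x\<bar> \<le> B"
  shows "integrable M (\<lambda>x. g x * h x)"
proof (rule Bochner_Integration.integrable_bound)
  show "integrable M (\<lambda>x. B * \<bar>h x\<bar>)" using assms by auto
  show "(\<lambda>x. g x * h x) \<in> borel_measurable M" using assms by measurable
  show "AE x in M. norm (g x * h x) \<le> norm (B * \<bar>h x\<bar>)"
  proof (rule AE_I2)
    fix x assume x: "x \<in> space M"
    show "norm (g x * h x) \<le> norm (B * \<bar>h x\<bar>)"
    proof (cases "h x = 0")
      case False
      then have "\<bar>g x\<bar> \<le> \<bar>B\<bar>" using assms(3)[OF x] by linarith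
      then show ?thesis by (simp add: abs_mult mult_right_mono)
    qed auto
  qed
qed

text \<open>The extra factor \<open>exp (- S x)\<close> shifts all exponents to
  \<open>Suc i\<close>, so that only transform values at positive integers occur and never the one
  at 0, about which nothing is assumed.\<close>

lemma laplace_moments:
  fixes h S :: "'m \<Rightarrow> real" and a :: "nat \<Rightarrow> real"
  assumes "integrable M h" "S \<in> borel_measurable M" "\<And>x. x \<in> space M \<Longrightarrow> h x \<noteq> 0 \<Longrightarrow> 0 \<le> S x"
  shows "(LINT x|M. (exp (- S x) * (\<Sum>i\<le>n. a i * exp (- S x) ^ i)) * h x)
     = (\<Sum>i\<le>n. a i * (LINT x|M. exp (- real (Suc i) * S x) * h x))"
proof -
  have int: "integrable M (\<lambda>x. exp (- real (Suc i) * S x) * h x)" for i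
    by (rule integrable_bounded_mult[where B=1]) (use assms in \<open>auto simp: mult_nonpos_nonneg\<close>)
  have e: "exp (- S x) * exp (- S x) ^ i = exp (- real (Suc i) * S x)" for x i
    by (simp add: exp_of_nat_mult[symmetric] exp_add[symmetric] algebra_simps)
  have "(LINT x|M. (exp (- S x) * (\<Sum>i\<le>n. a i * exp (- S x) ^ i)) * h x)
      = (LINT x|M. (\<Sum>i\<le>n. a i * (exp (- real (Suc i) * S x) * h x)))"
    unfolding e[symmetric]
    by (intro Bochner_Integration.integral_cong)
       (auto simp: sum_distrib_left sum_distrib_right mult_ac intro!: sum.cong)
  also have "\<dots> = (\<Sum>i\<le>n. a i * (LINT x|M. exp (- real (Suc i) * S x) * h x))"
    by (subst Bochner_Integration.integral_sum) (use int in auto)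
  finally show ?thesis .
qed

text \<open>On the support of \<open>h\<close> the variable \<open>exp (- S x)\<close> stays in
  [0,1], so uniform approximation on that interval costs no more than the total variation of
  \<open>h\<close>.\<close>

lemma laplace_approx:
  fixes h S :: "'m \<Rightarrow> real"
  assumes h: "integrable M h" and S: "S \<in> borel_measurable M"
    and S0: "\<And>x. x \<in> space M \<Longrightarrow> h x \<noteq> 0 \<Longrightarrow> 0 \<le> S x"
    and psi: "continuous_on UNIV \<psi>" and p: "continuous_on UNIV p"
    and e: "\<And>y. y \<in> {0..1} \<Longrightarrow> \<bar>\<psi> y - p y\<bar> < e"
  shows "\<bar>(LINT x|M. (exp (- S x) * \<psi> (exp (- S x))) * h x)
        - (LINT x|M. (exp (- S x) * p (exp (- S x))) * h x)\<bar> \<le> e * (LINT x|M. \<bar>h x\<bar>)"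
proof -
  have int: "integrable M (\<lambda>x. (exp (- S x) * q (exp (- S x))) * h x)"
    if q: "continuous_on UNIV q" for q :: "real \<Rightarrow> real"
  proof -
    have "bounded (q ` {0..1})"
      by (intro compact_imp_bounded compact_continuous_image) (auto intro: continuous_on_subset[OF q])
    then obtain B where B: "\<And>y. y \<in> {0..1} \<Longrightarrow> \<bar>q y\<bar> \<le> B" by (force simp: bounded_iff)
    have [measurable]: "q \<in> borel_measurable borel" using q by (rule borel_measurable_continuous_onI)
    show ?thesis
    proof (rule integrable_bounded_mult[OF h, where B=B])
      show "(\<lambda>x. exp (- S x) * q (exp (- S x))) \<in> borel_measurable M" using S by measurable
      fix x assume "x \<in> space M" "h x \<noteq> 0"
      then have "0 \<le> S x" by (rule S0)
      then have "\<bar>q (exp (- S x))\<bar> \<le> B" by (intro B) auto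
      then show "\<bar>exp (- S x) * q (exp (- S x))\<bar> \<le> B"
        using \<open>0 \<le> S x\<close> mult_mono[of "exp (- S x)" 1 "\<bar>q (exp (- S x))\<bar>" B] by (auto simp: abs_mult)
    qed
  qed
  have "\<bar>(LINT x|M. (exp (- S x) * \<psi> (exp (- S x))) * h x)
        - (LINT x|M. (exp (- S x) * p (exp (- S x))) * h x)\<bar>
      = \<bar>LINT x|M. (exp (- S x) * \<psi> (exp (- S x))) * h x - (exp (- S x) * p (exp (- S x))) * h x\<bar>"
    by (simp add: int psi p)
  also have "\<dots> \<le> (LINT x|M. e * \<bar>h x\<bar>)"
  proof (rule norm_integral_le[where 'b=real, unfolded real_norm_def])
    fix x assume x: "x \<in> space M"
    have eq: "\<bar>(exp (- S x) * \<psi> (exp (- S x))) * h x - (exp (- S x) * p (exp (- S x))) * h x\<bar>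
      = exp (- S x) * \<bar>\<psi> (exp (- S x)) - p (exp (- S x))\<bar> * \<bar>h x\<bar>"
      by (metis abs_exp_cancel abs_mult left_diff_distrib right_diff_distrib)
    show "\<bar>(exp (- S x) * \<psi> (exp (- S x))) * h x - (exp (- S x) * p (exp (- S x))) * h x\<bar> \<le> e * \<bar>h x\<bar>"
    proof (cases "h x = 0")
      case False
      then have "0 \<le> S x" using S0 x by auto
      then have "\<bar>\<psi> (exp (- S x)) - p (exp (- S x))\<bar> < e" by (intro e) auto
      then have "exp (- S x) * \<bar>\<psi> (exp (- S x)) - p (exp (- S x))\<bar> \<le> 1 * e"
        using \<open>0 \<le> S x\<close> by (intro mult_mono) auto
      then have "exp (- S x) * \<bar>\<psi> (exp (- S x)) - p (exp (- S x))\<bar> * \<bar>h x\<bar> \<le> 1 * e * \<bar>h x\<bar>"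
        by (rule mult_right_mono) auto
      then show ?thesis unfolding eq by simp
    qed auto
  qed (use h in auto)
  finally show ?thesis by simp
qed

text \<open>Weierstrass approximation in the variable y = exp(-S) reduces the claim to polynomials,
  hence to the values of the transforms at positive integers.\<close>

lemma laplace_unique_cont:
  fixes h1 S1 :: "'m \<Rightarrow> real" and h2 S2 :: "'n \<Rightarrow> real"
  assumes 1: "integrable M1 h1" "S1 \<in> borel_measurable M1" "\<And>x. x \<in> space M1 \<Longrightarrow> h1 x \<noteq> 0 \<Longrightarrow> 0 \<le> S1 x"
    and 2: "integrable M2 h2" "S2 \<in> borel_measurable M2" "\<And>x. x \<in> space M2 \<Longrightarrow> h2 x \<noteq> 0 \<Longrightarrow> 0 \<le> S2 x"
    and eq: "\<And>m. m > 0 \<Longrightarrow> (LINT x|M1. exp (- m * S1 x) * h1 x) = (LINT x|M2. exp (- m * S2 x) * h2 x)"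
    and psi: "continuous_on UNIV \<psi>"
  shows "(LINT x|M1. (exp (- S1 x) * \<psi> (exp (- S1 x))) * h1 x) = (LINT x|M2. (exp (- S2 x) * \<psi> (exp (- S2 x))) * h2 x)"
    (is "?I1 = ?I2")
proof -
  define K where "K = (LINT x|M1. \<bar>h1 x\<bar>) + (LINT x|M2. \<bar>h2 x\<bar>)"
  have K: "K \<ge> 0" unfolding K_def by (intro add_nonneg_nonneg) auto
  have *: "\<bar>?I1 - ?I2\<bar> \<le> e * K" if "e > 0" for e
  proof -
    obtain p where p: "real_polynomial_function p" "\<And>y::real. y \<in> {0..1} \<Longrightarrow> \<bar>\<psi> y - p y\<bar> < e"
      using Stone_Weierstrass_real_polynomial_function[of "{0..1::real}" \<psi> e] psi \<open>e > 0\<close>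
      by (metis compact_Icc continuous_on_subset top_greatest)
    then obtain a n where a: "p = (\<lambda>y. \<Sum>i\<le>n. a i * y ^ i)" by (auto simp: real_polynomial_function_iff_sum)
    have pc: "continuous_on UNIV p" unfolding a by (intro continuous_intros)
    have "(LINT x|M1. (exp (- S1 x) * p (exp (- S1 x))) * h1 x) = (LINT x|M2. (exp (- S2 x) * p (exp (- S2 x))) * h2 x)"
      unfolding a
      by (subst laplace_moments[where M=M1], use 1 in blast, use 1 in blast, use 1 in blast,
          subst laplace_moments[where M=M2], use 2 in blast, use 2 in blast, use 2 in blast)
         (intro sum.cong refl arg_cong2[of _ _ _ _ "(*)"] eq, simp)
    moreover note laplace_approx[OF 1 psi pc p(2)] laplace_approx[OF 2 psi pc p(2)]
    ultimately show ?thesis by (simp add: K_def algebra_simps)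
  qed
  have "\<bar>?I1 - ?I2\<bar> \<le> 0 + e" if "e > 0" for e
  proof -
    have "e / (K + 1) * K \<le> e" using that K by (simp add: field_simps)
    then show ?thesis using *[of "e / (K + 1)"] that K by simp
  qed
  then have "\<bar>?I1 - ?I2\<bar> \<le> 0" by (rule field_le_epsilon)
  then show ?thesis by simp
qed

text \<open>The transforms are taken of the images of \<open>h1 M1\<close> and \<open>h2 M2\<close> under \<open>S1\<close> and \<open>S2\<close>, so that convolutions
  (\<open>S\<close> the sum on a product space) and dilations need no separate treatment.\<close>

lemma laplace_unique:
  fixes h1 S1 :: "'m \<Rightarrow> real" and h2 S2 :: "'n \<Rightarrow> real" and g :: "real \<Rightarrow> real"
  assumes 1: "integrable M1 h1" "S1 \<in> borel_measurable M1" "\<And>x. x \<in> space M1 \<Longrightarrow> h1 x \<noteq> 0 \<Longrightarrow> 0 \<le> S1 x"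
    and 2: "integrable M2 h2" "S2 \<in> borel_measurable M2" "\<And>x. x \<in> space M2 \<Longrightarrow> h2 x \<noteq> 0 \<Longrightarrow> 0 \<le> S2 x"
    and eq: "\<And>m. m > 0 \<Longrightarrow> (LINT x|M1. exp (- m * S1 x) * h1 x) = (LINT x|M2. exp (- m * S2 x) * h2 x)"
    and g: "continuous_on UNIV g" and B: "\<And>x. \<bar>g x\<bar> \<le> B"
  shows "(LINT x|M1. g (S1 x) * h1 x) = (LINT x|M2. g (S2 x) * h2 x)"
proof -
  define cutoff where "cutoff n S = max 0 (min 1 (real n + 1 - S))" for n S
  define d where "d n = exp (- (real n + 1))" for n
  \<comment> \<open>This function is made so that \<open>exp (- S) * \<psi> n (exp (- S))\<close>
    equals \<open>g S * cutoff n S\<close>. Clamping y at \<open>d n\<close> keeps the logarithm and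
    the quotient continuous down to y = 0; it changes nothing, since the cutoff vanishes from S = n
    + 1 on, which is where y reaches \<open>d n\<close>.\<close>
  define \<psi> where "\<psi> n y = g (- ln (max y (d n))) * cutoff n (- ln (max y (d n))) / max y (d n)" for n y
  have d0: "d n > 0" for n by (simp add: d_def)
  have mx: "max y (d n) > 0" "max y (d n) \<noteq> 0" for y n using d0[of n] by linarith+
  have c: "continuous_on UNIV (\<psi> n)" for n
    unfolding \<psi>_def cutoff_def
    by (intro continuous_intros continuous_on_compose2[OF g]) (use mx in auto)
  have [measurable]: "g \<in> borel_measurable borel" using g by (rule borel_measurable_continuous_onI)
  have psi: "exp (- S) * \<psi> n (exp (- S)) = g S * cutoff n S" for S n
  proof (cases "S \<le> real n + 1")
    case True
    then have "max (exp (- S)) (d n) = exp (- S)" by (auto simp: d_def)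
    then show ?thesis by (simp add: \<psi>_def)
  next
    case False
    then have "max (exp (- S)) (d n) = d n" by (auto simp: d_def)
    then show ?thesis using False by (simp add: \<psi>_def cutoff_def d_def)
  qed
  have lim: "(\<lambda>n. cutoff n S) \<longlonglongrightarrow> 1" for S
  proof (rule tendsto_eventually)
    show "eventually (\<lambda>n. cutoff n S = 1) sequentially"
      using eventually_ge_at_top[of "nat \<lceil>S\<rceil>"]
    proof eventually_elim
      case (elim n)
      then have "S \<le> real n" by linarith
      then show ?case by (simp add: cutoff_def)
    qed
  qed
  have L1: "(\<lambda>n. LINT x|M1. (g (S1 x) * cutoff n (S1 x)) * h1 x) \<longlonglongrightarrow> (LINT x|M1. g (S1 x) * h1 x)"
    and L2: "(\<lambda>n. LINT x|M2. (g (S2 x) * cutoff n (S2 x)) * h2 x) \<longlonglongrightarrow> (LINT x|M2. g (S2 x) * h2 x)"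
  proof -
    have bd: "norm (g s * cutoff n s * h) \<le> B * \<bar>h\<bar>" for n s h
    proof -
      have "\<bar>g s\<bar> * \<bar>cutoff n s\<bar> \<le> B * 1" by (intro mult_mono B) (use B[of 0] in \<open>auto simp: cutoff_def\<close>)
      then show ?thesis by (simp add: abs_mult mult_right_mono)
    qed
    have lm: "(\<lambda>n. g s * cutoff n s * h) \<longlonglongrightarrow> g s * h" for s h
      using tendsto_mult[OF tendsto_mult[OF tendsto_const lim] tendsto_const] by simp
    note [measurable] = 1(2) 2(2) borel_measurable_integrable[OF 1(1)] borel_measurable_integrable[OF 2(1)]
    have [measurable]: "cutoff n \<in> borel_measurable borel" for n unfolding cutoff_def by measurable
    show "(\<lambda>n. LINT x|M1. (g (S1 x) * cutoff n (S1 x)) * h1 x) \<longlonglongrightarrow> (LINT x|M1. g (S1 x) * h1 x)"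
      by (rule integral_dominated_convergence[where w = "\<lambda>x. B * \<bar>h1 x\<bar>"])
         (use 1(1) bd lm in \<open>auto intro!: AE_I2\<close>)
    show "(\<lambda>n. LINT x|M2. (g (S2 x) * cutoff n (S2 x)) * h2 x) \<longlonglongrightarrow> (LINT x|M2. g (S2 x) * h2 x)"
      by (rule integral_dominated_convergence[where w = "\<lambda>x. B * \<bar>h2 x\<bar>"])
         (use 2(1) bd lm in \<open>auto intro!: AE_I2\<close>)
  qed
  show ?thesis
  proof (rule LIMSEQ_unique[OF L1])
    show "(\<lambda>n. LINT x|M1. (g (S1 x) * cutoff n (S1 x)) * h1 x) \<longlonglongrightarrow> (LINT x|M2. g (S2 x) * h2 x)"
      using L2 laplace_unique_cont[OF 1 2 eq c] by (simp add: psi)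
  qed
qed

section \<open>Inversion of Laplace transforms along a ray\<close>

lemma integrable_exp_abs:
  assumes "0 < a" shows "integrable lborel (\<lambda>x::real. exp (- a * \<bar>x\<bar>))"
proof -
  have "(\<lambda>x. exp (- a * x)) absolutely_integrable_on {0..}"
    by (intro nonnegative_absolutely_integrable_1 integrable_on_exp_minus_to_infinity assms) auto
  then have *: "integrable lborel (\<lambda>x::real. indicator {0..} x *\<^sub>R exp (- a * x))"
    unfolding set_integrable_def by (subst (asm) integrable_completion) auto
  then have "integrable lborel (\<lambda>x::real. indicator {0..} (0 + (-1) * x) *\<^sub>R exp (- a * (0 + (-1) * x)))"
    by (intro lborel_integrable_real_affine) auto
  with * have "integrable lborel (\<lambda>x::real. indicator {0..} x *\<^sub>R exp (- a * x)
      + indicator {0..} (0 + (-1) * x) *\<^sub>R exp (- a * (0 + (-1) * x)))"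
    by (rule Bochner_Integration.integrable_add)
  then show ?thesis
    by (rule Bochner_Integration.integrable_bound) (auto simp: indicator_def abs_if)
qed

text \<open>With t = exp x this is the Gamma integral of t^(a-1) exp(-ct).\<close>

lemma integrable_exp_exp:
  fixes a c :: real
  assumes a: "0 < a" "a \<le> 2" and c: "0 < c"
  shows "integrable lborel (\<lambda>x. exp (- (c * exp x)) * exp (a * x))"
proof (rule Bochner_Integration.integrable_bound)
  \<comment> \<open>Raising 1 + u <= exp u at u = z/4 to the fourth power gives exp(-z) <= 256/z^4,
    here with z = c exp x. The fourth power suffices because a - 4 <= -a for a <= 2; the 1 in the
    maximum serves negative x.\<close>
  define K where "K = max 1 (256 / c ^ 4)"
  show "integrable lborel (\<lambda>x. K * exp (- a * \<bar>x\<bar>))"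
    using integrable_exp_abs[OF a(1)] by simp
  show "AE x in lborel. norm (exp (- (c * exp x)) * exp (a * x)) \<le> norm (K * exp (- a * \<bar>x\<bar>))"
  proof (rule AE_I2)
    fix x :: real
    have K: "K \<ge> 1" "K \<ge> 256 / c ^ 4" by (auto simp: K_def)
    show "norm (exp (- (c * exp x)) * exp (a * x)) \<le> norm (K * exp (- a * \<bar>x\<bar>))"
    proof (cases "x \<le> 0")
      case True
      have "exp (- (c * exp x)) * exp (a * x) \<le> 1 * exp (a * x)"
        using c by (intro mult_right_mono) auto
      also have "\<dots> \<le> K * exp (a * x)" using K by (intro mult_right_mono) auto
      finally show ?thesis using True K by simp
    next
      case False
      define z where "z = c * exp x"
      have z: "z > 0" using c by (simp add: z_def)
      have "(z / 4) ^ 4 \<le> exp (z / 4) ^ 4"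
        using exp_ge_add_one_self[of "z/4"] z by (intro power_mono) linarith+
      also have "exp (z/4) ^ 4 = exp z" by (simp add: exp_of_nat_mult[symmetric])
      finally have "z ^ 4 / 256 \<le> exp z" by (simp add: power_divide)
      then have "exp (- z) \<le> 256 / z ^ 4" using z by (simp add: exp_minus field_simps)
      also have "\<dots> = 256 / c ^ 4 * exp (- 4 * x)"
        using c by (simp add: z_def power_mult_distrib exp_minus field_simps flip: exp_of_nat_mult)
      also have "\<dots> \<le> K * exp (- 4 * x)" using K by (intro mult_right_mono) auto
      finally have "exp (- z) * exp (a * x) \<le> K * exp (- 4 * x) * exp (a * x)" by (rule mult_right_mono) auto
      also have "\<dots> = K * exp ((a - 4) * x)" by (simp add: exp_add[symmetric] algebra_simps)
      also have "\<dots> \<le> K * exp (- a * x)"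
        using K a False mult_nonpos_nonneg[of "2 * a - 4" x]
        by (intro mult_left_mono) (auto simp: algebra_simps)
      finally show ?thesis using False K by (simp add: z_def)
    qed
  qed
qed auto

text \<open>Writing \<sigma> exp x as exp(ln \<sigma> + x) turns the dilation into a translation and
  releases the factor \<sigma>^(-a). All powers of \<sigma> in the density bounds originate
  here.\<close>

lemma integral_exp_exp_scale:
  fixes \<sigma> :: real
  assumes "0 < \<sigma>"
  shows "integrable lborel (\<lambda>x. exp (- (c * (\<sigma> * exp x))) * exp (a * x)) \<longleftrightarrow>
      integrable lborel (\<lambda>x. exp (- (c * exp x)) * exp (a * x))" (is ?A)
    and "(LINT x|lborel. exp (- (c * (\<sigma> * exp x))) * exp (a * x))
      = \<sigma> powr (- a) * (LINT x|lborel. exp (- (c * exp x)) * exp (a * x))" (is ?B)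
proof -
  have eq: "exp (- (c * (\<sigma> * exp x))) * exp (a * x)
     = \<sigma> powr (- a) * (exp (- (c * exp (ln \<sigma> + 1 * x))) * exp (a * (ln \<sigma> + 1 * x)))" for x
    using assms by (simp add: powr_def exp_add distrib_left exp_minus)
  have nz: "\<sigma> powr (- a) \<noteq> 0" using assms by simp
  have "integrable lborel (\<lambda>x. exp (- (c * (\<sigma> * exp x))) * exp (a * x)) \<longleftrightarrow>
    integrable lborel (\<lambda>x. (\<lambda>x. exp (- (c * exp x)) * exp (a * x)) (ln \<sigma> + 1 * x))"
    unfolding eq using nz by (subst integrable_mult_left_iff) auto
  also have "\<dots> \<longleftrightarrow> integrable lborel (\<lambda>x. exp (- (c * exp x)) * exp (a * x))"
    by (rule lborel_integrable_real_affine_iff) simp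
  finally show ?A .
  have "(LINT x|lborel. exp (- (c * (\<sigma> * exp x))) * exp (a * x))
    = \<sigma> powr (- a) * (LINT x|lborel. (\<lambda>x. exp (- (c * exp x)) * exp (a * x)) (ln \<sigma> + 1 * x))"
    unfolding eq by simp
  also have "\<dots> = \<sigma> powr (- a) * (LINT x|lborel. exp (- (c * exp x)) * exp (a * x))"
    using lborel_integral_real_affine[of 1 "\<lambda>x. exp (- (c * exp x)) * exp (a * x)" "ln \<sigma>"] by simp
  finally show ?B .
qed

lemma contour_integral_linepath_same_Im:
  assumes "a < b" "continuous_on (closed_segment (Complex a y) (Complex b y)) f"
  shows "contour_integral (linepath (Complex a y) (Complex b y)) f = integral {a..b} (\<lambda>x. f (Complex x y))"
proof -
  have c: "continuous_on {a..b} (\<lambda>x. f (Complex x y))"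
    by (rule continuous_on_compose2[OF assms(2)])
       (auto intro!: continuous_intros simp: Complex_eq closed_segment_same_Im complex_eq_iff closed_segment_eq_real_ivl)
  have "((\<lambda>t. (b - a) *\<^sub>R f (Complex (a + (b - a) * t) y)) has_integral
      integral {a + (b - a) * 0..a + (b - a) * 1} (\<lambda>x. f (Complex x y))) {0..1}"
  proof (rule has_integral_substitution[where c=a and d=b])
    show "(\<lambda>t. a + (b - a) * t) ` {0..1} \<subseteq> {a..b}"
    proof safe
      fix t :: real assume t: "t \<in> {0..1}"
      have "(b - a) * t \<le> (b - a) * 1" using assms(1) t by (intro mult_left_mono) auto
      moreover have "0 \<le> (b - a) * t" using assms(1) t by (intro mult_nonneg_nonneg) auto
      ultimately show "a + (b - a) * t \<in> {a..b}" unfolding atLeastAtMost_iff mult_1_right by linarith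
    qed
  qed (use assms(1) c in \<open>auto intro!: derivative_eq_intros\<close>)
  moreover have "f (linepath (Complex a y) (Complex b y) t) * (Complex b y - Complex a y)
      = (b - a) *\<^sub>R f (Complex (a + (b - a) * t) y)" for t
  proof -
    have "linepath (Complex a y) (Complex b y) t = Complex (a + (b - a) * t) y" "Complex b y - Complex a y = of_real (b - a)"
      by (auto simp: linepath_def complex_eq_iff algebra_simps)
    then show ?thesis by (simp only: scaleR_conv_of_real mult.commute)
  qed
  ultimately have "(f has_contour_integral integral {a..b} (\<lambda>x. f (Complex x y))) (linepath (Complex a y) (Complex b y))"
    by (simp add: has_contour_integral_linepath)
  then show ?thesis by (rule contour_integral_unique)
qed

lemma has_integral_exp_complex:
  fixes w :: complex
  assumes w: "0 < Re w"
  shows "set_integrable lborel {0<..} (\<lambda>x. exp (- w * of_real x))"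
    and "(LINT x:{0<..}|lborel. exp (- w * of_real x)) = 1 / w"
proof -
  have i: "integrable lborel (\<lambda>x. exp (- Re w * \<bar>x\<bar>))" using integrable_exp_abs[OF w] by simp
  show I: "set_integrable lborel {0<..} (\<lambda>x. exp (- w * of_real x))"
    unfolding set_integrable_def
    by (rule Bochner_Integration.integrable_bound[OF i]) (auto simp: indicator_def norm_exp_eq_Re)
  have w0: "w \<noteq> 0" using w by auto
  have "(LBINT x=0..\<infinity>. exp (- w * of_real x)) = 0 - (- (1 / w))"
  proof (rule interval_integral_FTC_integrable)
    show "((\<lambda>x. - exp (- w * of_real x) / w) has_vector_derivative exp (- w * of_real x)) (at x)" for x
      using w0 by (auto intro!: derivative_eq_intros has_vector_derivative_real_field)
    show "isCont (\<lambda>x. exp (- w * of_real x)) x" for x :: real by (intro continuous_intros)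
    show "set_integrable lborel (einterval 0 \<infinity>) (\<lambda>x. exp (- w * of_real x))"
      using I by (simp add: zero_ereal_def)
    have "((\<lambda>x::real. - exp (- w * of_real x) / w) \<longlongrightarrow> - exp (- w * of_real 0) / w) (at_right 0)"
      using w0 by (intro tendsto_intros)
    then show "(((\<lambda>x. - exp (- w * of_real x) / w) \<circ> real_of_ereal) \<longlongrightarrow> - (1 / w)) (at_right 0)"
      by (simp add: ereal_tendsto_simps zero_ereal_def)
    have "((\<lambda>x. exp (- (Re w * x))) \<longlongrightarrow> 0) at_top"
      using w by real_asymp
    then have "((\<lambda>x::real. - exp (- w * of_real x) / w) \<longlongrightarrow> 0) at_top"
      by (intro tendsto_norm_zero_cancel[of "\<lambda>x. - exp (- w * of_real x) / w"])
         (auto simp: norm_divide norm_exp_eq_Re intro!: tendsto_divide_zero)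
    then show "(((\<lambda>x. - exp (- w * of_real x) / w) \<circ> real_of_ereal) \<longlongrightarrow> 0) (at_left \<infinity>)"
      by (simp add: ereal_tendsto_simps)
  qed (auto simp: zero_ereal_def)
  then show "(LINT x:{0<..}|lborel. exp (- w * of_real x)) = 1 / w"
    by (simp add: interval_lebesgue_integral_def zero_ereal_def)
qed


text \<open>The ray is parametrised by \<open>exp (x + \<i>\<theta>)\<close> and the transform \<open>F\<close> is given as \<open>\<Phi>(z) = F(exp z)\<close>: in these
  coordinates the sector is a strip, there is no branch cut, and rescaling \<open>\<sigma>\<close> is a translation of \<open>x\<close>.\<close>

definition ray_transform :: "real \<Rightarrow> (complex \<Rightarrow> complex) \<Rightarrow> real \<Rightarrow> real" where
  "ray_transform \<theta> \<Phi> \<sigma> = Im (LINT x|lborel. exp (of_real \<sigma> * exp (Complex x \<theta>)) * exp (Complex x \<theta>) * \<Phi> (Complex x \<theta>)) / pi"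

text \<open>For a > 0 and cos \<theta> < 0 this is Gamma(a) (-cos \<theta>)^(-a) / pi.\<close>

definition ray_const :: "real \<Rightarrow> real \<Rightarrow> real" where
  "ray_const \<theta> a = (LINT x|lborel. exp (- (- cos \<theta> * exp x)) * exp (a * x)) / pi"

text \<open>In terms of F(w) = \<Phi>(ln w) on the sector of half-angle \<theta>, \<open>b1\<close>
  reads |F(w)| <= C1 |w|^(-s) and \<open>b2\<close> reads |F(w) - \<Phi>0| <= C2 |w|^s, so that
  \<Phi>0 is the value of F at 0. \<open>sym\<close> makes the integrals over the two conjugate rays
  combine into an imaginary part, and \<theta> > pi/2 makes \<open>exp (\<sigma> * exp z)\<close>
  decay along them.\<close>

locale sectorial =
  fixes s \<theta> C0 C1 C2 \<Phi>0 :: real and \<Phi> :: "complex \<Rightarrow> complex"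
  assumes s: "0 < s" "s < 1" and theta: "pi / 2 < \<theta>" "\<theta> < pi"
    and holo: "\<Phi> holomorphic_on {z. \<bar>Im z\<bar> \<le> \<theta>}"
    and sym: "\<And>z. \<bar>Im z\<bar> \<le> \<theta> \<Longrightarrow> \<Phi> (cnj z) = cnj (\<Phi> z)"
    and b0: "\<And>z. \<bar>Im z\<bar> \<le> \<theta> \<Longrightarrow> norm (\<Phi> z) \<le> C0"
    and b1: "\<And>z. \<bar>Im z\<bar> \<le> \<theta> \<Longrightarrow> norm (\<Phi> z) \<le> C1 * exp (- s * Re z)"
    and b2: "\<And>z. \<bar>Im z\<bar> \<le> \<theta> \<Longrightarrow> norm (\<Phi> z - of_real \<Phi>0) \<le> C2 * exp (s * Re z)"
begin

definition "c = - cos \<theta>"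

lemma c_bounds: "c > 0" "c \<le> 1"
proof -
  have "cos \<theta> < cos (pi / 2)" using theta by (intro cos_monotone_0_pi) auto
  then show "c > 0" by (simp add: c_def)
  show "c \<le> 1" by (simp add: c_def)
qed

lemma theta_pos: "\<theta> > 0" using theta pi_gt_zero by linarith

lemma C_nonneg: "C0 \<ge> 0" "C1 \<ge> 0" "C2 \<ge> 0"
proof -
  have "\<bar>Im 0\<bar> \<le> \<theta>" using theta_pos by simp
  from b0[OF this] b1[OF this] b2[OF this] show "C0 \<ge> 0" "C1 \<ge> 0" "C2 \<ge> 0"
    by (auto intro: order_trans[OF norm_ge_zero])
qed

abbreviation ray :: "real \<Rightarrow> complex" where "ray x \<equiv> Complex x \<theta>"

lemma cont: "continuous_on {z. \<bar>Im z\<bar> \<le> \<theta>} \<Phi>"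
  using holo by (rule holomorphic_on_imp_continuous_on)

lemma cont_line: "\<bar>y\<bar> \<le> \<theta> \<Longrightarrow> continuous_on UNIV (\<lambda>x. \<Phi> (Complex x y))"
  by (rule continuous_on_compose2[OF cont]) (auto simp: Complex_eq intro!: continuous_intros)

lemma meas_line [measurable]: "(\<lambda>x. \<Phi> (ray x)) \<in> borel_measurable borel"
  using theta_pos by (intro borel_measurable_continuous_onI cont_line) simp

lemma meas_ray [measurable]: "(\<lambda>x. ray x) \<in> borel_measurable borel"
  by (intro borel_measurable_continuous_onI) (auto simp: Complex_eq intro!: continuous_intros)

lemma norm_exp_ray: "norm (exp (of_real \<sigma> * exp (ray x)) * exp (ray x)) = exp (- (c * (\<sigma> * exp x))) * exp x"
  by (simp add: norm_mult norm_exp_eq_Re Re_exp c_def mult_ac)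

lemma integrand_bound:
  assumes "0 < \<sigma>" and q: "norm q \<le> C * exp (a * x)"
  shows "norm (exp (of_real \<sigma> * exp (ray x)) * exp (ray x) * q) \<le> C * (exp (- (c * (\<sigma> * exp x))) * exp ((1 + a) * x))"
proof -
  have "norm (exp (of_real \<sigma> * exp (ray x)) * exp (ray x) * q) \<le> (exp (- (c * (\<sigma> * exp x))) * exp x) * (C * exp (a * x))"
    unfolding norm_mult[of _ q] norm_exp_ray using q by (intro mult_left_mono) auto
  then show ?thesis by (simp add: exp_add algebra_simps)
qed

text \<open>It is applied with a = -s, 0 and s, the growth exponents in \<open>b1\<close>,
  \<open>b0\<close> and \<open>b2\<close>; the range of 1 + a is the one that
  \<open>integrable_exp_exp\<close> covers.\<close>

lemma integral_bound:
  assumes sg: "0 < \<sigma>" and a: "0 < 1 + a" "1 + a \<le> 2"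
    and q: "\<And>x. norm (q x) \<le> C * exp (a * x)"
  shows "norm (LINT x|lborel. exp (of_real \<sigma> * exp (ray x)) * exp (ray x) * q x) \<le> pi * C * ray_const \<theta> (1 + a) * \<sigma> powr (- (1 + a))"
    and "q \<in> borel_measurable borel \<Longrightarrow> integrable lborel (\<lambda>x. exp (of_real \<sigma> * exp (ray x)) * exp (ray x) * q x)"
proof -
  have I: "integrable lborel (\<lambda>x. C * (exp (- (c * (\<sigma> * exp x))) * exp ((1 + a) * x)))"
    using integrable_exp_exp[OF a c_bounds(1)] integral_exp_exp_scale(1)[OF sg, of c "1 + a"] by simp
  have "norm (LINT x|lborel. exp (of_real \<sigma> * exp (ray x)) * exp (ray x) * q x)
      \<le> (LINT x|lborel. C * (exp (- (c * (\<sigma> * exp x))) * exp ((1 + a) * x)))"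
    by (intro norm_integral_le I integrand_bound[OF sg q])
  also have "\<dots> = pi * C * ray_const \<theta> (1 + a) * \<sigma> powr (- (1 + a))"
    unfolding integral_mult_right_zero integral_exp_exp_scale(2)[OF sg] by (simp add: ray_const_def c_def)
  finally show "norm (LINT x|lborel. exp (of_real \<sigma> * exp (ray x)) * exp (ray x) * q x) \<le> pi * C * ray_const \<theta> (1 + a) * \<sigma> powr (- (1 + a))" .
  assume [measurable]: "q \<in> borel_measurable borel"
  show "integrable lborel (\<lambda>x. exp (of_real \<sigma> * exp (ray x)) * exp (ray x) * q x)"
  proof (rule Bochner_Integration.integrable_bound[OF I])
    have "norm (exp (of_real \<sigma> * exp (ray x)) * exp (ray x) * q x) \<le> norm (C * (exp (- (c * (\<sigma> * exp x))) * exp ((1 + a) * x)))" for x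
      using integrand_bound[OF sg q[of x]] unfolding real_norm_def by linarith
    then show "AE x in lborel. norm (exp (of_real \<sigma> * exp (ray x)) * exp (ray x) * q x) \<le> norm (C * (exp (- (c * (\<sigma> * exp x))) * exp ((1 + a) * x)))"
      by simp
  qed measurable
qed

lemma ray_bound1: "0 < \<sigma> \<Longrightarrow> \<bar>ray_transform \<theta> \<Phi> \<sigma>\<bar> \<le> ray_const \<theta> (1 - s) * C1 * \<sigma> powr (s - 1)"
proof -
  assume sg: "0 < \<sigma>"
  have "\<bar>Im (LINT x|lborel. exp (of_real \<sigma> * exp (ray x)) * exp (ray x) * \<Phi> (ray x))\<bar> \<le> pi * C1 * ray_const \<theta> (1 + - s) * \<sigma> powr (- (1 + - s))"
    by (rule order_trans[OF abs_Im_le_cmod], rule integral_bound(1)) (use sg s b1[of "ray _"] theta_pos in auto)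
  then show ?thesis by (simp add: ray_transform_def field_simps)
qed

text \<open>Along the ray the integrand has the antiderivative exp(\<sigma> exp z)/\<sigma>, which
  runs from 1/\<sigma> to 0. What matters later is that the value is real.\<close>

lemma integral_ray_exp:
  assumes sg: "0 < \<sigma>"
  shows "(LINT x|lborel. exp (of_real \<sigma> * exp (ray x)) * exp (ray x)) = - 1 / of_real \<sigma>"
proof -
  have I: "integrable lborel (\<lambda>x. exp (of_real \<sigma> * exp (ray x)) * exp (ray x) * 1)"
    using sg by (intro integral_bound(2)[where a=0 and C=1]) auto
  have "(LBINT x=-\<infinity>..\<infinity>. exp (of_real \<sigma> * exp (ray x)) * exp (ray x)) = 0 - 1 / of_real \<sigma>"
  proof (rule interval_integral_FTC_integrable)
    have R: "(ray has_vector_derivative 1) (at x)" for x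
      by (auto simp: Complex_eq intro!: derivative_eq_intros)
    show "((\<lambda>x. exp (of_real \<sigma> * exp (ray x)) / of_real \<sigma>) has_vector_derivative exp (of_real \<sigma> * exp (ray x)) * exp (ray x)) (at x)" for x
    proof -
      have "((\<lambda>z. exp (of_real \<sigma> * exp z) / of_real \<sigma>) has_field_derivative exp (of_real \<sigma> * exp (ray x)) * exp (ray x)) (at (ray x))"
        using sg by (auto intro!: derivative_eq_intros)
      from field_vector_diff_chain_at[OF R this] show ?thesis by (simp add: o_def)
    qed
    have "isCont ray x" for x using R by (rule has_vector_derivative_continuous)
    then show "isCont (\<lambda>x. exp (of_real \<sigma> * exp (ray x)) * exp (ray x)) x" for x by (intro continuous_intros)
    show "set_integrable lborel (einterval (- \<infinity>) \<infinity>) (\<lambda>x. exp (of_real \<sigma> * exp (ray x)) * exp (ray x))"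
      using I by (simp add: set_integrable_def)
    have "((\<lambda>x::real. exp x) \<longlongrightarrow> 0) at_bot" by real_asymp
    then have "((\<lambda>x. exp (ray x)) \<longlongrightarrow> 0) at_bot"
      by (intro tendsto_norm_zero_cancel[of "\<lambda>x. exp (ray x)"]) (simp add: norm_exp_eq_Re)
    then have "((\<lambda>x. exp (of_real \<sigma> * exp (ray x)) / of_real \<sigma>) \<longlongrightarrow> exp (of_real \<sigma> * 0) / of_real \<sigma>) at_bot"
      using sg by (intro tendsto_intros) auto
    then show "(((\<lambda>x. exp (of_real \<sigma> * exp (ray x)) / of_real \<sigma>) \<circ> real_of_ereal) \<longlongrightarrow> 1 / of_real \<sigma>) (at_right (- \<infinity>))"
      by (simp add: ereal_tendsto_simps)
    have "((\<lambda>x. exp (- (c * \<sigma> * exp x))) \<longlongrightarrow> 0) at_top" using c_bounds(1) sg by real_asymp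
    then have "((\<lambda>x. exp (of_real \<sigma> * exp (ray x)) / of_real \<sigma>) \<longlongrightarrow> 0) at_top"
      by (intro tendsto_norm_zero_cancel[of "\<lambda>x. exp (of_real \<sigma> * exp (ray x)) / of_real \<sigma>"])
         (auto simp: norm_divide norm_exp_eq_Re Re_exp c_def mult_ac intro!: tendsto_divide_zero)
    then show "(((\<lambda>x. exp (of_real \<sigma> * exp (ray x)) / of_real \<sigma>) \<circ> real_of_ereal) \<longlongrightarrow> 0) (at_left \<infinity>)"
      by (simp add: ereal_tendsto_simps)
  qed auto
  then show ?thesis by (simp add: interval_lebesgue_integral_def set_lebesgue_integral_def)
qed

text \<open>Replacing \<Phi> by \<Phi> - \<Phi>0 changes the ray integral by a real number,
  invisible to the imaginary part. The difference obeys \<open>b2\<close>, and its growth exponent s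
  turns into two-sided control at large \<sigma>.\<close>

lemma ray_bound2: "0 < \<sigma> \<Longrightarrow> \<bar>ray_transform \<theta> \<Phi> \<sigma>\<bar> \<le> ray_const \<theta> (1 + s) * C2 * \<sigma> powr (- 1 - s)"
proof -
  assume sg: "0 < \<sigma>"
  let ?e = "\<lambda>x. exp (of_real \<sigma> * exp (ray x)) * exp (ray x)"
  have i1: "integrable lborel (\<lambda>x. ?e x * \<Phi> (ray x))"
    using sg by (intro integral_bound(2)[where a=0 and C=C0]) (use b0[of "ray _"] theta_pos in auto)
  have i2: "integrable lborel (\<lambda>x. ?e x * of_real \<Phi>0)"
    using sg by (intro integral_bound(2)[where a=0 and C="\<bar>\<Phi>0\<bar>"]) auto
  have "(LINT x|lborel. ?e x * (\<Phi> (ray x) - of_real \<Phi>0)) = (LINT x|lborel. ?e x * \<Phi> (ray x)) - (LINT x|lborel. ?e x * of_real \<Phi>0)"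
    unfolding right_diff_distrib by (rule Bochner_Integration.integral_diff[OF i1 i2])
  also have "(LINT x|lborel. ?e x * of_real \<Phi>0) = of_real (- \<Phi>0 / \<sigma>)"
    using integral_ray_exp[OF sg] by simp
  finally have "Im (LINT x|lborel. ?e x * \<Phi> (ray x)) = Im (LINT x|lborel. ?e x * (\<Phi> (ray x) - of_real \<Phi>0))"
    by simp
  moreover have "\<bar>Im (LINT x|lborel. ?e x * (\<Phi> (ray x) - of_real \<Phi>0))\<bar> \<le> pi * C2 * ray_const \<theta> (1 + s) * \<sigma> powr (- (1 + s))"
    by (rule order_trans[OF abs_Im_le_cmod], rule integral_bound(1)) (use sg s b2[of "ray _"] theta_pos in auto)
  ultimately show ?thesis by (simp add: ray_transform_def field_simps)
qed

text \<open>The integrand at \<sigma> is dominated by the one at any smaller a > 0 but by nothing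
  uniform up to \<sigma> = 0; continuity is therefore proved on each half-line beyond a and then
  glued.\<close>

lemma ray_continuous: "continuous_on {0<..} (ray_transform \<theta> \<Phi>)"
proof -
  let ?f = "\<lambda>\<sigma> x. exp (of_real \<sigma> * exp (ray x)) * exp (ray x) * \<Phi> (ray x)"
  have "continuous_on {a<..} (\<lambda>\<sigma>. LINT x|lborel. ?f \<sigma> x)" if a: "0 < a" for a :: real
    unfolding continuous_on_sequentially o_def
  proof safe
    fix u :: "nat \<Rightarrow> real" and l assume u: "\<forall>n. u n \<in> {a<..}" "u \<longlonglongrightarrow> l"
    show "(\<lambda>n. LINT x|lborel. ?f (u n) x) \<longlonglongrightarrow> (LINT x|lborel. ?f l x)"
    proof (rule integral_dominated_convergence)
      show "integrable lborel (\<lambda>x. C0 * (exp (- (c * (a * exp x))) * exp ((1 + 0) * x)))"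
        using integrable_exp_exp[of 1 c] c_bounds(1) integral_exp_exp_scale(1)[OF a, of c "1"] by simp
      show "AE x in lborel. norm (?f (u n) x) \<le> C0 * (exp (- (c * (a * exp x))) * exp ((1 + 0) * x))" for n
      proof (rule AE_I2)
        fix x
        have "norm (?f (u n) x) \<le> C0 * (exp (- (c * (u n * exp x))) * exp ((1 + 0) * x))"
          using u a b0[of "ray x"] theta_pos by (intro integrand_bound) (auto intro: less_trans)
        also have "\<dots> \<le> C0 * (exp (- (c * (a * exp x))) * exp ((1 + 0) * x))"
          using u(1)[rule_format, of n] c_bounds C_nonneg by (intro mult_left_mono mult_right_mono) auto
        finally show "norm (?f (u n) x) \<le> C0 * (exp (- (c * (a * exp x))) * exp ((1 + 0) * x))" .
      qed
      show "AE x in lborel. (\<lambda>n. ?f (u n) x) \<longlonglongrightarrow> ?f l x"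
        using u(2) by (intro AE_I2 tendsto_intros)
    qed measurable
  qed
  then have "isCont (\<lambda>\<sigma>. LINT x|lborel. ?f \<sigma> x) \<sigma>" if "0 < \<sigma>" for \<sigma>
    using continuous_on_interior[of "{\<sigma>/2<..}" "\<lambda>\<sigma>. LINT x|lborel. ?f \<sigma> x" \<sigma>] that by (simp add: interior_open)
  then show ?thesis
    unfolding ray_transform_def[abs_def]
    by (intro continuous_at_imp_continuous_on ballI continuous_intros) auto
qed

text \<open>This is what the Laplace transform in \<sigma> leaves of the ray integrand, since
  exp(-m\<sigma>) exp(\<sigma> exp z) integrates over \<sigma> > 0 to 1/(m - exp z).\<close>

definition pole_int :: "real \<Rightarrow> complex \<Rightarrow> complex" where
  "pole_int m z = exp z * \<Phi> z / (of_real m - exp z)"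

lemma exp_eq_real_strip:
  assumes "exp z = of_real m" "\<bar>Im z\<bar> \<le> \<theta>" "0 < m"
  shows "z = of_real (ln m)"
proof -
  have "exp z = exp (of_real (ln m))" using assms by (simp add: exp_of_real)
  moreover have "\<bar>Im z - Im (of_real (ln m))\<bar> < 2 * pi" using assms theta by auto
  ultimately show ?thesis by (rule exp_complex_eqI[rotated])
qed

text \<open>The only pole of \<open>pole_int m\<close> in the strip is ln m. It is simple, and its
  residue is -\<Phi>(ln m), because the derivative of m - exp z there is -m and cancels the factor
  exp z up to sign.\<close>

lemma cauchy_strip:
  assumes m: "0 < m" and X: "\<bar>ln m\<bar> < X"
  shows "contour_integral (rectpath (Complex (-X) (-\<theta>)) (Complex X \<theta>)) (pole_int m) = - (2 * pi * \<i> * \<Phi> (of_real (ln m)))"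
proof -
  let ?L = "of_real (ln m) :: complex" and ?S = "{z. \<bar>Im z\<bar> \<le> \<theta>}"
  \<comment> \<open>The difference quotient of \<open>exp\<close> at ln m, with its removable
    singularity filled in, gives m - exp z = -q(z)(z - ln m) with q free of zeros in the strip. This
    puts \<open>pole_int\<close> in the form H(z)/(z - ln m) of Cauchy's formula.\<close>
  define q where "q z = (if z = ?L then deriv exp ?L else (exp z - exp ?L) / (z - ?L))" for z
  have L: "exp ?L = of_real m" using m by (simp add: exp_of_real)
  have qh: "q holomorphic_on UNIV" unfolding q_def[abs_def] by (rule pole_lemma) (auto intro!: holomorphic_intros)
  have qL: "q ?L = of_real m" unfolding q_def L[symmetric] by (simp add: DERIV_imp_deriv[OF DERIV_exp])
  have q0: "q z \<noteq> 0" if "z \<in> ?S" for z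
    using exp_eq_real_strip[of z m] that m L qL by (cases "z = ?L") (auto simp: q_def)
  define H where "H z = - (exp z * \<Phi> z / q z)" for z
  have H: "H holomorphic_on ?S"
    unfolding H_def by (intro holomorphic_intros holo holomorphic_on_subset[OF qh]) (use q0 in auto)
  have Lb: "?L \<in> box (Complex (-X) (-\<theta>)) (Complex X \<theta>)"
    using X theta_pos by (auto simp: in_box_complex_iff)
  have less: "-X < X" "-\<theta> < \<theta>" using X theta_pos by auto
  have "cbox (Complex (-X) (-\<theta>)) (Complex X \<theta>) \<subseteq> ?S" by (auto simp: in_cbox_complex_iff)
  then have sub: "path_image (rectpath (Complex (-X) (-\<theta>)) (Complex X \<theta>)) \<subseteq> ?S - {?L}"
    using path_image_rectpath_subset_cbox[of "Complex (-X) (-\<theta>)" "Complex X \<theta>"] 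
      path_image_rectpath_inter_box[of "Complex (-X) (-\<theta>)" "Complex X \<theta>"] Lb less by auto
  have op: "open {z. \<bar>Im z\<bar> < \<theta>}" by (intro open_Collect_less continuous_intros)
  have conv: "convex ?S"
  proof -
    have "?S = {z. Im z \<le> \<theta>} \<inter> {z. Im z \<ge> - \<theta>}" by auto
    then show ?thesis by (simp add: convex_Int convex_halfspace_Im_le convex_halfspace_Im_ge)
  qed
  have "((\<lambda>z. H z / (z - ?L)) has_contour_integral
      2 * pi * \<i> * winding_number (rectpath (Complex (-X) (-\<theta>)) (Complex X \<theta>)) ?L * H ?L) (rectpath (Complex (-X) (-\<theta>)) (Complex X \<theta>))"
  proof (rule Cauchy_integral_formula_convex_simple[OF conv H _ _ sub])
    have "?L \<in> {z. \<bar>Im z\<bar> < \<theta>}" using theta_pos by simp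
    moreover have "{z. \<bar>Im z\<bar> < \<theta>} \<subseteq> interior ?S" by (rule interior_maximal) (use op in auto)
    ultimately show "?L \<in> interior ?S" by blast
  qed auto
  then have "((\<lambda>z. H z / (z - ?L)) has_contour_integral - (2 * pi * \<i> * \<Phi> ?L)) (rectpath (Complex (-X) (-\<theta>)) (Complex X \<theta>))"
    using m by (simp add: winding_number_rectpath[OF Lb] H_def qL L)
  then have "(pole_int m has_contour_integral - (2 * pi * \<i> * \<Phi> ?L)) (rectpath (Complex (-X) (-\<theta>)) (Complex X \<theta>))"
  proof (rule has_contour_integral_eq)
    fix z assume "z \<in> path_image (rectpath (Complex (-X) (-\<theta>)) (Complex X \<theta>))"
    then have z: "z \<in> ?S" "z \<noteq> ?L" using sub by auto
    have "of_real m - exp z = - (q z * (z - ?L))" using z by (simp add: q_def L)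
    then show "H z / (z - ?L) = pole_int m z" using q0[OF z(1)] z by (simp add: H_def pole_int_def)
  qed
  then show ?thesis by (rule contour_integral_unique)
qed

lemma pole_int_sym: "\<bar>Im z\<bar> \<le> \<theta> \<Longrightarrow> pole_int m (cnj z) = cnj (pole_int m z)"
  by (simp add: pole_int_def sym exp_cnj)

lemma pole_int_cont:
  assumes "0 < m"
  shows "continuous_on ({z. \<bar>Im z\<bar> \<le> \<theta>} - {of_real (ln m)}) (pole_int m)"
  unfolding pole_int_def[abs_def]
  by (intro continuous_intros continuous_on_subset[OF cont])
     (use exp_eq_real_strip[OF _ _ assms] in \<open>auto simp: eq_commute[of "of_real m"]\<close>)

text \<open>The values on the lower edge are the conjugates of those on the upper edge, which is run
  in the opposite direction. The two edges together contribute -2i times the imaginary part of the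
  upper integral, and X > |ln m| keeps the pole inside.\<close>

lemma pole_int_contour:
  assumes m: "0 < m" and X: "\<bar>ln m\<bar> < X"
  shows "2 * \<i> * Im (integral {-X..X} (\<lambda>x. pole_int m (ray x)))
     = 2 * pi * \<i> * \<Phi> (of_real (ln m))
        + contour_integral (linepath (Complex X (-\<theta>)) (Complex X \<theta>)) (pole_int m)
        + contour_integral (linepath (Complex (-X) \<theta>) (Complex (-X) (-\<theta>))) (pole_int m)"
proof -
  let ?a = "Complex (-X) (-\<theta>)" and ?b = "Complex X (-\<theta>)" and ?c = "Complex X \<theta>" and ?d = "Complex (-X) \<theta>"
  let ?S = "{z. \<bar>Im z\<bar> \<le> \<theta>} - {of_real (ln m)}"
  have X0: "-X < X" using X by linarith
  have sub: "closed_segment ?a ?b \<subseteq> ?S" "closed_segment ?b ?c \<subseteq> ?S" "closed_segment ?d ?c \<subseteq> ?S" "closed_segment ?d ?a \<subseteq> ?S"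
    using X theta_pos
    by (auto simp: closed_segment_same_Im closed_segment_same_Re closed_segment_eq_real_ivl)
  note ci = continuous_on_subset[OF pole_int_cont[OF m]]
  have int: "pole_int m contour_integrable_on linepath ?a ?b" "pole_int m contour_integrable_on linepath ?b ?c"
     "pole_int m contour_integrable_on linepath ?c ?d" "pole_int m contour_integrable_on linepath ?d ?a"
    using ci[OF sub(1)] ci[OF sub(2)] ci[OF sub(3)] ci[OF sub(4)] ci[OF sub(3)[unfolded closed_segment_commute[of ?d ?c]]]
    by (auto intro: contour_integrable_continuous_linepath)
  have "- (2 * pi * \<i> * \<Phi> (of_real (ln m))) = contour_integral (rectpath ?a ?c) (pole_int m)"
    by (rule cauchy_strip[OF m X, symmetric])
  also have "\<dots> = contour_integral (linepath ?a ?b) (pole_int m) + (contour_integral (linepath ?b ?c) (pole_int m) +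
      (contour_integral (linepath ?c ?d) (pole_int m) + contour_integral (linepath ?d ?a) (pole_int m)))"
    using int by (simp add: rectpath_def Let_def contour_integrable_joinI)
  also have "contour_integral (linepath ?c ?d) (pole_int m) = - contour_integral (linepath ?d ?c) (pole_int m)"
    using sub(3) by (intro contour_integral_reverse_linepath ci) (simp add: closed_segment_commute)
  also have "contour_integral (linepath ?d ?c) (pole_int m) = integral {-X..X} (\<lambda>x. pole_int m (ray x))"
    using X0 sub(3) by (intro contour_integral_linepath_same_Im ci) auto
  also have "contour_integral (linepath ?a ?b) (pole_int m) = integral {-X..X} (\<lambda>x. pole_int m (Complex x (-\<theta>)))"
    using X0 sub(1) by (intro contour_integral_linepath_same_Im ci) auto
  also have "\<dots> = integral {-X..X} (\<lambda>x. cnj (pole_int m (ray x)))"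
    by (intro arg_cong[where f="integral _"] ext) (simp add: pole_int_sym[symmetric] theta_pos less_imp_le complex_cnj)
  also have "\<dots> = cnj (integral {-X..X} (\<lambda>x. pole_int m (ray x)))" by (rule integral_cnj[symmetric])
  finally show ?thesis by (simp add: complex_eq_iff algebra_simps)
qed

text \<open>On the ray m - exp z has real part m + c exp x. Bounding this below by m for negative x
  and by c exp x otherwise, and using \<open>b0\<close> and \<open>b1\<close> respectively, yields
  decay of order exp(-s|x|) on both sides. The first integrand is also the absolute integral over
  \<sigma> that Fubini asks for later.\<close>

lemma pole_int_ray:
  assumes m: "0 < m"
  shows "integrable lborel (\<lambda>x. exp x * norm (\<Phi> (ray x)) / (m + c * exp x))"
    and "integrable lborel (\<lambda>x. pole_int m (ray x))"
proof -
  define K where "K = max (C0 / m) (C1 / c)"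
  have K: "C0 \<le> K * m" "C1 \<le> K * c" "0 \<le> K"
    using c_bounds m C_nonneg by (auto simp: K_def field_simps max_def)
  have I: "integrable lborel (\<lambda>x. K * exp (- s * \<bar>x\<bar>))" using integrable_exp_abs[OF s(1)] by simp
  have b: "exp x * norm (\<Phi> (ray x)) / (m + c * exp x) \<le> K * exp (- s * \<bar>x\<bar>)" for x
  proof (cases "x \<ge> 0")
    case True
    have "exp x * norm (\<Phi> (ray x)) \<le> exp x * (K * c * exp (- s * x))"
      using b1[of "ray x"] theta_pos K(2)
      by (intro mult_left_mono) (auto intro: order_trans[OF _ mult_right_mono[OF K(2)]])
    also have "\<dots> \<le> K * exp (- s * x) * (m + c * exp x)"
      using K(3) m by (simp add: algebra_simps)
    finally show ?thesis using True m c_bounds by (simp add: divide_le_eq add_pos_pos)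
  next
    case False
    have "exp x * norm (\<Phi> (ray x)) \<le> exp x * (K * m)"
      using b0[of "ray x"] theta_pos K(1) by (intro mult_left_mono) auto
    also have "\<dots> \<le> exp (s * x) * (K * m)"
      using K m False s mult_right_mono_neg[of s 1 x] by (intro mult_right_mono) (auto intro: mult_nonneg_nonneg)
    also have "\<dots> \<le> K * exp (s * x) * (m + c * exp x)"
      using K(3) c_bounds by (simp add: algebra_simps)
    finally show ?thesis using False m c_bounds by (simp add: divide_le_eq add_pos_pos)
  qed
  have pos: "m + c * exp x > 0" for x using m c_bounds by (simp add: add_pos_pos)
  show A: "integrable lborel (\<lambda>x. exp x * norm (\<Phi> (ray x)) / (m + c * exp x))"
  proof (rule Bochner_Integration.integrable_bound[OF I])
    show "AE x in lborel. norm (exp x * norm (\<Phi> (ray x)) / (m + c * exp x)) \<le> norm (K * exp (- s * \<bar>x\<bar>))"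
      using b pos K(3) by (intro AE_I2) (simp add: less_imp_le)
  qed measurable
  show "integrable lborel (\<lambda>x. pole_int m (ray x))"
  proof (rule Bochner_Integration.integrable_bound[OF A])
    have "norm (pole_int m (ray x)) \<le> exp x * norm (\<Phi> (ray x)) / (m + c * exp x)" for x
    proof -
      have "m + c * exp x = Re (of_real m - exp (ray x))" by (simp add: Re_exp c_def)
      also have "\<dots> \<le> norm (of_real m - exp (ray x))" by (rule complex_Re_le_cmod)
      finally show ?thesis using pos[of x]
        by (auto simp: pole_int_def norm_mult norm_divide norm_exp_eq_Re intro!: divide_left_mono mult_pos_pos)
    qed
    then show "AE x in lborel. norm (pole_int m (ray x)) \<le> norm (exp x * norm (\<Phi> (ray x)) / (m + c * exp x))"
      using pos by (intro AE_I2) (simp add: less_imp_le)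
    show "(\<lambda>x. pole_int m (ray x)) \<in> borel_measurable lborel" unfolding pole_int_def by measurable
  qed
qed

end

section \<open>Integrals of functions with power bounds at 0 and at infinity\<close>

lemma powr_from_0:
  fixes a p :: real
  assumes "p > -1" "0 < a"
  shows "set_integrable lborel {0<..a} (\<lambda>x. x powr p)" "(LINT x:{0<..a}|lborel. x powr p) = a powr (p + 1) / (p + 1)"
proof -
  have h: "((\<lambda>x. x powr p) has_integral (a powr (p + 1) / (p + 1))) {0<..a}"
    using has_integral_powr_from_0[of p a] assms
    by (subst has_integral_spike_set_eq[where T="{0..a}"]) (auto intro: negligible_subset[of "{0}"])
  then have "(\<lambda>x. x powr p) absolutely_integrable_on {0<..a}"
    by (intro nonnegative_absolutely_integrable_1) auto
  then show i: "set_integrable lborel {0<..a} (\<lambda>x. x powr p)"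
    unfolding set_integrable_def by (subst (asm) integrable_completion) auto
  show "(LINT x:{0<..a}|lborel. x powr p) = a powr (p + 1) / (p + 1)"
    using set_borel_integral_eq_integral(2)[OF i] h by (simp add: has_integral_iff)
qed

lemma powr_to_inf:
  fixes a q :: real
  assumes "q > 1" "0 < a"
  shows "set_integrable lborel {a<..} (\<lambda>x. x powr (- q))" "(LINT x:{a<..}|lborel. x powr (- q)) = a powr (1 - q) / (q - 1)"
proof -
  have "- (a powr (- q + 1)) / (- q + 1) = a powr (1 - q) / (q - 1)"
    using minus_divide_divide[of "a powr (1 - q)" "q - 1"] by (simp only: minus_diff_eq uminus_add_conv_diff)
  then have "((\<lambda>x. x powr (- q)) has_integral (a powr (1 - q) / (q - 1))) {a..}"
    using has_integral_powr_to_inf[of "-q" a] assms by simp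
  then have h: "((\<lambda>x. x powr (- q)) has_integral (a powr (1 - q) / (q - 1))) {a<..}"
    by (subst has_integral_spike_set_eq[where T="{a..}"]) (auto intro: negligible_subset[of "{a}"])
  then have "(\<lambda>x. x powr (- q)) absolutely_integrable_on {a<..}"
    by (intro nonnegative_absolutely_integrable_1) auto
  then show i: "set_integrable lborel {a<..} (\<lambda>x. x powr (- q))"
    unfolding set_integrable_def by (subst (asm) integrable_completion) auto
  show "(LINT x:{a<..}|lborel. x powr (- q)) = a powr (1 - q) / (q - 1)"
    using set_borel_integral_eq_integral(2)[OF i] h by (simp add: has_integral_iff)
qed

text \<open>The split point stays free so that it can be adapted to the scale of the problem:
  t^(1/s) for the stable density, |h|^2 for differences of the resolvent.\<close>

lemma split_power_bound:
  fixes h :: "real \<Rightarrow> real" and a A B p q :: real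
  assumes m: "set_borel_measurable lborel {0<..} h" and a: "0 < a" and p: "p > -1" and q: "q > 1"
    and h1: "\<And>x. 0 < x \<Longrightarrow> x \<le> a \<Longrightarrow> \<bar>h x\<bar> \<le> A * x powr p"
    and h2: "\<And>x. a < x \<Longrightarrow> \<bar>h x\<bar> \<le> B * x powr (- q)"
  shows "set_integrable lborel {0<..} h"
    and "(LINT x:{0<..}|lborel. \<bar>h x\<bar>) \<le> A * a powr (p + 1) / (p + 1) + B * a powr (1 - q) / (q - 1)"
    and "\<bar>LINT x:{0<..}|lborel. h x\<bar> \<le> A * a powr (p + 1) / (p + 1) + B * a powr (1 - q) / (q - 1)"
proof -
  let ?w = "\<lambda>x. indicator {0<..a} x *\<^sub>R (A * x powr p) + indicator {a<..} x *\<^sub>R (B * x powr (- q))"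
  have i1: "integrable lborel (\<lambda>x. indicator {0<..a} x *\<^sub>R (A * x powr p))"
    using powr_from_0(1)[OF p a] set_integrable_mult_right[of A lborel "{0<..a}"] by (simp add: set_integrable_def)
  have i2: "integrable lborel (\<lambda>x. indicator {a<..} x *\<^sub>R (B * x powr (- q)))"
    using powr_to_inf(1)[OF q a] set_integrable_mult_right[of B lborel "{a<..}"] by (simp add: set_integrable_def)
  have i: "integrable lborel ?w" using i1 i2 by (rule Bochner_Integration.integrable_add)
  have le: "\<bar>indicator {0<..} x *\<^sub>R h x\<bar> \<le> ?w x" for x
    using h1[of x] h2[of x] a by (auto simp: indicator_def)
  have w0: "0 \<le> ?w x" for x using le[of x] by linarith
  show I: "set_integrable lborel {0<..} h"
    unfolding set_integrable_def
    using m le w0 by (intro Bochner_Integration.integrable_bound[OF i]) (auto simp: set_borel_measurable_def)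
  have "(LINT x:{0<..}|lborel. \<bar>h x\<bar>) \<le> (LINT x|lborel. ?w x)"
    unfolding set_lebesgue_integral_def
  proof (rule integral_mono[OF _ i])
    show "integrable lborel (\<lambda>x. indicator {0<..} x *\<^sub>R \<bar>h x\<bar>)"
      using set_integrable_abs[OF I] by (simp add: set_integrable_def)
    show "indicat_real {0<..} x *\<^sub>R \<bar>h x\<bar> \<le> ?w x" for x using le[of x] by (simp add: abs_mult)
  qed
  also have "\<dots> = (LINT x:{0<..a}|lborel. A * x powr p) + (LINT x:{a<..}|lborel. B * x powr (- q))"
    unfolding set_lebesgue_integral_def by (rule Bochner_Integration.integral_add[OF i1 i2])
  also have "\<dots> = A * a powr (p + 1) / (p + 1) + B * a powr (1 - q) / (q - 1)"
    by (simp add: powr_from_0(2)[OF p a] powr_to_inf(2)[OF q a])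
  finally show *: "(LINT x:{0<..}|lborel. \<bar>h x\<bar>) \<le> A * a powr (p + 1) / (p + 1) + B * a powr (1 - q) / (q - 1)" .
  have "\<bar>LINT x:{0<..}|lborel. h x\<bar> \<le> (LINT x:{0<..}|lborel. \<bar>h x\<bar>)"
    using set_integral_norm_bound[OF I] by simp
  with * show "\<bar>LINT x:{0<..}|lborel. h x\<bar> \<le> A * a powr (p + 1) / (p + 1) + B * a powr (1 - q) / (q - 1)"
    by linarith
qed

lemma integral_exp_real:
  fixes a :: real
  assumes "0 < a"
  shows "set_integrable lborel {0<..} (\<lambda>x. exp (- a * x))" "(LINT x:{0<..}|lborel. exp (- a * x)) = 1 / a"
proof -
  have w: "0 < Re (of_real a)" using assms by simp
  have eq: "exp (- of_real a * of_real x) = complex_of_real (exp (- a * x))" for x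
    by (simp add: exp_of_real[symmetric])
  show "set_integrable lborel {0<..} (\<lambda>x. exp (- a * x))"
    using has_integral_exp_complex(1)[OF w] unfolding eq set_integrable_def scaleR_conv_of_real of_real_mult[symmetric] complex_of_real_integrable_eq by simp
  show "(LINT x:{0<..}|lborel. exp (- a * x)) = 1 / a"
    using has_integral_exp_complex(2)[OF w] unfolding eq set_integral_complex_of_real
    by (metis of_real_1 of_real_divide of_real_eq_iff)
qed

section \<open>The Laplace transform of a ray transform\<close>

context sectorial
begin

text \<open>The rectangle of Cauchy's formula is stretched to the whole strip. On the right edge
  \<open>b1\<close> leaves O(exp(-sn)), on the left edge \<open>b0\<close> leaves O(exp(-n)), and
  both edges have the fixed length 2\<theta>.\<close>

lemma pole_int_integral:
  assumes m: "0 < m"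
  shows "Im (LINT x|lborel. pole_int m (ray x)) = pi * Re (\<Phi> (of_real (ln m)))"
proof -
  let ?P = "\<lambda>x. pole_int m (ray x)"
  define I where "I n = integral {- real n..real n} ?P" for n
  define U where "U n = contour_integral (linepath (Complex (real n) (-\<theta>)) (Complex (real n) \<theta>)) (pole_int m)
        + contour_integral (linepath (Complex (- real n) \<theta>) (Complex (- real n) (-\<theta>))) (pole_int m)" for n
  have Ieq: "I n = (LINT x|lborel. indicator {- real n..real n} x *\<^sub>R ?P x)" for n
  proof -
    have "set_integrable lborel {- real n..real n} ?P"
      unfolding set_integrable_def using pole_int_ray(2)[OF m] by (intro integrable_mult_indicator) auto
    from set_borel_integral_eq_integral(2)[OF this] show ?thesis
      by (simp add: I_def set_lebesgue_integral_def)
  qed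
  have "I \<longlonglongrightarrow> (LINT x|lborel. ?P x)"
    unfolding Ieq
  proof (rule integral_dominated_convergence[where w="\<lambda>x. norm (?P x)"])
    note pole_int_ray(2)[OF m, THEN borel_measurable_integrable, measurable]
    show "(\<lambda>x. ?P x) \<in> borel_measurable lborel" by measurable
    show "(\<lambda>x. indicator {- real n..real n} x *\<^sub>R ?P x) \<in> borel_measurable lborel" for n by measurable
    show "integrable lborel (\<lambda>x. norm (?P x))" using pole_int_ray(2)[OF m] by simp
    have "(\<lambda>n. indicator {- real n..real n} x *\<^sub>R ?P x) \<longlonglongrightarrow> ?P x" for x
    proof (rule tendsto_eventually)
      show "eventually (\<lambda>n. indicator {- real n..real n} x *\<^sub>R ?P x = ?P x) sequentially"
        using eventually_ge_at_top[of "nat \<lceil>\<bar>x\<bar>\<rceil>"]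
      proof eventually_elim
        case (elim n)
        then have "\<bar>x\<bar> \<le> real n" by linarith
        then show ?case by (simp add: indicator_def abs_le_iff minus_le_iff)
      qed
    qed
    then show "AE x in lborel. (\<lambda>n. indicator {- real n..real n} x *\<^sub>R ?P x) \<longlonglongrightarrow> ?P x" by simp
    show "AE x in lborel. norm (indicator {- real n..real n} x *\<^sub>R ?P x) \<le> norm (?P x)" for n
      by (intro AE_I2) (simp add: indicator_def)
  qed
  then have lim1: "(\<lambda>n. 2 * \<i> * of_real (Im (I n))) \<longlonglongrightarrow> 2 * \<i> * of_real (Im (LINT x|lborel. ?P x))"
    by (intro tendsto_intros)
  have "U \<longlonglongrightarrow> 0"
  proof (rule tendsto_norm_zero_cancel, rule tendsto_sandwich[OF _ _ tendsto_const])
    let ?B = "\<lambda>n. C1 * exp ((1 - s) * real n) / (exp (real n) - m) * (2 * \<theta>) + C0 * exp (- real n) / (m - exp (- real n)) * (2 * \<theta>)"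
    have "eventually (\<lambda>n::nat. exp (- real n) < m) sequentially" using m by real_asymp
    moreover have "eventually (\<lambda>n::nat. exp (real n) > m) sequentially" using m by real_asymp
    moreover have "eventually (\<lambda>n::nat. real n > \<bar>ln m\<bar>) sequentially" by real_asymp
    ultimately show "eventually (\<lambda>n. norm (U n) \<le> ?B n) sequentially"
    proof eventually_elim
      case (elim n)
      note ci = continuous_on_subset[OF pole_int_cont[OF m]]
      have seg: "Re z = x \<and> \<bar>Im z\<bar> \<le> \<theta>" if "z \<in> closed_segment (Complex x (-\<theta>)) (Complex x \<theta>)" for x z
        using that theta_pos by (auto simp: closed_segment_same_Re closed_segment_eq_real_ivl)
      have sub: "closed_segment (Complex x (-\<theta>)) (Complex x \<theta>) \<subseteq> {z. \<bar>Im z\<bar> \<le> \<theta>} - {of_real (ln m)}"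
        if "x \<noteq> ln m" for x using seg[of _ x] that by fastforce
      have A: "norm (contour_integral (linepath (Complex (real n) (-\<theta>)) (Complex (real n) \<theta>)) (pole_int m))
         \<le> C1 * exp ((1 - s) * real n) / (exp (real n) - m) * norm (Complex (real n) \<theta> - Complex (real n) (-\<theta>))"
      proof (rule contour_integral_bound_linepath)
        show "pole_int m contour_integrable_on linepath (Complex (real n) (- \<theta>)) (ray (real n))"
          using elim by (intro contour_integrable_continuous_linepath ci sub) auto
        show "0 \<le> C1 * exp ((1 - s) * real n) / (exp (real n) - m)" using C_nonneg elim by simp
        fix z assume "z \<in> closed_segment (Complex (real n) (- \<theta>)) (ray (real n))"
        then have z: "Re z = real n" "\<bar>Im z\<bar> \<le> \<theta>" using seg by auto
        have "norm (exp z) - norm (of_real m :: complex) \<le> norm (of_real m - exp z)" by (metis norm_minus_commute norm_triangle_ineq2)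
        then have d: "exp (real n) - m \<le> norm (of_real m - exp z)" using z m by (simp add: norm_exp_eq_Re)
        have "norm (pole_int m z) = exp (real n) * norm (\<Phi> z) / norm (of_real m - exp z)"
          using z by (simp add: pole_int_def norm_mult norm_divide norm_exp_eq_Re)
        also have "\<dots> \<le> exp (real n) * (C1 * exp (- s * real n)) / (exp (real n) - m)"
          using b1[OF z(2)] d elim z by (intro frac_le mult_left_mono mult_nonneg_nonneg C_nonneg) auto
        also have "\<dots> = C1 * exp ((1 - s) * real n) / (exp (real n) - m)"
          by (simp add: left_diff_distrib exp_diff exp_minus field_simps)
        finally show "norm (pole_int m z) \<le> C1 * exp ((1 - s) * real n) / (exp (real n) - m)" .
      qed
      have B: "norm (contour_integral (linepath (Complex (- real n) \<theta>) (Complex (- real n) (- \<theta>))) (pole_int m))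
         \<le> C0 * exp (- real n) / (m - exp (- real n)) * norm (Complex (- real n) (-\<theta>) - Complex (- real n) \<theta>)"
      proof (rule contour_integral_bound_linepath)
        show "pole_int m contour_integrable_on linepath (Complex (- real n) \<theta>) (Complex (- real n) (- \<theta>))"
          unfolding closed_segment_commute
          using elim by (intro contour_integrable_continuous_linepath ci) (subst closed_segment_commute, intro sub, auto)
        show "0 \<le> C0 * exp (- real n) / (m - exp (- real n))" using C_nonneg elim by simp
        fix z assume "z \<in> closed_segment (Complex (- real n) \<theta>) (Complex (- real n) (- \<theta>))"
        then have z: "Re z = - real n" "\<bar>Im z\<bar> \<le> \<theta>" using seg by (auto simp: closed_segment_commute)
        have "norm (of_real m :: complex) - norm (exp z) \<le> norm (of_real m - exp z)" by (rule norm_triangle_ineq2)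
        then have d: "m - exp (- real n) \<le> norm (of_real m - exp z)" using z m by (simp add: norm_exp_eq_Re)
        have "norm (pole_int m z) = exp (- real n) * norm (\<Phi> z) / norm (of_real m - exp z)"
          using z by (simp add: pole_int_def norm_mult norm_divide norm_exp_eq_Re)
        also have "\<dots> \<le> exp (- real n) * C0 / (m - exp (- real n))"
          using b0[OF z(2)] d elim z by (intro frac_le mult_left_mono mult_nonneg_nonneg C_nonneg) auto
        finally show "norm (pole_int m z) \<le> C0 * exp (- real n) / (m - exp (- real n))" by (simp add: mult.commute)
      qed
      have len: "norm (Complex x \<theta> - Complex x (-\<theta>)) = 2 * \<theta>" "norm (Complex x (-\<theta>) - Complex x \<theta>) = 2 * \<theta>" for x
        using theta_pos by (simp_all add: cmod_def real_sqrt_mult)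
      show ?case unfolding U_def using A B norm_triangle_mono len by metis
    qed
    have "?B \<longlonglongrightarrow> C1 * 0 * (2 * \<theta>) + C0 * 0 * (2 * \<theta>)"
    proof -
      have "(\<lambda>n::nat. exp ((1 - s) * real n) / (exp (real n) - m)) \<longlonglongrightarrow> 0" using s m by real_asymp
      moreover have "(\<lambda>n::nat. exp (- real n) / (m - exp (- real n))) \<longlonglongrightarrow> 0" using m by real_asymp
      ultimately show ?thesis unfolding times_divide_eq_right[symmetric] by (intro tendsto_intros)
    qed
    then show "?B \<longlonglongrightarrow> 0" by simp
  qed simp
  then have "(\<lambda>n. 2 * pi * \<i> * \<Phi> (of_real (ln m)) + U n) \<longlonglongrightarrow> 2 * pi * \<i> * \<Phi> (of_real (ln m)) + 0"
    by (intro tendsto_intros)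
  moreover have "eventually (\<lambda>n. 2 * pi * \<i> * \<Phi> (of_real (ln m)) + U n = 2 * \<i> * of_real (Im (I n))) sequentially"
  proof -
    have "eventually (\<lambda>n::nat. real n > \<bar>ln m\<bar>) sequentially" by real_asymp
    then show ?thesis
      by eventually_elim (simp only: pole_int_contour[OF m] U_def I_def add.assoc)
  qed
  ultimately have "(\<lambda>n. 2 * \<i> * of_real (Im (I n))) \<longlonglongrightarrow> 2 * pi * \<i> * \<Phi> (of_real (ln m)) + 0"
    by (rule Lim_transform_eventually)
  from LIMSEQ_unique[OF this lim1] show ?thesis by (simp add: complex_eq_iff)
qed

text \<open>Fubini exchanges \<sigma> with the ray parameter: integrating over \<sigma> first gives
  \<open>pole_int\<close>, whose ray integral is known from Cauchy's formula; integrating over the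
  ray first gives the transform in question. The exchange is legitimate because m - exp z has
  positive real part on the ray.\<close>

lemma ray_laplace:
  assumes m: "0 < m"
  shows "set_integrable lborel {0<..} (\<lambda>\<sigma>. exp (- m * \<sigma>) * ray_transform \<theta> \<Phi> \<sigma>)"
    and "(LINT \<sigma>:{0<..}|lborel. exp (- m * \<sigma>) * ray_transform \<theta> \<Phi> \<sigma>) = Re (\<Phi> (of_real (ln m)))"
proof -
  define f where "f x \<sigma> = (indicator {0<..} \<sigma> :: real) *\<^sub>R (exp (- (of_real m - exp (ray x)) * of_real \<sigma>) * (exp (ray x) * \<Phi> (ray x)))" for x \<sigma> :: real
  have pos: "m + c * exp x > 0" for x using m c_bounds by (simp add: add_pos_pos)
  have Re: "Re (of_real m - exp (ray x)) = m + c * exp x" for x by (simp add: Re_exp c_def)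
  have nf: "norm (f x \<sigma>) = (indicator {0<..} \<sigma> *\<^sub>R exp (- (m + c * exp x) * \<sigma>)) * (exp x * norm (\<Phi> (ray x)))" for x \<sigma>
    by (simp add: f_def norm_mult norm_exp_eq_Re Re_exp c_def algebra_simps)
  have [measurable]: "(\<lambda>(x, \<sigma>). f x \<sigma>) \<in> borel_measurable (lborel \<Otimes>\<^sub>M lborel)"
    unfolding f_def by measurable
  have inner: "integrable lborel (f x)" "(LINT \<sigma>|lborel. f x \<sigma>) = pole_int m (ray x)" for x
  proof -
    have w: "Re (of_real m - exp (ray x)) > 0" unfolding Re by (rule pos)
    note E = has_integral_exp_complex[OF w]
    show "integrable lborel (f x)"
      using integrable_mult_left[OF E(1)[unfolded set_integrable_def], of "exp (ray x) * \<Phi> (ray x)"]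
      by (simp add: f_def[abs_def] scaleR_conv_of_real mult_ac)
    have "(LINT \<sigma>|lborel. f x \<sigma>) = (LINT \<sigma>:{0<..}|lborel. exp (- (of_real m - exp (ray x)) * of_real \<sigma>)) * (exp (ray x) * \<Phi> (ray x))"
      unfolding set_lebesgue_integral_def f_def
      by (subst integral_mult_left_zero[symmetric]) (simp add: scaleR_conv_of_real mult_ac)
    then show "(LINT \<sigma>|lborel. f x \<sigma>) = pole_int m (ray x)"
      unfolding E(2) by (simp add: pole_int_def)
  qed
  have int: "integrable (lborel \<Otimes>\<^sub>M lborel) (\<lambda>(x, \<sigma>). f x \<sigma>)"
  proof (rule lborel_pair.Fubini_integrable)
    have "(LINT \<sigma>|lborel. norm (f x \<sigma>)) = exp x * norm (\<Phi> (ray x)) / (m + c * exp x)" for x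
      unfolding nf using integral_exp_real(2)[OF pos[of x]] by (simp add: set_lebesgue_integral_def)
    then show "integrable lborel (\<lambda>x. LINT \<sigma>|lborel. norm (case (x, \<sigma>) of (x, \<sigma>) \<Rightarrow> f x \<sigma>))"
      using pole_int_ray(1)[OF m] by simp
    show "AE x in lborel. integrable lborel (\<lambda>\<sigma>. case (x, \<sigma>) of (x, \<sigma>) \<Rightarrow> f x \<sigma>)"
      using inner(1) by simp
  qed measurable
  have outer: "(LINT x|lborel. f x \<sigma>) = indicator {0<..} \<sigma> *\<^sub>R (of_real (exp (- m * \<sigma>)) * (LINT x|lborel. exp (of_real \<sigma> * exp (ray x)) * exp (ray x) * \<Phi> (ray x)))" for \<sigma>
  proof -
    have "f x \<sigma> = (of_real (indicator {0<..} \<sigma>) * of_real (exp (- m * \<sigma>))) * (exp (of_real \<sigma> * exp (ray x)) * exp (ray x) * \<Phi> (ray x))" for x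
      by (simp add: f_def scaleR_conv_of_real exp_of_real[symmetric] exp_diff left_diff_distrib exp_minus field_simps)
    then show ?thesis by (simp only: integral_mult_right_zero) (simp add: scaleR_conv_of_real mult_ac)
  qed
  have Imf: "Im (LINT x|lborel. f x \<sigma>) / pi = indicator {0<..} \<sigma> *\<^sub>R (exp (- m * \<sigma>) * ray_transform \<theta> \<Phi> \<sigma>)" for \<sigma>
    unfolding outer by (simp add: ray_transform_def)
  have sn: "integrable lborel (\<lambda>\<sigma>. LINT x|lborel. f x \<sigma>)" using lborel_pair.integrable_snd[OF int] .
  then have "integrable lborel (\<lambda>\<sigma>. Im (LINT x|lborel. f x \<sigma>) / pi)" by simp
  then show "set_integrable lborel {0<..} (\<lambda>\<sigma>. exp (- m * \<sigma>) * ray_transform \<theta> \<Phi> \<sigma>)"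
    unfolding Imf set_integrable_def .
  have "(LINT \<sigma>:{0<..}|lborel. exp (- m * \<sigma>) * ray_transform \<theta> \<Phi> \<sigma>) = (LINT \<sigma>|lborel. Im (LINT x|lborel. f x \<sigma>) / pi)"
    unfolding Imf set_lebesgue_integral_def ..
  also have "\<dots> = Im (LINT \<sigma>|lborel. (LINT x|lborel. f x \<sigma>)) / pi" using sn by simp
  also have "(LINT \<sigma>|lborel. (LINT x|lborel. f x \<sigma>)) = (LINT x|lborel. pole_int m (ray x))"
    using lborel_pair.Fubini_integral[OF int] by (simp add: inner(2))
  also have "Im \<dots> / pi = Re (\<Phi> (of_real (ln m)))" using pole_int_integral[OF m] by simp
  finally show "(LINT \<sigma>:{0<..}|lborel. exp (- m * \<sigma>) * ray_transform \<theta> \<Phi> \<sigma>) = Re (\<Phi> (of_real (ln m)))" .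
qed

lemma ray_integrable:
  assumes a: "0 < a"
  shows "set_integrable lborel {0<..} (ray_transform \<theta> \<Phi>)"
    and "(LINT \<sigma>:{0<..}|lborel. \<bar>ray_transform \<theta> \<Phi> \<sigma>\<bar>) \<le> (ray_const \<theta> (1 - s) * C1 * a powr s + ray_const \<theta> (1 + s) * C2 * a powr (- s)) / s"
proof -
  have "set_borel_measurable lborel {0<..} (ray_transform \<theta> \<Phi>)"
    using borel_measurable_continuous_on_indicator[OF _ ray_continuous] by (simp add: set_borel_measurable_def)
  note sp = split_power_bound[OF this a, of "s - 1" "1 + s" "ray_const \<theta> (1 - s) * C1" "ray_const \<theta> (1 + s) * C2"]
  show "set_integrable lborel {0<..} (ray_transform \<theta> \<Phi>)"
    using ray_bound1 ray_bound2 s a by (intro sp(1)) (auto intro: less_trans)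
  have "(LINT \<sigma>:{0<..}|lborel. \<bar>ray_transform \<theta> \<Phi> \<sigma>\<bar>) \<le> ray_const \<theta> (1 - s) * C1 * a powr (s - 1 + 1) / (s - 1 + 1)
      + ray_const \<theta> (1 + s) * C2 * a powr (1 - (1 + s)) / (1 + s - 1)"
    using ray_bound1 ray_bound2 s a by (intro sp(2)) (auto intro: less_trans)
  then show "(LINT \<sigma>:{0<..}|lborel. \<bar>ray_transform \<theta> \<Phi> \<sigma>\<bar>) \<le> (ray_const \<theta> (1 - s) * C1 * a powr s + ray_const \<theta> (1 + s) * C2 * a powr (- s)) / s"
    by (simp add: add_divide_distrib)
qed

end

section \<open>The stable and the resolvent density\<close>

text \<open>Decay of exp(\<sigma>z) on the ray requires \<theta> > pi/2, decay of exp(-tz^s)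
  requires s\<theta> < pi/2. With \<theta> + s\<theta> = pi both hold with the same margin, and both
  amount to s < 1.\<close>

definition sect_angle :: "real \<Rightarrow> real" where "sect_angle s = pi / (1 + s)"

definition stable_density :: "real \<Rightarrow> real \<Rightarrow> real \<Rightarrow> real" where
  "stable_density s t = ray_transform (sect_angle s) (\<lambda>z. exp (- (of_real t * exp (of_real s * z))))"

definition resolvent_density :: "real \<Rightarrow> real \<Rightarrow> real \<Rightarrow> real" where
  "resolvent_density s lam = ray_transform (sect_angle s) (\<lambda>z. 1 / (of_real lam + exp (of_real s * z)))"

text \<open>The mean value inequality in the left half-plane, which is convex and on which |exp| is
  at most 1.\<close>

lemma norm_exp_minus_one_le:
  fixes w :: complex
  assumes "Re w \<le> 0"
  shows "norm (exp w - 1) \<le> norm w"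
proof -
  have "norm (exp w - exp 0) \<le> 1 * norm (w - 0)"
  proof (rule field_differentiable_bound)
    show "convex {z. Re z \<le> 0}" by (rule convex_halfspace_Re_le)
    show "(exp has_field_derivative exp z) (at z within {z. Re z \<le> 0})" for z :: complex
      by (rule DERIV_subset[OF DERIV_exp]) simp
    show "norm (exp z) \<le> 1" if "z \<in> {z. Re z \<le> 0}" for z using that by (simp add: norm_exp_eq_Re)
  qed (use assms in auto)
  then show ?thesis by simp
qed

lemma sect_angle:
  assumes "0 < s" "s < 1"
  shows "pi / 2 < sect_angle s" "sect_angle s < pi" "0 < cos (s * sect_angle s)"
    "\<bar>y\<bar> \<le> sect_angle s \<Longrightarrow> cos (s * sect_angle s) \<le> cos (s * y)"
proof -
  show a: "pi / 2 < sect_angle s" "sect_angle s < pi" using assms by (auto simp: sect_angle_def field_simps)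
  have b: "s * sect_angle s < pi / 2" "s * sect_angle s > 0" using assms by (auto simp: sect_angle_def field_simps)
  then show "0 < cos (s * sect_angle s)" by (intro cos_gt_zero_pi) auto
  assume y: "\<bar>y\<bar> \<le> sect_angle s"
  have "cos (s * sect_angle s) \<le> cos (s * \<bar>y\<bar>)"
    using y b assms by (intro cos_monotone_0_pi_le mult_left_mono) auto
  also have "\<dots> = cos (s * y)" by (auto simp: abs_if)
  finally show "cos (s * sect_angle s) \<le> cos (s * y)" .
qed

text \<open>The map exp(sz) sends the strip into a sector of half-angle below pi/2, where the real
  part is comparable to the modulus exp(s Re z).\<close>

lemma Re_exp_sector:
  assumes "0 < s" "s < 1" "\<bar>Im z\<bar> \<le> sect_angle s"
  shows "cos (s * sect_angle s) * exp (s * Re z) \<le> Re (exp (of_real s * z))" "0 < Re (exp (of_real s * z))"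
proof -
  show A: "cos (s * sect_angle s) * exp (s * Re z) \<le> Re (exp (of_real s * z))"
    using sect_angle(4)[OF assms] by (simp add: Re_exp mult.commute)
  show "0 < Re (exp (of_real s * z))"
    by (rule less_le_trans[OF _ A]) (use sect_angle(3)[OF assms(1,2)] in simp)
qed

text \<open>With \<kappa> the cosine of s\<theta>, the constant C1 = 1/(\<kappa>t) comes from
  exp(-w) <= 1/w at w = \<kappa>t exp(s Re z), and C2 = t from |exp v - 1| <= |v| in the left
  half-plane. Their reciprocal dependence on t is what makes the total mass of the density bounded
  uniformly in t.\<close>

lemma sectorial_stable:
  assumes s: "0 < s" "s < 1" and t: "0 < t"
  shows "sectorial s (sect_angle s) 1 (1 / (cos (s * sect_angle s) * t)) t 1 (\<lambda>z. exp (- (of_real t * exp (of_real s * z))))"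
proof
  fix z :: complex assume z: "\<bar>Im z\<bar> \<le> sect_angle s"
  note R = Re_exp_sector[OF s z]
  define \<kappa> where "\<kappa> = cos (s * sect_angle s)"
  have k: "\<kappa> > 0" using sect_angle(3)[OF s] by (simp add: \<kappa>_def)
  have n: "norm (exp (- (of_real t * exp (of_real s * z)))) = exp (- (t * Re (exp (of_real s * z))))"
    by (simp add: norm_exp_eq_Re)
  show "norm (exp (- (of_real t * exp (of_real s * z)))) \<le> 1"
    unfolding n using R t by simp
  show "norm (exp (- (of_real t * exp (of_real s * z)))) \<le> 1 / (cos (s * sect_angle s) * t) * exp (- s * Re z)"
  proof -
    define w where "w = \<kappa> * t * exp (s * Re z)"
    have w: "w > 0" using k t by (simp add: w_def)
    have "norm (exp (- (of_real t * exp (of_real s * z)))) \<le> exp (- w)"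
      unfolding n w_def using R t mult_left_mono[of "\<kappa> * exp (s * Re z)" "Re (exp (of_real s * z))" t]
      by (simp add: \<kappa>_def mult_ac)
    also have "\<dots> \<le> 1 / w"
      using exp_ge_add_one_self[of w] w by (simp add: exp_minus field_simps) (use \<open>1 + w \<le> exp w\<close> in linarith)
    finally show ?thesis by (simp add: w_def \<kappa>_def exp_minus field_simps)
  qed
  show "norm (exp (- (of_real t * exp (of_real s * z))) - of_real 1) \<le> t * exp (s * Re z)"
  proof -
    have "norm (exp (- (of_real t * exp (of_real s * z))) - 1) \<le> norm (- (of_real t * exp (of_real s * z)))"
      using R t by (intro norm_exp_minus_one_le) simp
    then show ?thesis using t by (simp add: norm_mult norm_exp_eq_Re)
  qed
qed (use s sect_angle in \<open>auto intro!: holomorphic_intros simp: exp_cnj\<close>)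

text \<open>Adding \<lambda> > 0 to a number w of the right half-plane gives a modulus of at least
  \<lambda> and at least |w|; these two facts produce C0 and C1. C2 comes from 1/(\<lambda> + w) -
  1/\<lambda> = -w/(\<lambda>(\<lambda> + w)).\<close>

lemma sectorial_resolvent:
  assumes s: "0 < s" "s < 1" and lam: "0 < lam"
  shows "sectorial s (sect_angle s) (1 / lam) 1 (1 / lam\<^sup>2) (1 / lam) (\<lambda>z. 1 / (of_real lam + exp (of_real s * z)))"
proof
  have Re: "lam < Re (of_real lam + exp (of_real s * z))" if "\<bar>Im z\<bar> \<le> sect_angle s" for z
    using Re_exp_sector[OF s that] by simp
  have nz: "of_real lam + exp (of_real s * z) \<noteq> 0" if "\<bar>Im z\<bar> \<le> sect_angle s" for z
    using Re[OF that] lam by (metis order_less_asym zero_complex.sel(1))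
  show "(\<lambda>z. 1 / (of_real lam + exp (of_real s * z))) holomorphic_on {z. \<bar>Im z\<bar> \<le> sect_angle s}"
    using nz by (auto intro!: holomorphic_intros)
  fix z :: complex assume z: "\<bar>Im z\<bar> \<le> sect_angle s"
  let ?w = "exp (of_real s * z)"
  have n: "norm ?w = exp (s * Re z)" by (simp add: norm_exp_eq_Re)
  have l: "lam \<le> norm (of_real lam + ?w)" using Re[OF z] complex_Re_le_cmod[of "of_real lam + ?w"] by linarith
  have e: "exp (s * Re z) \<le> norm (of_real lam + ?w)"
    unfolding n[symmetric] cmod_def using Re_exp_sector[OF s z] lam
    by (intro real_sqrt_le_mono add_mono) (auto intro: power_mono)
  show "norm (1 / (of_real lam + ?w)) \<le> 1 / lam"
    using l lam by (simp add: norm_divide frac_le)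
  show "norm (1 / (of_real lam + ?w)) \<le> 1 * exp (- s * Re z)"
    using e by (simp add: norm_divide norm_inverse exp_minus divide_inverse le_imp_inverse_le)
  have "1 / (of_real lam + ?w) - of_real (1 / lam) = - ?w / (of_real lam * (of_real lam + ?w))"
    using nz[OF z] lam by (simp add: field_simps)
  then have "norm (1 / (of_real lam + ?w) - of_real (1 / lam)) = exp (s * Re z) / (lam * norm (of_real lam + ?w))"
    using lam by (simp add: norm_divide norm_mult n)
  also have "\<dots> \<le> exp (s * Re z) / (lam * lam)"
    using l lam by (intro divide_left_mono mult_left_mono mult_pos_pos) auto
  finally show "norm (1 / (of_real lam + ?w) - of_real (1 / lam)) \<le> 1 / lam\<^sup>2 * exp (s * Re z)"
    by (simp add: power2_eq_square)
qed (use s sect_angle in \<open>auto simp: exp_cnj\<close>)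

lemma resolvent_density_bounds:
  assumes "0 < s" "s < 1" "0 < lam"
  obtains K where "0 < K" "\<And>\<sigma>. 0 < \<sigma> \<Longrightarrow> \<bar>resolvent_density s lam \<sigma>\<bar> \<le> K * \<sigma> powr (s - 1)"
    "\<And>\<sigma>. 0 < \<sigma> \<Longrightarrow> \<bar>resolvent_density s lam \<sigma>\<bar> \<le> K * \<sigma> powr (- 1 - s)"
proof -
  interpret sectorial s "sect_angle s" "1 / lam" 1 "1 / lam\<^sup>2" "1 / lam" "\<lambda>z. 1 / (of_real lam + exp (of_real s * z))"
    by (rule sectorial_resolvent[OF assms])
  define K where "K = max 1 (max (ray_const (sect_angle s) (1 - s) * 1) (ray_const (sect_angle s) (1 + s) * (1 / lam\<^sup>2)))"
  show ?thesis
  proof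
    show "0 < K" by (simp add: K_def)
    fix \<sigma> :: real assume sg: "0 < \<sigma>"
    have "ray_const (sect_angle s) (1 - s) * 1 * \<sigma> powr (s - 1) \<le> K * \<sigma> powr (s - 1)"
      by (intro mult_right_mono) (auto simp: K_def)
    then show "\<bar>resolvent_density s lam \<sigma>\<bar> \<le> K * \<sigma> powr (s - 1)"
      using ray_bound1[OF sg] by (simp add: resolvent_density_def)
    have "ray_const (sect_angle s) (1 + s) * (1 / lam\<^sup>2) * \<sigma> powr (- 1 - s) \<le> K * \<sigma> powr (- 1 - s)"
      by (intro mult_right_mono) (auto simp: K_def)
    then show "\<bar>resolvent_density s lam \<sigma>\<bar> \<le> K * \<sigma> powr (- 1 - s)"
      using ray_bound2[OF sg] by (simp add: resolvent_density_def)
  qed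
qed

lemma resolvent_density_laplace:
  assumes "0 < s" "s < 1" "0 < lam" "0 < m"
  shows "(LINT \<sigma>:{0<..}|lborel. exp (- m * \<sigma>) * resolvent_density s lam \<sigma>) = 1 / (lam + m powr s)"
proof -
  interpret sectorial s "sect_angle s" "1 / lam" 1 "1 / lam\<^sup>2" "1 / lam" "\<lambda>z. 1 / (of_real lam + exp (of_real s * z))"
    by (rule sectorial_resolvent[OF assms(1-3)])
  have "exp (of_real s * of_real (ln m)) = complex_of_real (m powr s)"
    using assms by (simp add: powr_def exp_of_real[symmetric])
  then have "Re (1 / (of_real lam + exp (of_real s * of_real (ln m)))) = 1 / (lam + m powr s)"
    by (metis Re_complex_of_real of_real_1 of_real_add of_real_divide)
  then show ?thesis using ray_laplace(2)[OF assms(4)] by (simp add: resolvent_density_def)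
qed

lemma resolvent_density_integrable:
  assumes "0 < s" "s < 1" "0 < lam"
  shows "set_integrable lborel {0<..} (resolvent_density s lam)"
proof -
  interpret sectorial s "sect_angle s" "1 / lam" 1 "1 / lam\<^sup>2" "1 / lam" "\<lambda>z. 1 / (of_real lam + exp (of_real s * z))"
    by (rule sectorial_resolvent[OF assms])
  show ?thesis using ray_integrable(1)[of 1] by (simp add: resolvent_density_def)
qed

lemma stable_density_laplace:
  assumes "0 < s" "s < 1" "0 < t"
  shows "is_inverse_laplace (\<lambda>lam. exp (- t * lam powr s)) (stable_density s t)"
proof -
  interpret sectorial s "sect_angle s" 1 "1 / (cos (s * sect_angle s) * t)" t 1 "\<lambda>z. exp (- (of_real t * exp (of_real s * z)))"
    by (rule sectorial_stable[OF assms])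
  have "exp (of_real s * of_real (ln m)) = complex_of_real (m powr s)" if "m > 0" for m
    using that by (simp add: powr_def exp_of_real[symmetric])
  then have "Re (exp (- (of_real t * exp (of_real s * of_real (ln m))))) = exp (- t * m powr s)" if "m > 0" for m
    using that by (simp add: exp_of_real flip: of_real_mult of_real_minus)
  then show ?thesis unfolding is_inverse_laplace_def stable_density_def
    using ray_continuous ray_laplace by simp
qed

text \<open>A bound independent of t takes the place of the total mass 1 that positivity would give;
  it lets the weight exp(-\<lambda>t) alone ensure integrability in t.\<close>

lemma stable_density_integrable:
  assumes "0 < s" "s < 1"
  obtains K where "\<And>t. 0 < t \<Longrightarrow> set_integrable lborel {0<..} (stable_density s t)"
    "\<And>t. 0 < t \<Longrightarrow> (LINT \<sigma>:{0<..}|lborel. \<bar>stable_density s t \<sigma>\<bar>) \<le> K"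
proof
  fix t :: real assume t: "0 < t"
  let ?th = "sect_angle s"
  interpret sectorial s "sect_angle s" 1 "1 / (cos (s * sect_angle s) * t)" t 1 "\<lambda>z. exp (- (of_real t * exp (of_real s * z)))"
    by (rule sectorial_stable[OF assms t])
  \<comment> \<open>The self-similar scale of the density: splitting at t^(1/s) cancels t from both
    terms, because C1 is proportional to 1/t and C2 equals t.\<close>
  have a: "0 < t powr (1 / s)" using t by simp
  show "set_integrable lborel {0<..} (stable_density s t)"
    using ray_integrable(1)[OF a] by (simp add: stable_density_def)
  have p: "(t powr (1 / s)) powr s = t" "(t powr (1 / s)) powr (- s) = 1 / t"
    using t assms by (simp_all add: powr_powr powr_minus divide_inverse)
  show "(LINT \<sigma>:{0<..}|lborel. \<bar>stable_density s t \<sigma>\<bar>) \<le> (ray_const ?th (1 - s) * (1 / cos (s * sect_angle s)) + ray_const ?th (1 + s)) / s"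
    using ray_integrable(2)[OF a] t unfolding p stable_density_def by simp
qed

text \<open>If g1 exceeded g2 at one point, it would do so on a neighbourhood by continuity, and a
  hat function supported there would separate the two in spite of equal transforms. The one-sided
  form gives equality by exchanging the roles.\<close>

lemma inverse_laplace_le:
  assumes "is_inverse_laplace F g1" "is_inverse_laplace F g2" "0 < \<sigma>0"
  shows "g1 \<sigma>0 \<le> g2 \<sigma>0"
proof (rule ccontr)
  assume "\<not> g1 \<sigma>0 \<le> g2 \<sigma>0"
  define d where "d \<sigma> = g1 \<sigma> - g2 \<sigma>" for \<sigma>
  have d0: "d \<sigma>0 > 0" using \<open>\<not> _\<close> by (simp add: d_def)
  have "continuous_on {0<..} d" unfolding d_def using assms by (intro continuous_intros) (auto simp: is_inverse_laplace_def)
  then have "isCont d \<sigma>0" using assms(3) by (simp add: continuous_on_eq_continuous_at)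
  then obtain \<delta>' where "\<delta>' > 0" "\<And>x. \<bar>x - \<sigma>0\<bar> < \<delta>' \<Longrightarrow> \<bar>d x - d \<sigma>0\<bar> < d \<sigma>0"
    using d0 unfolding continuous_at_eps_delta dist_real_def by metis
  \<comment> \<open>Keeping \<delta> below \<sigma>0 places the support of the hat function inside
    the open half-line, outside of which g1 and g2 are arbitrary.\<close>
  then obtain \<delta> where \<delta>: "\<delta> > 0" "\<delta> < \<sigma>0" "\<And>x. \<bar>x - \<sigma>0\<bar> < \<delta> \<Longrightarrow> d x > 0"
    using assms(3) by (intro that[of "min \<delta>' (\<sigma>0/2)"]) (auto simp: abs_less_iff)
  define g where "g x = max 0 (\<delta> - \<bar>x - \<sigma>0\<bar>)" for x
  have gc: "continuous_on UNIV g" unfolding g_def by (intro continuous_intros)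
  have gb: "\<bar>g x\<bar> \<le> \<delta>" for x using \<delta> by (auto simp: g_def)
  \<comment> \<open>The factor exp(-x) supplies integrability, which an inverse Laplace transform
    itself need not have, at the price of shifting the transform by 1.\<close>
  let ?h = "\<lambda>gg x. indicator {0<..} x *\<^sub>R (exp (- 1 * x) * gg x)"
  have int: "integrable lborel (?h g1)" "integrable lborel (?h g2)"
    using assms(1,2) by (auto simp: is_inverse_laplace_def set_integrable_def dest!: spec[of _ 1])
  have L: "(LINT x|lborel. exp (- m * x) * ?h gg x) = F (m + 1)" if "is_inverse_laplace F gg" "m > 0" for m gg
  proof -
    have "(LINT x|lborel. exp (- m * x) * ?h gg x) = (LINT x:{0<..}|lborel. exp (- (m + 1) * x) * gg x)"
      unfolding set_lebesgue_integral_def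
      by (intro Bochner_Integration.integral_cong) (auto simp: exp_add exp_diff algebra_simps exp_minus indicator_def divide_inverse)
    also have "\<dots> = F (m + 1)" using that(1)[unfolded is_inverse_laplace_def, THEN conjunct2, rule_format, of "m + 1"] that(2) by auto
    finally show ?thesis .
  qed
  have "(LINT x|lborel. g x * ?h g1 x) = (LINT x|lborel. g x * ?h g2 x)"
    by (rule laplace_unique[where B=\<delta>]) (use int L assms gc gb in \<open>auto simp: indicator_def split: if_splits\<close>)
  moreover have gi: "integrable lborel (\<lambda>x. g x * ?h g1 x)" "integrable lborel (\<lambda>x. g x * ?h g2 x)"
    using gb by (intro integrable_bounded_mult[where B=\<delta>] int; auto intro: borel_measurable_continuous_onI gc)+
  ultimately have z: "(LINT x|lborel. g x * ?h g1 x - g x * ?h g2 x) = 0" by simp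
  have eq: "g x * ?h g1 x - g x * ?h g2 x = (if \<bar>x - \<sigma>0\<bar> < \<delta> then g x * exp (- x) * d x else 0)" for x
    using \<delta> by (auto simp: g_def d_def indicator_def algebra_simps abs_if split: if_splits)
  have "AE x in lborel. g x * ?h g1 x - g x * ?h g2 x = 0"
  proof (subst integral_nonneg_eq_0_iff_AE[symmetric])
    show "integrable lborel (\<lambda>x. g x * ?h g1 x - g x * ?h g2 x)" using gi by simp
    show "AE x in lborel. 0 \<le> g x * ?h g1 x - g x * ?h g2 x"
      unfolding eq using \<delta>(3) by (intro AE_I2) (auto simp: g_def intro!: mult_nonneg_nonneg less_imp_le)
  qed (rule z)
  then have "AE x in lborel. x \<notin> {\<sigma>0 - \<delta><..<\<sigma>0 + \<delta>}"
  proof eventually_elim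
    case (elim x)
    show ?case
    proof
      assume "x \<in> {\<sigma>0 - \<delta><..<\<sigma>0 + \<delta>}"
      then have x: "\<bar>x - \<sigma>0\<bar> < \<delta>" by auto
      then have "g x > 0" by (simp add: g_def)
      then show False using elim[unfolded eq] x \<delta>(3)[OF x] by simp
    qed
  qed
  then have "emeasure lborel {\<sigma>0 - \<delta><..<\<sigma>0 + \<delta>} = 0"
    by (subst (asm) AE_iff_measurable[of "{\<sigma>0 - \<delta><..<\<sigma>0 + \<delta>}"]) auto
  then show False using \<delta>(1) by simp
qed

lemma subord_density_eq:
  assumes "0 < s" "s < 1" "0 < t" "0 < \<sigma>"
  shows "subord_density s t \<sigma> = stable_density s t \<sigma>"
proof -
  note S = stable_density_laplace[OF assms(1-3)]
  then have I: "is_inverse_laplace (\<lambda>lam. exp (- t * lam powr s)) (subord_density s t)"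
    unfolding subord_density_def inverse_laplace_def by (rule someI[of "is_inverse_laplace _"])
  show ?thesis using inverse_laplace_le[OF S I assms(4)] inverse_laplace_le[OF I S assms(4)] by simp
qed

text \<open>Fubini in (t, \<sigma>) needs joint measurability. The explicit integral provides it,
  whereas \<open>subord_density\<close> is chosen separately for each t.\<close>

lemma stable_density_measurable [measurable]:
  "(\<lambda>(t, \<sigma>). stable_density s t \<sigma>) \<in> borel_measurable (borel \<Otimes>\<^sub>M borel)"
proof -
  have [measurable]: "(\<lambda>x. Complex x y) \<in> borel_measurable borel" for y
    by (intro borel_measurable_continuous_onI) (auto simp: Complex_eq intro!: continuous_intros)
  show ?thesis unfolding stable_density_def ray_transform_def by measurable
qed

section \<open>The heat semigroup\<close>

lemma lborel_integral_affine:
  fixes f :: "'a::euclidean_space \<Rightarrow> real"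
  assumes c: "c \<noteq> 0" and [measurable]: "f \<in> borel_measurable borel"
  shows "(LINT x|lborel. f x) = \<bar>c\<bar> ^ DIM('a) * (LINT x|lborel. f (t + c *\<^sub>R x))"
proof -
  have "(LINT x|lborel. f x) = (LINT x|density (distr lborel borel (\<lambda>x. t + c *\<^sub>R x)) (\<lambda>_. ennreal (\<bar>c\<bar> ^ DIM('a))). f x)"
    by (subst lborel_affine[OF c, of t]) simp
  also have "\<dots> = \<bar>c\<bar> ^ DIM('a) * (LINT x|lborel. f (t + c *\<^sub>R x))"
    by (subst integral_density) (auto simp: integral_distr)
  finally show ?thesis .
qed

lemma lborel_integrable_affine:
  fixes f :: "'a::euclidean_space \<Rightarrow> real"
  assumes c: "c \<noteq> 0" and f: "integrable lborel f"
  shows "integrable lborel (\<lambda>x. f (t + c *\<^sub>R x))"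
proof -
  have [measurable]: "f \<in> borel_measurable borel" using borel_measurable_integrable[OF f] by simp
  have "integrable (density (distr lborel borel (\<lambda>x. t + c *\<^sub>R x)) (\<lambda>_. ennreal (\<bar>c\<bar> ^ DIM('a)))) f"
    using f by (subst (asm) lborel_affine[OF c, of t]) simp
  then show ?thesis using c by (subst (asm) integrable_density) (auto simp: integrable_distr_eq)
qed

text \<open>The integrand factors over the coordinates into multiples of normal densities of
  variance 1/(2a).\<close>

lemma gaussian_integral:
  fixes a :: real
  assumes a: "0 < a"
  shows "integrable lborel (\<lambda>z::'a::euclidean_space. exp (- (a * (norm z)\<^sup>2)))"
    and "(LINT z|lborel. exp (- (a * (norm (z::'a))\<^sup>2))) = (pi / a) powr (real DIM('a) / 2)"
proof -
  define \<sigma> where "\<sigma> = 1 / sqrt (2 * a)"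
  have sg: "\<sigma> > 0" "\<sigma>\<^sup>2 = 1 / (2 * a)" using a by (auto simp: \<sigma>_def power_divide)
  have d: "exp (- (a * x\<^sup>2)) = sqrt (pi / a) * normal_density 0 \<sigma> x" for x
    using a by (simp add: normal_density_def sg real_sqrt_divide mult.commute)
  have 1: "(\<integral>\<^sup>+x. ennreal (exp (- (a * x\<^sup>2))) \<partial>lborel) = ennreal (sqrt (pi / a))"
    using integrable_normal_density[OF sg(1), of 0] integral_normal_density[OF sg(1), of 0] a
    by (subst nn_integral_eq_integral) (auto simp: d normal_density_nonneg)
  have p: "exp (- (a * (norm z)\<^sup>2)) = (\<Prod>b\<in>Basis. exp (- (a * (z \<bullet> b)\<^sup>2)))" for z :: 'a
  proof -
    have "(norm z)\<^sup>2 = (\<Sum>b\<in>Basis. (z \<bullet> b)\<^sup>2)"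
      unfolding power2_norm_eq_inner by (subst euclidean_inner) (simp add: power2_eq_square)
    then show ?thesis by (simp add: exp_sum[symmetric] sum_negf sum_distrib_left)
  qed
  have "(\<integral>\<^sup>+z. ennreal (exp (- (a * (norm (z::'a))\<^sup>2))) \<partial>lborel) = (\<integral>\<^sup>+z. (\<Prod>b\<in>Basis. ennreal (exp (- (a * ((z::'a) \<bullet> b)\<^sup>2)))) \<partial>lborel)"
    by (simp add: p prod_ennreal)
  also have "\<dots> = ennreal (sqrt (pi / a)) ^ DIM('a)"
    by (subst nn_integral_lborel_prod) (auto simp: 1)
  also have "\<dots> = ennreal ((pi / a) powr (real DIM('a) / 2))"
    using a by (simp add: ennreal_power powr_half_sqrt[symmetric] powr_realpow[symmetric] powr_powr)
  finally have n: "(\<integral>\<^sup>+z. ennreal (exp (- (a * (norm (z::'a))\<^sup>2))) \<partial>lborel) = ennreal ((pi / a) powr (real DIM('a) / 2))" .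
  show "integrable lborel (\<lambda>z::'a. exp (- (a * (norm z)\<^sup>2)))"
    by (rule integrableI_nn_integral_finite[OF _ _ n]) auto
  show "(LINT z|lborel. exp (- (a * (norm (z::'a))\<^sup>2))) = (pi / a) powr (real DIM('a) / 2)"
    by (subst integral_eq_nn_integral) (auto simp: n)
qed

text \<open>The heat kernel at time 1: a centred normal density of variance 2 in each
  coordinate.\<close>

definition gauss :: "'a::euclidean_space \<Rightarrow> real" where
  "gauss z = (4 * pi) powr (- (real DIM('a) / 2)) * exp (- (norm z)\<^sup>2 / 4)"

lemma gauss_pos: "gauss z > 0" by (simp add: gauss_def)

lemma gauss_measurable [measurable]: "gauss \<in> borel_measurable borel"
  unfolding gauss_def by measurable

lemma gauss_minus: "gauss (- z) = gauss z" by (simp add: gauss_def)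

lemma gauss_integral: "integrable lborel (gauss :: 'a::euclidean_space \<Rightarrow> real)" "(LINT z|lborel. gauss (z::'a)) = 1"
proof -
  show "integrable lborel (gauss :: 'a \<Rightarrow> real)"
    using gaussian_integral(1)[of "1/4", where 'a='a] unfolding gauss_def[abs_def] by simp
  show "(LINT z|lborel. gauss (z::'a)) = 1"
    using gaussian_integral(2)[of "1/4", where 'a='a]
    by (simp add: gauss_def powr_minus mult.commute)
qed

text \<open>Half of the exponent is spent on the quadratic factor, by means of 1 + u <= exp u at u =
  |z|^2/8.\<close>

lemma norm_gauss_le:
  fixes z :: "'a::euclidean_space"
  shows "(1 + (norm z)\<^sup>2) * gauss z \<le> 8 * ((4 * pi) powr (- (real DIM('a) / 2)) * exp (- (norm z)\<^sup>2 / 8))"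
proof -
  have "1 + (norm z)\<^sup>2 \<le> 8 * exp ((norm z)\<^sup>2 / 8)"
    using exp_ge_add_one_self[of "(norm z)\<^sup>2 / 8"] by linarith
  then have "(1 + (norm z)\<^sup>2) * exp (- (norm z)\<^sup>2 / 4) \<le> 8 * exp ((norm z)\<^sup>2 / 8) * exp (- (norm z)\<^sup>2 / 4)"
    by (rule mult_right_mono) simp
  also have "\<dots> = 8 * exp (- (norm z)\<^sup>2 / 8)" by (simp add: exp_add[symmetric] mult.assoc)
  finally have "(4 * pi) powr (- (real DIM('a) / 2)) * ((1 + (norm z)\<^sup>2) * exp (- (norm z)\<^sup>2 / 4))
      \<le> (4 * pi) powr (- (real DIM('a) / 2)) * (8 * exp (- (norm z)\<^sup>2 / 8))" by (rule mult_left_mono) simp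
  then show ?thesis by (simp add: gauss_def mult_ac)
qed

text \<open>A single moment serves all gradient estimates, since 1 + |z|^2 dominates both |z| and
  |z|^(1+\<alpha>) for 0 <= \<alpha> < 1.\<close>

definition gauss_moment :: "'a::euclidean_space itself \<Rightarrow> real" where
  "gauss_moment _ = (LINT z|lborel. (1 + (norm (z::'a))\<^sup>2) * gauss z)"

lemma gauss_moment_integrable: "integrable lborel (\<lambda>z::'a::euclidean_space. (1 + (norm z)\<^sup>2) * gauss z)"
proof (rule Bochner_Integration.integrable_bound)
  show "integrable lborel (\<lambda>z::'a. 8 * ((4 * pi) powr (- (real DIM('a) / 2)) * exp (- (norm z)\<^sup>2 / 8)))"
    using gaussian_integral(1)[of "1/8", where 'a='a] by simp
  show "AE z::'a in lborel. norm ((1 + (norm z)\<^sup>2) * gauss z) \<le> norm (8 * ((4 * pi) powr (- (real DIM('a) / 2)) * exp (- (norm z)\<^sup>2 / 8)))"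
  proof (intro AE_I2)
    fix z :: 'a
    have "0 \<le> (1 + (norm z)\<^sup>2) * gauss z" using less_imp_le[OF gauss_pos[of z]] by simp
    then show "norm ((1 + (norm z)\<^sup>2) * gauss z) \<le> norm (8 * ((4 * pi) powr (- (real DIM('a) / 2)) * exp (- (norm z)\<^sup>2 / 8)))"
      using norm_gauss_le[of z] unfolding real_norm_def by linarith
  qed
qed measurable

lemma gauss_moment_nonneg: "0 \<le> gauss_moment TYPE('a::euclidean_space)"
  unfolding gauss_moment_def by (intro Bochner_Integration.integral_nonneg) (auto intro!: mult_nonneg_nonneg less_imp_le[OF gauss_pos])

lemma bcontfunD:
  assumes "f \<in> bcontfun"
  shows "continuous_on UNIV f" "f \<in> borel_measurable borel" "\<exists>B\<ge>0. \<forall>x. norm (f x) \<le> B"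
proof -
  show "continuous_on UNIV f" using assms by (auto simp: bcontfun_def)
  then show "f \<in> borel_measurable borel" by (rule borel_measurable_continuous_onI)
  show "\<exists>B\<ge>0. \<forall>x. norm (f x) \<le> B" using assms by (auto simp: bcontfun_def bounded_pos intro: less_imp_le)
qed

lemma bcontfunI:
  assumes "continuous_on UNIV f" "\<And>x. norm (f x) \<le> B"
  shows "f \<in> bcontfun"
  using assms by (auto simp: bcontfun_def bounded_iff)

lemma continuous_param_integral:
  fixes w :: "'m \<Rightarrow> real" and f :: "'c::topological_space \<Rightarrow> real" and \<phi> :: "'p::metric_space \<Rightarrow> 'm \<Rightarrow> 'c"
  assumes w: "integrable M w" and fc: "continuous_on UNIV f" and fb: "\<And>x. \<bar>f x\<bar> \<le> B"
    and c: "\<And>z. continuous_on UNIV (\<lambda>p. \<phi> p z)" and m: "\<And>p. (\<lambda>z. f (\<phi> p z)) \<in> borel_measurable M"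
  shows "continuous_on UNIV (\<lambda>p. LINT z|M. w z * f (\<phi> p z))"
  unfolding continuous_on_sequentially o_def
proof safe
  fix u :: "nat \<Rightarrow> 'p" and l assume u: "u \<longlonglongrightarrow> l"
  note [measurable] = borel_measurable_integrable[OF w] m
  show "(\<lambda>n. LINT z|M. w z * f (\<phi> (u n) z)) \<longlonglongrightarrow> (LINT z|M. w z * f (\<phi> l z))"
  proof (rule integral_dominated_convergence[where w="\<lambda>z. \<bar>w z\<bar> * B"])
    have "(\<lambda>n. f (\<phi> (u n) z)) \<longlonglongrightarrow> f (\<phi> l z)" for z
      using continuous_on_tendsto_compose[OF continuous_on_compose2[OF fc c] u] by simp
    then show "AE z in M. (\<lambda>n. w z * f (\<phi> (u n) z)) \<longlonglongrightarrow> w z * f (\<phi> l z)"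
      by (intro AE_I2 tendsto_intros)
    show "AE z in M. norm (w z * f (\<phi> (u n) z)) \<le> \<bar>w z\<bar> * B" for n
      using fb by (intro AE_I2) (simp add: abs_mult mult_left_mono)
  qed (use w in \<open>auto intro: integrable_mult_left integrable_abs\<close>)
qed

lemma weight_integrable:
  fixes w f :: "'m \<Rightarrow> real"
  assumes "integrable M w" "f \<in> borel_measurable M" "\<And>x. \<bar>f x\<bar> \<le> B"
  shows "integrable M (\<lambda>x. w x * f x)"
  using integrable_bounded_mult[OF assms(1,2), of B] assms(3) by (simp add: mult.commute)

text \<open>The substitution y = x + sqrt(\<sigma>) z frees the kernel of \<sigma> and includes
  \<sigma> = 0 as the identity. As \<open>sqrt\<close> is continuous on all reals, the result is
  continuous in \<sigma> over \<open>UNIV\<close>, the form of test function that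
  \<open>laplace_unique\<close> takes.\<close>

definition heat_flow :: "real \<Rightarrow> ('a::euclidean_space \<Rightarrow> real) \<Rightarrow> 'a \<Rightarrow> real" where
  "heat_flow \<sigma> f x = (LINT z|lborel. gauss z * f (x + sqrt \<sigma> *\<^sub>R z))"

lemma heat_flow_integrable:
  fixes f :: "'a::euclidean_space \<Rightarrow> real"
  assumes f: "f \<in> bcontfun"
  shows "integrable lborel (\<lambda>z. gauss z * f (x + c *\<^sub>R z))"
proof -
  obtain B where B: "\<And>x. \<bar>f x\<bar> \<le> B" using bcontfunD(3)[OF f] by auto
  note [measurable] = bcontfunD(2)[OF f]
  show ?thesis by (rule weight_integrable[OF gauss_integral(1)]) (use B in auto)
qed

lemma heat_eq_flow:
  fixes f :: "'a::euclidean_space \<Rightarrow> real"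
  assumes "0 < \<sigma>" "f \<in> bcontfun"
  shows "heat \<sigma> f x = heat_flow \<sigma> f x"
proof -
  note [measurable] = bcontfunD(2)[OF assms(2)]
  let ?f = "\<lambda>y. (4 * pi * \<sigma>) powr (- (real DIM('a) / 2)) * exp (- ((norm (x - y))\<^sup>2 / (4 * \<sigma>))) * f y"
  have "heat \<sigma> f x = (LINT y|lborel. ?f y)" by (simp add: heat_def)
  also have "\<dots> = \<bar>sqrt \<sigma>\<bar> ^ DIM('a) * (LINT z|lborel. ?f (x + sqrt \<sigma> *\<^sub>R z))"
    using assms by (intro lborel_integral_affine) auto
  also have "\<dots> = (LINT z|lborel. \<bar>sqrt \<sigma>\<bar> ^ DIM('a) * ?f (x + sqrt \<sigma> *\<^sub>R z))" by simp
  also have "\<dots> = heat_flow \<sigma> f x" unfolding heat_flow_def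
  proof (intro Bochner_Integration.integral_cong refl)
    fix z :: 'a
    have A: "\<bar>sqrt \<sigma>\<bar> ^ DIM('a) = \<sigma> powr (real DIM('a) / 2)"
      using assms by (simp add: powr_half_sqrt[symmetric] powr_realpow[symmetric] powr_powr)
    have B: "(4 * pi * \<sigma>) powr (- (real DIM('a) / 2)) = (4 * pi) powr (- (real DIM('a) / 2)) * \<sigma> powr (- (real DIM('a) / 2))"
      using assms by (intro powr_mult)
    have C: "\<sigma> powr (real DIM('a) / 2) * \<sigma> powr (- (real DIM('a) / 2)) = 1"
      using assms by (simp add: powr_add[symmetric])
    have D: "(norm (x - (x + sqrt \<sigma> *\<^sub>R z)))\<^sup>2 / (4 * \<sigma>) = (norm z)\<^sup>2 / 4"
      using assms by (simp add: power_mult_distrib)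
    have E: "p * ((c * q) * exp (- e) * v) = c * exp (- e) * v" if "p * q = 1" for p q c e v :: real
    proof -
      have "p * ((c * q) * exp (- e) * v) = (p * q) * (c * exp (- e) * v)" by (simp only: mult_ac)
      then show ?thesis using that by simp
    qed
    show "\<bar>sqrt \<sigma>\<bar> ^ DIM('a) * ?f (x + sqrt \<sigma> *\<^sub>R z) = gauss z * f (x + sqrt \<sigma> *\<^sub>R z)"
      by (simp only: A B D gauss_def minus_divide_left[symmetric] E[OF C])
  qed
  finally show ?thesis .
qed

lemma heat_flow_bound:
  fixes f :: "'a::euclidean_space \<Rightarrow> real"
  assumes "\<And>x. \<bar>f x\<bar> \<le> B"
  shows "\<bar>heat_flow \<sigma> f x\<bar> \<le> B"
proof -
  have "norm (heat_flow \<sigma> f x) \<le> (LINT z|lborel. gauss (z::'a) * B)"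
    unfolding heat_flow_def
    by (rule norm_integral_le) (use gauss_integral(1)[where 'a='a] assms less_imp_le[OF gauss_pos] in \<open>auto simp: abs_mult intro!: mult_mono\<close>)
  then show ?thesis using gauss_integral(2)[where 'a='a] by simp
qed

lemma heat_flow_bcontfun:
  assumes f: "f \<in> bcontfun"
  shows "heat_flow \<sigma> f \<in> bcontfun"
proof -
  obtain B where B: "\<And>x. \<bar>f x\<bar> \<le> B" using bcontfunD(3)[OF f] by auto
  note [measurable] = bcontfunD(2)[OF f]
  have "continuous_on UNIV (heat_flow \<sigma> f)"
    unfolding heat_flow_def[abs_def]
    by (rule continuous_param_integral[OF gauss_integral(1) bcontfunD(1)[OF f] B]) (auto intro!: continuous_intros)
  then show ?thesis by (rule bcontfunI[where B=B]) (use heat_flow_bound[OF B] in auto)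
qed

lemma heat_flow_continuous_time:
  assumes f: "f \<in> bcontfun"
  shows "continuous_on UNIV (\<lambda>\<sigma>. heat_flow \<sigma> f x)"
proof -
  obtain B where B: "\<And>x. \<bar>f x\<bar> \<le> B" using bcontfunD(3)[OF f] by auto
  note [measurable] = bcontfunD(2)[OF f]
  show ?thesis unfolding heat_flow_def[abs_def]
    by (rule continuous_param_integral[OF gauss_integral(1) bcontfunD(1)[OF f] B]) (auto intro!: continuous_intros)
qed

lemma heat_flow_0: "heat_flow 0 f = f"
  by (rule ext) (simp add: heat_flow_def gauss_integral(2))

lemma heat_flow_measurable [measurable (raw)]:
  assumes f: "f \<in> borel_measurable borel" "u \<in> borel_measurable N" "v \<in> borel_measurable N"
  shows "(\<lambda>p. heat_flow (u p) f (v p)) \<in> borel_measurable N"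
  unfolding heat_flow_def using assms by measurable

text \<open>With p = r/sqrt(\<tau>) and q = sqrt(\<sigma>)/sqrt(\<tau>) one has p^2 = 1 + q^2, so
  the quadratic form |z|^2 + |pv - qz|^2 has the same coefficient p^2 at |z|^2 and at |v|^2 and is
  symmetric in z and v.\<close>

lemma gauss_rotate:
  fixes z v :: "'a::euclidean_space"
  assumes "0 < \<tau>" "0 \<le> \<sigma>" and r: "r\<^sup>2 = \<sigma> + \<tau>"
  shows "gauss z * gauss ((r / sqrt \<tau>) *\<^sub>R v - (sqrt \<sigma> / sqrt \<tau>) *\<^sub>R z) = gauss v * gauss ((r / sqrt \<tau>) *\<^sub>R z - (sqrt \<sigma> / sqrt \<tau>) *\<^sub>R v)"
proof -
  have n: "(norm (a *\<^sub>R x - b *\<^sub>R y))\<^sup>2 = a\<^sup>2 * (norm x)\<^sup>2 - 2 * a * b * (x \<bullet> y) + b\<^sup>2 * (norm y)\<^sup>2" for a b and x y :: 'a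
    unfolding power2_norm_eq_inner inner_diff_left inner_diff_right inner_scaleR_left inner_scaleR_right inner_commute[of y x]
    by (simp add: power2_eq_square algebra_simps)
  have c: "(r / sqrt \<tau>)\<^sup>2 = 1 + \<sigma> / \<tau>" "(sqrt \<sigma> / sqrt \<tau>)\<^sup>2 = \<sigma> / \<tau>"
    using assms by (auto simp: power_divide add_divide_distrib)
  have "(norm z)\<^sup>2 + (norm ((r / sqrt \<tau>) *\<^sub>R v - (sqrt \<sigma> / sqrt \<tau>) *\<^sub>R z))\<^sup>2 = (norm v)\<^sup>2 + (norm ((r / sqrt \<tau>) *\<^sub>R z - (sqrt \<sigma> / sqrt \<tau>) *\<^sub>R v))\<^sup>2"
    unfolding n c by (simp add: inner_commute algebra_simps)
  then have "exp (- ((norm z)\<^sup>2 + (norm ((r / sqrt \<tau>) *\<^sub>R v - (sqrt \<sigma> / sqrt \<tau>) *\<^sub>R z))\<^sup>2) / 4) = exp (- ((norm v)\<^sup>2 + (norm ((r / sqrt \<tau>) *\<^sub>R z - (sqrt \<sigma> / sqrt \<tau>) *\<^sub>R v))\<^sup>2) / 4)"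
    by simp
  then have "exp (- (norm z)\<^sup>2 / 4) * exp (- (norm ((r / sqrt \<tau>) *\<^sub>R v - (sqrt \<sigma> / sqrt \<tau>) *\<^sub>R z))\<^sup>2 / 4)
      = exp (- (norm v)\<^sup>2 / 4) * exp (- (norm ((r / sqrt \<tau>) *\<^sub>R z - (sqrt \<sigma> / sqrt \<tau>) *\<^sub>R v))\<^sup>2 / 4)"
    by (simp only: exp_add[symmetric] add_divide_distrib[symmetric] minus_add_distrib[symmetric])
  then show ?thesis by (simp add: gauss_def)
qed

text \<open>A change of the inner variable makes the argument of \<open>f\<close> depend on v alone,
  as x + rv. It remains to integrate the joint density \<open>k\<close> over z, and by its symmetry
  this is the same as the easy integration over v.\<close>

lemma heat_flow_semigroup:
  fixes f :: "'a::euclidean_space \<Rightarrow> real"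
  assumes f: "f \<in> bcontfun" and "0 \<le> \<sigma>" "0 \<le> \<tau>"
  shows "heat_flow \<sigma> (heat_flow \<tau> f) x = heat_flow (\<sigma> + \<tau>) f x"
proof (cases "\<tau> = 0")
  case True
  then show ?thesis by (simp add: heat_flow_0)
next
  case False
  then have t: "0 < \<tau>" using assms by simp
  obtain B where B: "\<And>x. \<bar>f x\<bar> \<le> B" "B \<ge> 0" using bcontfunD(3)[OF f] by auto
  note [measurable] = bcontfunD(2)[OF f]
  define r where "r = sqrt (\<sigma> + \<tau>)"
  have r: "0 < r" "r\<^sup>2 = \<sigma> + \<tau>" using t assms by (auto simp: r_def)
  define p where "p = r / sqrt \<tau>"
  define q where "q = sqrt \<sigma> / sqrt \<tau>"
  have p: "p > 0" "sqrt \<tau> * p = r" "sqrt \<tau> * q = sqrt \<sigma>" using r t by (auto simp: p_def q_def)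
  \<comment> \<open>The joint density of z and v = (sqrt(\<sigma>) z + sqrt(\<tau>) y)/r for
    independent z, y distributed as \<open>gauss\<close>; y equals pv - qz, and the power of p is
    the Jacobian.\<close>
  define k where "k z v = \<bar>p\<bar> ^ DIM('a) * (gauss z * gauss (p *\<^sub>R v - q *\<^sub>R z))" for z v :: 'a
  have k0: "k z v \<ge> 0" for z v using gauss_pos[of z] gauss_pos[of "p *\<^sub>R v - q *\<^sub>R z"] by (simp add: k_def)
  have [measurable]: "(\<lambda>(z, v). k z v) \<in> borel_measurable (borel \<Otimes>\<^sub>M borel)" unfolding k_def by measurable
  have G: "\<bar>p\<bar> ^ DIM('a) * (LINT v|lborel. gauss (p *\<^sub>R v - q *\<^sub>R z)) = 1" for z :: 'a
    using lborel_integral_affine[of p gauss "- (q *\<^sub>R z)"] p gauss_integral(2)[where 'a='a] by simp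
  have Gi: "integrable lborel (\<lambda>v::'a. gauss (p *\<^sub>R v - q *\<^sub>R z))" for z :: 'a
    using lborel_integrable_affine[OF _ gauss_integral(1), of p "- (q *\<^sub>R z)"] p by simp
  have kv: "integrable lborel (k z)" "(LINT v|lborel. k z v) = gauss z" for z
    using Gi[of z] G[of z] by (simp_all add: k_def[abs_def] mult.left_commute[of _ "gauss z"])
  have sym: "k z v = k v z" for z v unfolding k_def p_def q_def by (subst gauss_rotate[OF t assms(2) r(2)]) (rule refl)
  have int: "integrable (lborel \<Otimes>\<^sub>M lborel) (\<lambda>(z, v). k z v * f (x + r *\<^sub>R v))"
  proof (rule Bochner_Integration.integrable_bound)
    show "integrable (lborel \<Otimes>\<^sub>M lborel) (\<lambda>(z, v). B * k z v)"
      by (rule lborel_pair.Fubini_integrable) (use kv k0 B gauss_integral(1) in auto)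
    show "AE zv in lborel \<Otimes>\<^sub>M lborel. norm (case zv of (z, v) \<Rightarrow> k z v * f (x + r *\<^sub>R v)) \<le> norm (case zv of (z, v) \<Rightarrow> B * k z v)"
      using B k0 by (intro AE_I2) (auto simp: abs_mult mult.commute[of B] intro!: mult_left_mono)
  qed measurable
  have "heat_flow \<tau> f (x + sqrt \<sigma> *\<^sub>R z) * gauss z = (LINT v|lborel. k z v * f (x + r *\<^sub>R v))" for z
  proof -
    have "heat_flow \<tau> f (x + sqrt \<sigma> *\<^sub>R z) = \<bar>p\<bar> ^ DIM('a) * (LINT v|lborel. gauss (- (q *\<^sub>R z) + p *\<^sub>R v) * f (x + sqrt \<sigma> *\<^sub>R z + sqrt \<tau> *\<^sub>R (- (q *\<^sub>R z) + p *\<^sub>R v)))"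
      unfolding heat_flow_def using p by (intro lborel_integral_affine) auto
    also have "(\<lambda>v. x + sqrt \<sigma> *\<^sub>R z + sqrt \<tau> *\<^sub>R (- (q *\<^sub>R z) + p *\<^sub>R v)) = (\<lambda>v. x + r *\<^sub>R v)"
      using p by (simp add: scaleR_add_right scaleR_diff_right)
    finally have "heat_flow \<tau> f (x + sqrt \<sigma> *\<^sub>R z) * gauss z = (LINT v|lborel. \<bar>p\<bar> ^ DIM('a) * gauss z * (gauss (p *\<^sub>R v - q *\<^sub>R z) * f (x + r *\<^sub>R v)))"
      by (simp add: mult_ac)
    then show ?thesis by (simp add: k_def mult_ac)
  qed
  then have "heat_flow \<sigma> (heat_flow \<tau> f) x = (LINT z|lborel. LINT v|lborel. k z v * f (x + r *\<^sub>R v))"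
    unfolding heat_flow_def[of \<sigma> "heat_flow \<tau> f"] by (simp add: mult.commute)
  also have "\<dots> = (LINT v|lborel. LINT z|lborel. k z v * f (x + r *\<^sub>R v))"
    by (rule lborel_pair.Fubini_integral[OF int, symmetric])
  also have "\<dots> = (LINT v|lborel. (LINT z|lborel. k v z) * f (x + r *\<^sub>R v))"
    by (simp add: sym)
  also have "\<dots> = heat_flow (\<sigma> + \<tau>) f x" by (simp add: kv heat_flow_def r_def)
  finally show ?thesis .
qed

section \<open>Derivatives of the heat semigroup\<close>

text \<open>A differential encoded by its values on the basis, which is the form in which
  \<open>iter_deriv\<close> supplies derivatives.\<close>

definition grad_form :: "('a::euclidean_space \<Rightarrow> real) \<Rightarrow> 'a \<Rightarrow> real" where
  "grad_form D h = (\<Sum>b\<in>Basis. (h \<bullet> b) * D b)"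

lemma bounded_linear_grad_form: "bounded_linear (grad_form D)"
  unfolding grad_form_def by (intro bounded_linear_intros bounded_linear_mult_const bounded_linear_inner_left)

lemma grad_form_Basis: "b \<in> Basis \<Longrightarrow> grad_form D b = D b"
  by (simp add: grad_form_def inner_Basis if_distrib if_distribR sum.delta cong: if_cong)

lemma grad_form_bound:
  fixes h :: "'a::euclidean_space"
  assumes "\<And>b. b \<in> Basis \<Longrightarrow> \<bar>D b\<bar> \<le> B"
  shows "\<bar>grad_form D h\<bar> \<le> real DIM('a) * B * norm h"
proof -
  have "\<bar>grad_form D h\<bar> \<le> (\<Sum>b\<in>(Basis::'a set). norm h * B)"
    unfolding grad_form_def
    by (rule order_trans[OF sum_abs], rule sum_mono) (auto simp: abs_mult intro!: mult_mono Basis_le_norm assms)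
  then show ?thesis by (simp add: mult_ac)
qed

lemma has_derivative_grad_form:
  assumes "f differentiable (at x)"
  shows "(f has_derivative grad_form (\<lambda>b. frechet_derivative f (at x) b)) (at x)"
proof -
  have D: "(f has_derivative frechet_derivative f (at x)) (at x)" using assms by (simp add: frechet_derivative_works)
  interpret linear "frechet_derivative f (at x)" using D by (rule has_derivative_linear)
  have "frechet_derivative f (at x) h = grad_form (\<lambda>b. frechet_derivative f (at x) b) h" for h
  proof -
    have "frechet_derivative f (at x) h = frechet_derivative f (at x) (\<Sum>b\<in>Basis. (h \<bullet> b) *\<^sub>R b)"
      by (simp add: euclidean_representation)
    then show ?thesis by (simp add: sum scale grad_form_def)
  qed
  with D show ?thesis by (metis ext)
qed

lemma frechet_grad_form:
  assumes "(f has_derivative grad_form D) (at x)"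
  shows "f differentiable (at x)" "b \<in> Basis \<Longrightarrow> frechet_derivative f (at x) b = D b"
  using assms frechet_derivative_at[OF assms] grad_form_Basis[of b D] by (auto simp: differentiable_def)

text \<open>The operator norm of the differential is estimated coordinate by coordinate; the powers
  of the dimension in later constants come from here.\<close>

lemma mean_value_bound:
  fixes f :: "'a::euclidean_space \<Rightarrow> real"
  assumes "convex S" "\<And>x. x \<in> S \<Longrightarrow> (f has_derivative grad_form (D x)) (at x)"
    "\<And>x b. x \<in> S \<Longrightarrow> b \<in> Basis \<Longrightarrow> \<bar>D x b\<bar> \<le> B" "x \<in> S" "y \<in> S"
  shows "\<bar>f x - f y\<bar> \<le> real DIM('a) * B * norm (x - y)"
proof -
  have "norm (f x - f y) \<le> real DIM('a) * B * norm (x - y)"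
  proof (rule differentiable_bound[OF assms(1) _ _ assms(4,5)])
    fix z assume z: "z \<in> S"
    show "(f has_derivative grad_form (D z)) (at z within S)" using assms(2)[OF z] by (rule has_derivative_at_withinI)
    show "onorm (grad_form (D z)) \<le> real DIM('a) * B"
      using grad_form_bound[of "D z" B] assms(3)[OF z] by (intro onorm_le) simp
  qed
  then show ?thesis by simp
qed

text \<open>Frechet differentiation under the integral sign: the mean value bound keeps the
  remainder quotient below 2 DIM m(w) uniformly near x0, and dominated convergence applies along
  every sequence tending to x0.\<close>

lemma has_derivative_integral:
  fixes G :: "'m \<Rightarrow> 'a::euclidean_space \<Rightarrow> real"
  assumes r: "0 < r"
    and int: "\<And>x. x \<in> ball x0 r \<Longrightarrow> integrable M (\<lambda>w. G w x)"
    and der: "\<And>w x. w \<in> space M \<Longrightarrow> x \<in> ball x0 r \<Longrightarrow> (G w has_derivative grad_form (D w x)) (at x)"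
    and bnd: "\<And>w x b. w \<in> space M \<Longrightarrow> x \<in> ball x0 r \<Longrightarrow> b \<in> Basis \<Longrightarrow> \<bar>D w x b\<bar> \<le> m w"
    and m: "integrable M m"
    and Dm: "\<And>b. b \<in> Basis \<Longrightarrow> (\<lambda>w. D w x0 b) \<in> borel_measurable M"
  shows "((\<lambda>x. LINT w|M. G w x) has_derivative grad_form (\<lambda>b. LINT w|M. D w x0 b)) (at x0)"
proof -
  let ?N = "real DIM('a)"
  have x0: "x0 \<in> ball x0 r" using r by simp
  have Di: "integrable M (\<lambda>w. D w x0 b)" if "b \<in> Basis" for b
    using bnd[OF _ x0 that] by (intro Bochner_Integration.integrable_bound[OF m Dm[OF that]] AE_I2) fastforce
  then have Gi: "integrable M (\<lambda>w. grad_form (D w x0) h)" for h unfolding grad_form_def by auto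
  have Gint: "(LINT w|M. grad_form (D w x0) h) = grad_form (\<lambda>b. LINT w|M. D w x0 b) h" for h
    unfolding grad_form_def by (subst Bochner_Integration.integral_sum) (use Di in auto)
  have "((\<lambda>y. ((LINT w|M. G w y) - (LINT w|M. G w x0) - grad_form (\<lambda>b. LINT w|M. D w x0 b) (y - x0)) /\<^sub>R norm (y - x0)) \<longlongrightarrow> 0) (at x0 within ball x0 r)"
    unfolding tendsto_at_iff_sequentially o_def
  proof safe
    fix X assume X: "\<forall>i. X i \<in> ball x0 r - {x0}" "X \<longlonglongrightarrow> x0"
    have Xb: "X i \<in> ball x0 r" "X i \<noteq> x0" for i using X(1) by auto
    let ?q = "\<lambda>i w. (G w (X i) - G w x0 - grad_form (D w x0) (X i - x0)) /\<^sub>R norm (X i - x0)"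
    have eq: "((LINT w|M. G w (X i)) - (LINT w|M. G w x0) - grad_form (\<lambda>b. LINT w|M. D w x0 b) (X i - x0)) /\<^sub>R norm (X i - x0)
       = (LINT w|M. ?q i w)" for i
      using int[OF Xb(1)] int[OF x0] Gi by (simp add: Gint)
    have "(\<lambda>i. LINT w|M. ?q i w) \<longlonglongrightarrow> (LINT w|M. 0)"
    proof (rule integral_dominated_convergence[where w="\<lambda>w. 2 * ?N * m w"])
      show "(\<lambda>w. ?q i w) \<in> borel_measurable M" for i
        using int[OF Xb(1)] int[OF x0] Gi by (intro borel_measurable_integrable) auto
      show "AE w in M. (\<lambda>i. ?q i w) \<longlonglongrightarrow> 0"
      proof (intro AE_I2)
        fix w assume w: "w \<in> space M"
        have "((\<lambda>y. (G w y - G w x0 - grad_form (D w x0) (y - x0)) /\<^sub>R norm (y - x0)) \<longlongrightarrow> 0) (at x0)"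
          using der[OF w x0] unfolding has_derivative_at_within by blast
        then show "(\<lambda>i. ?q i w) \<longlonglongrightarrow> 0"
          using X Xb(2) unfolding tendsto_at_iff_sequentially o_def by auto
      qed
      show "AE w in M. norm (?q i w) \<le> 2 * ?N * m w" for i
      proof (intro AE_I2)
        fix w assume w: "w \<in> space M"
        have "\<bar>G w (X i) - G w x0\<bar> \<le> ?N * m w * norm (X i - x0)"
          by (rule mean_value_bound[where S="ball x0 r" and D="D w"]) (use der[OF w] bnd[OF w] Xb x0 in auto)
        moreover have "\<bar>grad_form (D w x0) (X i - x0)\<bar> \<le> ?N * m w * norm (X i - x0)"
          by (rule grad_form_bound) (use bnd[OF w x0] in auto)
        ultimately have "\<bar>G w (X i) - G w x0 - grad_form (D w x0) (X i - x0)\<bar> \<le> 2 * ?N * m w * norm (X i - x0)" by linarith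
        then show "norm (?q i w) \<le> 2 * ?N * m w"
          using Xb(2)[of i] by (simp add: abs_mult divide_inverse[symmetric] mult.commute[of "inverse _"] divide_le_eq)
      qed
    qed (use m in auto)
    then show "(\<lambda>i. ((LINT w|M. G w (X i)) - (LINT w|M. G w x0) - grad_form (\<lambda>b. LINT w|M. D w x0 b) (X i - x0)) /\<^sub>R norm (X i - x0)) \<longlonglongrightarrow> 0"
      unfolding eq by simp
  qed
  then have "((\<lambda>x. LINT w|M. G w x) has_derivative grad_form (\<lambda>b. LINT w|M. D w x0 b)) (at x0 within ball x0 r)"
    unfolding has_derivative_at_within using bounded_linear_grad_form by blast
  then show ?thesis unfolding at_within_open[OF x0 open_ball] .
qed

text \<open>The derivative is moved to the kernel, whose derivative in direction b is -(z \<bullet>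
  b)/2 times \<open>gauss\<close>. Hence it makes sense for data that are merely continuous, and it
  costs a factor \<sigma>^(-1/2).\<close>

definition heat_grad :: "'a::euclidean_space \<Rightarrow> real \<Rightarrow> ('a \<Rightarrow> real) \<Rightarrow> 'a \<Rightarrow> real" where
  "heat_grad b \<sigma> f x = (LINT z|lborel. ((z \<bullet> b) / 2 * gauss z) * f (x + sqrt \<sigma> *\<^sub>R z)) / sqrt \<sigma>"

lemma moment_weight_bound:
  fixes z b :: "'a::euclidean_space"
  assumes "b \<in> Basis"
  shows "\<bar>(z \<bullet> b) / 2 * gauss z\<bar> \<le> (1 + (norm z)\<^sup>2) * gauss z"
proof -
  have "\<bar>z \<bullet> b\<bar> / 2 \<le> norm z" using Basis_le_norm[OF assms, of z] by simp
  also have "norm z \<le> 1 + (norm z)\<^sup>2"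
    using zero_le_power2[of "norm z - 1/2"] by (simp add: power2_diff power2_eq_square[of "1/2"])
  finally have "\<bar>z \<bullet> b\<bar> / 2 * gauss z \<le> (1 + (norm z)\<^sup>2) * gauss z"
    by (rule mult_right_mono) (rule less_imp_le[OF gauss_pos])
  then show ?thesis using gauss_pos[of z] by (simp add: abs_mult)
qed

lemma moment_weight_integrable:
  assumes "b \<in> Basis"
  shows "integrable lborel (\<lambda>z::'a::euclidean_space. (z \<bullet> b) / 2 * gauss z)"
proof (rule Bochner_Integration.integrable_bound[OF gauss_moment_integrable])
  show "AE z in lborel. norm ((z \<bullet> b) / 2 * gauss z) \<le> norm ((1 + (norm z)\<^sup>2) * gauss z)"
    using moment_weight_bound[OF assms] by (intro AE_I2) (metis abs_ge_self order_trans real_norm_def)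
qed measurable

lemma gauss_has_derivative:
  fixes y :: "'a::euclidean_space"
  shows "((\<lambda>x. gauss (y - x)) has_derivative grad_form (\<lambda>b. ((y - x) \<bullet> b) / 2 * gauss (y - x))) (at x)"
proof -
  have "((\<lambda>x. gauss (y - x)) has_derivative (\<lambda>h. (h \<bullet> (y - x)) / 2 * gauss (y - x))) (at x)"
  proof -
    have d: "((\<lambda>x. y - x) has_derivative (\<lambda>h. - h)) (at x)" by (auto intro!: derivative_eq_intros)
    have "(\<lambda>h. - (1/4) * ((y - x) \<bullet> - h + - h \<bullet> (y - x))) = (\<lambda>h. (h \<bullet> (y - x)) / 2)"
      by (rule ext, subst inner_commute) simp
    with has_derivative_mult_right[OF has_derivative_inner[OF d d], of "- (1/4)"]
    have "((\<lambda>x. - ((y - x) \<bullet> (y - x)) / 4) has_derivative (\<lambda>h. (h \<bullet> (y - x)) / 2)) (at x)"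
      by simp
    from has_derivative_mult_right[OF has_derivative_exp[OF this], of "(4 * pi) powr (- (real DIM('a) / 2))"]
    show ?thesis unfolding gauss_def power2_norm_eq_inner by (simp add: mult_ac)
  qed
  also have "(\<lambda>h. (h \<bullet> (y - x)) / 2 * gauss (y - x)) = grad_form (\<lambda>b. ((y - x) \<bullet> b) / 2 * gauss (y - x))"
    by (rule ext, subst euclidean_inner) (simp add: grad_form_def sum_distrib_left sum_distrib_right sum_divide_distrib mult_ac)
  finally show ?thesis .
qed

text \<open>Differentiation under the integral needs one majorant for all x in a unit ball about x0.
  From |y - x0|^2 <= 2|y - x|^2 + 2 the exponent 1/8 drops to 1/16 at the price of the factor
  exp(1/8).\<close>

lemma moment_weight_shift_bound:
  fixes y x x0 b :: "'a::euclidean_space"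
  assumes "norm (x - x0) < 1" "b \<in> Basis"
  shows "\<bar>((y - x) \<bullet> b) / 2 * gauss (y - x)\<bar> \<le> 8 * ((4 * pi) powr (- (real DIM('a) / 2)) * (exp (1/8) * exp (- (1/16 * (norm (y - x0))\<^sup>2))))"
proof -
  have n: "norm (y - x0) \<le> norm (y - x) + 1" using norm_triangle_ineq[of "y - x" "x - x0"] assms by simp
  have "(norm (y - x0))\<^sup>2 \<le> (norm (y - x) + 1)\<^sup>2" by (rule power_mono[OF n]) simp
  also have "\<dots> \<le> 2 * (norm (y - x))\<^sup>2 + 2"
    using zero_le_power2[of "norm (y - x) - 1"] by (simp add: power2_eq_square algebra_simps)
  finally have "- (norm (y - x))\<^sup>2 / 8 \<le> 1/8 + - (1/16 * (norm (y - x0))\<^sup>2)" by simp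
  then have "exp (- (norm (y - x))\<^sup>2 / 8) \<le> exp (1/8) * exp (- (1/16 * (norm (y - x0))\<^sup>2))"
    by (simp only: exp_add[symmetric] exp_le_cancel_iff)
  then have "8 * ((4 * pi) powr (- (real DIM('a) / 2)) * exp (- (norm (y - x))\<^sup>2 / 8))
     \<le> 8 * ((4 * pi) powr (- (real DIM('a) / 2)) * (exp (1/8) * exp (- (1/16 * (norm (y - x0))\<^sup>2))))"
    by (intro mult_left_mono) auto
  then show ?thesis using moment_weight_bound[OF assms(2), of "y - x"] norm_gauss_le[of "y - x"] by linarith
qed

text \<open>As \<open>g\<close> has no derivative of its own, x is first moved from the argument of
  \<open>g\<close> into the kernel by y = x + z and moved back after differentiating.\<close>

lemma heat_unit_has_derivative:
  fixes g :: "'a::euclidean_space \<Rightarrow> real"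
  assumes g: "g \<in> bcontfun"
  shows "((\<lambda>x. LINT z|lborel. gauss z * g (x + z)) has_derivative grad_form (\<lambda>b. LINT z|lborel. (z \<bullet> b) / 2 * gauss z * g (x0 + z))) (at x0)"
proof -
  obtain B where B: "\<And>x. \<bar>g x\<bar> \<le> B" "B \<ge> 0" using bcontfunD(3)[OF g] by auto
  note [measurable] = bcontfunD(2)[OF g]
  have sub: "(LINT z|lborel. u z * g (x + z)) = (LINT y|lborel. u (y - x) * g y)"
    if [measurable]: "u \<in> borel_measurable borel" for u :: "'a \<Rightarrow> real" and x
    using lborel_integral_affine[of 1 "\<lambda>y. u (y - x) * g y" x] by simp
  have "((\<lambda>x. LINT y|lborel. gauss (y - x) * g y) has_derivative grad_form (\<lambda>b. LINT y|lborel. ((y - x0) \<bullet> b) / 2 * gauss (y - x0) * g y)) (at x0)"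
  proof (rule has_derivative_integral[where r=1 and D="\<lambda>y x b. ((y - x) \<bullet> b) / 2 * gauss (y - x) * g y"
        and m="\<lambda>y. 8 * ((4 * pi) powr (- (real DIM('a) / 2)) * (exp (1/8) * exp (- (1/16 * (norm (y - x0))\<^sup>2)))) * B"])
    have gi: "integrable lborel (\<lambda>y. gauss (y - x))" for x :: 'a
      using lborel_integrable_affine[OF _ gauss_integral(1), of 1 "- x"] by simp
    show "integrable lborel (\<lambda>y. gauss (y - x) * g y)" for x
      by (rule weight_integrable[OF gi]) (use B in auto)
    fix x y b :: 'a
    show "((\<lambda>x. gauss (y - x) * g y) has_derivative grad_form (\<lambda>b. ((y - x) \<bullet> b) / 2 * gauss (y - x) * g y)) (at x)"
    proof -
      have "((\<lambda>x. gauss (y - x) * g y) has_derivative (\<lambda>h. grad_form (\<lambda>b. ((y - x) \<bullet> b) / 2 * gauss (y - x)) h * g y)) (at x)"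
        by (rule has_derivative_mult_left[OF gauss_has_derivative])
      then show ?thesis unfolding grad_form_def by (simp add: sum_distrib_right mult.assoc)
    qed
    assume "x \<in> ball x0 1" "b \<in> Basis"
    then have "norm (x - x0) < 1" by (simp add: dist_norm norm_minus_commute)
    from moment_weight_shift_bound[OF this \<open>b \<in> Basis\<close>, of y]
    show "\<bar>((y - x) \<bullet> b) / 2 * gauss (y - x) * g y\<bar> \<le> 8 * ((4 * pi) powr (- (real DIM('a) / 2)) * (exp (1/8) * exp (- (1/16 * (norm (y - x0))\<^sup>2)))) * B"
      unfolding abs_mult[of _ "g y"] by (rule mult_mono) (use B in auto)
  next
    have "integrable lborel (\<lambda>y. exp (- (1/16 * (norm (- x0 + 1 *\<^sub>R y))\<^sup>2)))"
      by (rule lborel_integrable_affine) (use gaussian_integral(1)[of "1/16", where 'a='a] in auto)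
    then show "integrable lborel (\<lambda>y. 8 * ((4 * pi) powr (- (real DIM('a) / 2)) * (exp (1/8) * exp (- (1/16 * (norm (y - x0))\<^sup>2)))) * B)"
      by simp
  qed (simp, measurable)
  then show ?thesis
    by (simp add: sub)
qed

lemma heat_flow_has_derivative:
  fixes f :: "'a::euclidean_space \<Rightarrow> real"
  assumes f: "f \<in> bcontfun" and s: "0 < \<sigma>"
  shows "(heat_flow \<sigma> f has_derivative grad_form (\<lambda>b. heat_grad b \<sigma> f x)) (at x)"
proof -
  define g where "g y = f (sqrt \<sigma> *\<^sub>R y)" for y
  obtain B where B: "\<And>x. \<bar>f x\<bar> \<le> B" using bcontfunD(3)[OF f] by auto
  have g: "g \<in> bcontfun"
    unfolding g_def[abs_def] using B
    by (intro bcontfunI[where B=B] continuous_on_compose2[OF bcontfunD(1)[OF f]]) (auto intro!: continuous_intros)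
  have eq: "x + sqrt \<sigma> *\<^sub>R z = sqrt \<sigma> *\<^sub>R (x /\<^sub>R sqrt \<sigma> + z)" for x z :: 'a
    using s by (simp add: scaleR_add_right)
  have h: "heat_flow \<sigma> f = (\<lambda>x. LINT z|lborel. gauss z * g (x + z)) \<circ> (\<lambda>x. x /\<^sub>R sqrt \<sigma>)"
    unfolding heat_flow_def g_def o_def eq ..
  have "((\<lambda>x. LINT z|lborel. gauss z * g (x + z)) \<circ> (\<lambda>x. x /\<^sub>R sqrt \<sigma>) has_derivative
      grad_form (\<lambda>b. LINT z|lborel. (z \<bullet> b) / 2 * gauss z * g (x /\<^sub>R sqrt \<sigma> + z)) \<circ> (\<lambda>h. h /\<^sub>R sqrt \<sigma>)) (at x)"
    by (rule diff_chain_at[OF _ heat_unit_has_derivative[OF g]]) (auto intro!: derivative_eq_intros)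
  also have "grad_form (\<lambda>b. LINT z|lborel. (z \<bullet> b) / 2 * gauss z * g (x /\<^sub>R sqrt \<sigma> + z)) \<circ> (\<lambda>h. h /\<^sub>R sqrt \<sigma>)
     = grad_form (\<lambda>b. heat_grad b \<sigma> f x)"
  proof (rule ext)
    fix h
    have L: "heat_grad b \<sigma> f x = (LINT z|lborel. (z \<bullet> b) / 2 * gauss z * g (x /\<^sub>R sqrt \<sigma> + z)) * inverse (sqrt \<sigma>)" for b
      unfolding heat_grad_def g_def eq divide_inverse[of _ "sqrt \<sigma>"] ..
    show "(grad_form (\<lambda>b. LINT z|lborel. (z \<bullet> b) / 2 * gauss z * g (x /\<^sub>R sqrt \<sigma> + z)) \<circ> (\<lambda>h. h /\<^sub>R sqrt \<sigma>)) h
      = grad_form (\<lambda>b. heat_grad b \<sigma> f x) h"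
      unfolding L grad_form_def o_def inner_scaleR_left by (intro sum.cong refl) (simp only: mult_ac)
  qed
  finally show ?thesis unfolding h .
qed

lemma heat_grad_bcontfun:
  fixes f :: "'a::euclidean_space \<Rightarrow> real"
  assumes f: "f \<in> bcontfun" and b: "b \<in> Basis"
  shows "heat_grad b \<sigma> f \<in> bcontfun"
proof -
  obtain B where B: "\<And>x. \<bar>f x\<bar> \<le> B" using bcontfunD(3)[OF f] by auto
  note [measurable] = bcontfunD(2)[OF f]
  have "continuous_on UNIV (heat_grad b \<sigma> f)"
    unfolding heat_grad_def[abs_def] divide_inverse[of _ "sqrt \<sigma>"]
    by (intro continuous_on_mult_right continuous_param_integral[OF moment_weight_integrable[OF b] bcontfunD(1)[OF f] B])
       (auto intro!: continuous_intros)
  moreover have "norm (heat_grad b \<sigma> f x) \<le> (LINT z|lborel. \<bar>(z \<bullet> b) / 2 * gauss z\<bar> * B) / \<bar>sqrt \<sigma>\<bar>" for x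
    unfolding heat_grad_def norm_divide real_norm_def[of "sqrt \<sigma>"]
  proof (intro divide_right_mono norm_integral_le)
    show "integrable lborel (\<lambda>z. \<bar>(z \<bullet> b) / 2 * gauss z\<bar> * B)"
      by (rule integrable_mult_left[OF integrable_abs[OF moment_weight_integrable[OF b]]])
    show "norm ((z \<bullet> b) / 2 * gauss z * f (x + sqrt \<sigma> *\<^sub>R z)) \<le> \<bar>(z \<bullet> b) / 2 * gauss z\<bar> * B" for z
      unfolding real_norm_def abs_mult[of "z \<bullet> b / 2 * gauss z"] by (intro mult_left_mono B) simp
  qed simp
  ultimately show ?thesis by (rule bcontfunI)
qed

lemma divide_sqrt_powr: "0 < \<sigma> \<Longrightarrow> a / sqrt \<sigma> = a * \<sigma> powr (- (1/2))"
  by (simp only: powr_minus powr_half_sqrt[OF less_imp_le] divide_inverse[of a])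

lemma heat_grad_bound:
  fixes f :: "'a::euclidean_space \<Rightarrow> real"
  assumes f: "\<And>x. \<bar>f x\<bar> \<le> B" and b: "b \<in> Basis" and s: "0 < \<sigma>"
  shows "\<bar>heat_grad b \<sigma> f x\<bar> \<le> gauss_moment TYPE('a) * B * \<sigma> powr (- (1/2))"
proof -
  have "norm (LINT z|lborel. ((z \<bullet> b) / 2 * gauss z) * f (x + sqrt \<sigma> *\<^sub>R z)) \<le> (LINT z|lborel. (1 + (norm (z::'a))\<^sup>2) * gauss z * B)"
  proof (rule norm_integral_le)
    show "integrable lborel (\<lambda>z::'a. (1 + (norm z)\<^sup>2) * gauss z * B)" using gauss_moment_integrable by auto
    show "norm (z \<bullet> b / 2 * gauss z * f (x + sqrt \<sigma> *\<^sub>R z)) \<le> (1 + (norm z)\<^sup>2) * gauss z * B" for z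
      unfolding real_norm_def abs_mult[of "z \<bullet> b / 2 * gauss z"] by (intro mult_mono moment_weight_bound b f) (use less_imp_le[OF gauss_pos[of z]] in auto)
  qed
  then have "\<bar>heat_grad b \<sigma> f x\<bar> \<le> (gauss_moment TYPE('a) * B) / sqrt \<sigma>"
    using s unfolding heat_grad_def abs_divide gauss_moment_def integral_mult_left_zero real_norm_def abs_of_pos[OF real_sqrt_gt_zero[OF s]]
    by (intro divide_right_mono) auto
  then show ?thesis unfolding divide_sqrt_powr[OF s] .
qed

lemma heat_grad_const:
  assumes "b \<in> Basis"
  shows "(LINT z|lborel. (z \<bullet> b) / 2 * gauss (z::'a::euclidean_space)) = 0"
proof -
  have "(LINT z|lborel. (z \<bullet> b) / 2 * gauss z) = \<bar>- 1\<bar> ^ DIM('a) * (LINT z|lborel. ((0 + (- 1) *\<^sub>R z) \<bullet> b) / 2 * gauss (0 + (- 1) *\<^sub>R z))"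
    by (rule lborel_integral_affine) auto
  also have "\<dots> = - (LINT z|lborel. (z \<bullet> b) / 2 * gauss z)" by (simp add: gauss_minus)
  finally show ?thesis by simp
qed

text \<open>The kernel is odd, so f(x) may be subtracted from the data, and the increment
  contributes \<sigma>^(\<alpha>/2). The factor 2 in the hypothesis, which lets a function bounded
  by N count as the case \<alpha> = 0, is absorbed by the 1/2 in the kernel.\<close>

lemma heat_grad_bound_holder:
  fixes f :: "'a::euclidean_space \<Rightarrow> real"
  assumes f: "f \<in> bcontfun" and h: "\<And>x h. \<bar>f (x + h) - f x\<bar> \<le> 2 * N * norm h powr \<alpha>" and al: "0 \<le> \<alpha>" "\<alpha> < 1"
    and N: "0 \<le> N" and b: "b \<in> Basis" and s: "0 < \<sigma>"
  shows "\<bar>heat_grad b \<sigma> f x\<bar> \<le> gauss_moment TYPE('a) * N * \<sigma> powr ((\<alpha> - 1) / 2)"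
proof -
  obtain B where B: "\<And>x. \<bar>f x\<bar> \<le> B" using bcontfunD(3)[OF f] by auto
  note [measurable] = bcontfunD(2)[OF f]
  let ?w = "\<lambda>z. (z \<bullet> b) / 2 * gauss z"
  have i: "integrable lborel (\<lambda>z. ?w z * f (x + sqrt \<sigma> *\<^sub>R z))"
    by (rule weight_integrable[OF moment_weight_integrable[OF b]]) (use B in auto)
  have "(LINT z|lborel. ?w z * f (x + sqrt \<sigma> *\<^sub>R z)) = (LINT z|lborel. ?w z * f (x + sqrt \<sigma> *\<^sub>R z)) - (LINT z|lborel. ?w z) * f x"
    using heat_grad_const[OF b] by simp
  also have "\<dots> = (LINT z|lborel. ?w z * (f (x + sqrt \<sigma> *\<^sub>R z) - f x))"
    unfolding integral_mult_left_zero[symmetric] right_diff_distrib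
    by (rule Bochner_Integration.integral_diff[symmetric, OF i integrable_mult_left[OF moment_weight_integrable[OF b]]])
  finally have eq: "(LINT z|lborel. ?w z * f (x + sqrt \<sigma> *\<^sub>R z)) = (LINT z|lborel. ?w z * (f (x + sqrt \<sigma> *\<^sub>R z) - f x))" .
  have "norm (LINT z|lborel. ?w z * (f (x + sqrt \<sigma> *\<^sub>R z) - f x)) \<le> (LINT z|lborel. (1 + (norm (z::'a))\<^sup>2) * gauss z * (N * \<sigma> powr (\<alpha> / 2)))"
  proof (rule norm_integral_le)
    show "integrable lborel (\<lambda>z::'a. (1 + (norm z)\<^sup>2) * gauss z * (N * \<sigma> powr (\<alpha> / 2)))" using gauss_moment_integrable by auto
    fix z :: 'a
    have 1: "\<bar>z \<bullet> b\<bar> \<le> norm z" using Basis_le_norm[OF b] .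
    have "norm (sqrt \<sigma> *\<^sub>R z) powr \<alpha> = \<sigma> powr (\<alpha> / 2) * norm z powr \<alpha>"
      using s by (simp add: powr_mult powr_half_sqrt[symmetric] powr_powr mult.commute)
    then have 2: "\<bar>f (x + sqrt \<sigma> *\<^sub>R z) - f x\<bar> \<le> 2 * N * (\<sigma> powr (\<alpha> / 2) * norm z powr \<alpha>)" using h[of x "sqrt \<sigma> *\<^sub>R z"] by simp
    have 3: "norm z * norm z powr \<alpha> \<le> 1 + (norm z)\<^sup>2"
    proof (cases "norm z \<le> 1")
      case True
      then have "norm z * norm z powr \<alpha> \<le> 1 * 1" using al by (intro mult_mono powr_le1) auto
      then show ?thesis by (simp add: add_increasing2)
    next
      case False
      then have "norm z powr \<alpha> \<le> norm z powr 1" using al by (intro powr_mono) auto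
      then have "norm z * norm z powr \<alpha> \<le> norm z * norm z" by (intro mult_left_mono) auto
      then show ?thesis by (simp add: power2_eq_square)
    qed
    have "norm (?w z * (f (x + sqrt \<sigma> *\<^sub>R z) - f x)) = \<bar>z \<bullet> b\<bar> / 2 * gauss z * \<bar>f (x + sqrt \<sigma> *\<^sub>R z) - f x\<bar>"
      using gauss_pos[of z] by (simp add: abs_mult)
    also have "\<dots> \<le> norm z / 2 * gauss z * (2 * N * (\<sigma> powr (\<alpha> / 2) * norm z powr \<alpha>))"
      using 1 2 less_imp_le[OF gauss_pos[of z]] by (intro mult_mono) auto
    also have "\<dots> = (norm z * norm z powr \<alpha>) * (gauss z * (N * \<sigma> powr (\<alpha> / 2)))" by simp
    also have "\<dots> \<le> (1 + (norm z)\<^sup>2) * (gauss z * (N * \<sigma> powr (\<alpha> / 2)))"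
      using 3 N less_imp_le[OF gauss_pos[of z]] by (intro mult_right_mono) auto
    finally show "norm (?w z * (f (x + sqrt \<sigma> *\<^sub>R z) - f x)) \<le> (1 + (norm z)\<^sup>2) * gauss z * (N * \<sigma> powr (\<alpha> / 2))" by (simp add: mult.assoc)
  qed
  then have "\<bar>heat_grad b \<sigma> f x\<bar> \<le> (gauss_moment TYPE('a) * (N * \<sigma> powr (\<alpha> / 2))) / sqrt \<sigma>"
    using s unfolding heat_grad_def abs_divide gauss_moment_def integral_mult_left_zero real_norm_def abs_of_pos[OF real_sqrt_gt_zero[OF s]] eq
    by (intro divide_right_mono) auto
  also have "\<dots> = gauss_moment TYPE('a) * N * (\<sigma> powr (\<alpha> / 2) * \<sigma> powr (- (1/2)))"
    unfolding divide_sqrt_powr[OF s] by (simp only: mult_ac)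
  also have "\<dots> = gauss_moment TYPE('a) * N * \<sigma> powr ((\<alpha> - 1) / 2)"
    by (simp add: powr_add[symmetric] diff_divide_distrib)
  finally show ?thesis .
qed

text \<open>Here the derivative falls on the data instead of the kernel: the flow commutes with
  derivatives of data that already are continuously differentiable.\<close>

lemma heat_flow_C1:
  fixes f :: "'a::euclidean_space \<Rightarrow> real"
  assumes f: "f \<in> bcontfun" and D: "\<And>x. (f has_derivative grad_form (\<lambda>b. D b x)) (at x)"
    and Db: "\<And>b. b \<in> Basis \<Longrightarrow> D b \<in> bcontfun"
  shows "(heat_flow \<sigma> f has_derivative grad_form (\<lambda>b. heat_flow \<sigma> (D b) x)) (at x)"
proof -
  obtain B where B: "\<And>b x. b \<in> Basis \<Longrightarrow> \<bar>D b x\<bar> \<le> B b" using bcontfunD(3)[OF Db] unfolding real_norm_def by metis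
  note [measurable] = bcontfunD(2)[OF Db]
  show ?thesis unfolding heat_flow_def
  proof (rule has_derivative_integral[where r=1 and D="\<lambda>z x b. gauss z * D b (x + sqrt \<sigma> *\<^sub>R z)" and m="\<lambda>z. gauss z * (\<Sum>b\<in>Basis. \<bar>B b\<bar>)"])
    show "integrable lborel (\<lambda>z. gauss z * f (x + sqrt \<sigma> *\<^sub>R z))" for x by (rule heat_flow_integrable[OF f])
    show "((\<lambda>x. gauss z * f (x + sqrt \<sigma> *\<^sub>R z)) has_derivative grad_form (\<lambda>b. gauss z * D b (x + sqrt \<sigma> *\<^sub>R z))) (at x)" for z x
    proof -
      have "((\<lambda>x. x + sqrt \<sigma> *\<^sub>R z) has_derivative (\<lambda>h. h)) (at x)" by (auto intro!: derivative_eq_intros)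
      from has_derivative_compose[OF this D]
      have "((\<lambda>x. f (x + sqrt \<sigma> *\<^sub>R z)) has_derivative grad_form (\<lambda>b. D b (x + sqrt \<sigma> *\<^sub>R z))) (at x)" .
      from has_derivative_mult_right[OF this, of "gauss z"] show ?thesis
        unfolding grad_form_def by (simp add: sum_distrib_left mult_ac)
    qed
    show "\<bar>gauss z * D b (x + sqrt \<sigma> *\<^sub>R z)\<bar> \<le> gauss z * (\<Sum>b\<in>Basis. \<bar>B b\<bar>)" if b: "b \<in> Basis" for z x b
    proof -
      have "\<bar>D b (x + sqrt \<sigma> *\<^sub>R z)\<bar> \<le> \<bar>B b\<bar>" using B[OF b, of "x + sqrt \<sigma> *\<^sub>R z"] by linarith
      also have "\<dots> \<le> (\<Sum>b\<in>Basis. \<bar>B b\<bar>)" using b by (intro member_le_sum) auto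
      finally show ?thesis using less_imp_le[OF gauss_pos[of z]] by (simp add: abs_mult mult_left_mono)
    qed
  qed (use gauss_integral(1) in auto)
qed

text \<open>Each derivative is paid for by a share \<open>\<sigma>\<close> of the time; the semigroup property then reduces derivatives
  of any order to first ones.\<close>

primrec heat_iter :: "real \<Rightarrow> 'a::euclidean_space list \<Rightarrow> ('a \<Rightarrow> real) \<Rightarrow> 'a \<Rightarrow> real" where
  "heat_iter \<sigma> [] f = f"
| "heat_iter \<sigma> (b # bs) f = heat_grad b \<sigma> (heat_iter \<sigma> bs f)"

lemma heat_iter_bcontfun: "f \<in> bcontfun \<Longrightarrow> set bs \<subseteq> Basis \<Longrightarrow> heat_iter \<sigma> bs f \<in> bcontfun"
  by (induction bs) (auto intro: heat_grad_bcontfun)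

lemma iter_deriv_heat_flow:
  fixes f :: "'a::euclidean_space \<Rightarrow> real"
  assumes f: "f \<in> bcontfun" and s: "0 < \<sigma>"
  shows "0 < \<tau> \<Longrightarrow> set bs \<subseteq> Basis \<Longrightarrow> iter_deriv bs (heat_flow (\<tau> + real (length bs) * \<sigma>) f) = heat_flow \<tau> (heat_iter \<sigma> bs f)"
proof (induction bs arbitrary: \<tau>)
  case Nil
  then show ?case by simp
next
  case (Cons b bs)
  let ?w = "heat_iter \<sigma> bs f"
  have b: "b \<in> Basis" and w: "?w \<in> bcontfun" using Cons.prems f by (auto intro: heat_iter_bcontfun)
  have "iter_deriv bs (heat_flow (\<tau> + real (length (b # bs)) * \<sigma>) f) = iter_deriv bs (heat_flow ((\<tau> + \<sigma>) + real (length bs) * \<sigma>) f)"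
    by (simp add: algebra_simps)
  also have "\<dots> = heat_flow (\<tau> + \<sigma>) ?w" using Cons s by auto
  also have "\<dots> = heat_flow \<tau> (heat_flow \<sigma> ?w)"
    using Cons.prems s by (intro ext heat_flow_semigroup[symmetric] w) auto
  finally have eq: "iter_deriv bs (heat_flow (\<tau> + real (length (b # bs)) * \<sigma>) f) = heat_flow \<tau> (heat_flow \<sigma> ?w)" .
  \<comment> \<open>The inner flow over time \<sigma> makes the data differentiable, with derivative
    \<open>heat_grad\<close>; the outer flow over time \<tau> merely commutes with it and remains
    available for further derivatives.\<close>
  have "(heat_flow \<tau> (heat_flow \<sigma> ?w) has_derivative grad_form (\<lambda>b. heat_flow \<tau> (heat_grad b \<sigma> ?w) x)) (at x)" for x
    using w s by (intro heat_flow_C1 heat_flow_bcontfun heat_flow_has_derivative heat_grad_bcontfun)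
  then have "frechet_derivative (heat_flow \<tau> (heat_flow \<sigma> ?w)) (at x) b = heat_flow \<tau> (heat_grad b \<sigma> ?w) x" for x
    by (rule frechet_grad_form(2)[OF _ b])
  then show ?case unfolding iter_deriv.simps heat_iter.simps eq by (rule ext)
qed

text \<open>The time is cut into one share for each derivative and one for the remaining flow,
  whence the denominator.\<close>

lemma iter_deriv_heat_flow_step:
  fixes f :: "'a::euclidean_space \<Rightarrow> real"
  assumes f: "f \<in> bcontfun" and s: "0 < \<sigma>" and bs: "set bs \<subseteq> Basis"
  defines "\<epsilon> \<equiv> \<sigma> / (real (length bs) + 1)"
  shows "iter_deriv bs (heat_flow \<sigma> f) = heat_flow \<epsilon> (heat_iter \<epsilon> bs f)"
proof -
  have "\<epsilon> > 0" and "\<epsilon> * (real (length bs) + 1) = \<sigma>" using s by (auto simp: \<epsilon>_def)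
  then have "\<sigma> = \<epsilon> + real (length bs) * \<epsilon>" by (simp add: algebra_simps)
  then show ?thesis using iter_deriv_heat_flow[OF f \<open>\<epsilon> > 0\<close> \<open>\<epsilon> > 0\<close> bs] by simp
qed

lemma iter_deriv_heat_flow_bcontfun:
  assumes "f \<in> bcontfun" "0 < \<sigma>" "set bs \<subseteq> Basis"
  shows "iter_deriv bs (heat_flow \<sigma> f) \<in> bcontfun"
  unfolding iter_deriv_heat_flow_step[OF assms] using assms by (intro heat_flow_bcontfun heat_iter_bcontfun)

lemma iter_deriv_heat_flow_has_derivative:
  fixes f :: "'a::euclidean_space \<Rightarrow> real"
  assumes "f \<in> bcontfun" "0 < \<sigma>" "set bs \<subseteq> Basis"
  shows "(iter_deriv bs (heat_flow \<sigma> f) has_derivative grad_form (\<lambda>b. iter_deriv (b # bs) (heat_flow \<sigma> f) x)) (at x)"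
proof -
  have "iter_deriv bs (heat_flow \<sigma> f) differentiable (at x)"
    unfolding iter_deriv_heat_flow_step[OF assms]
    by (rule frechet_grad_form(1)[OF heat_flow_has_derivative]) (use assms in \<open>auto intro: heat_iter_bcontfun\<close>)
  from has_derivative_grad_form[OF this] show ?thesis by simp
qed

text \<open>Only the innermost derivative acts on the data and profits from the exponent \<alpha>;
  each further one sees a bounded function and costs \<sigma>^(-1/2).\<close>

lemma heat_iter_bound:
  fixes f :: "'a::euclidean_space \<Rightarrow> real"
  assumes f: "f \<in> bcontfun" and h: "\<And>x h. \<bar>f (x + h) - f x\<bar> \<le> 2 * N * norm h powr \<alpha>" and al: "0 \<le> \<alpha>" "\<alpha> < 1"
    and N: "0 \<le> N" and s: "0 < \<sigma>"
  shows "bs \<noteq> [] \<Longrightarrow> set bs \<subseteq> Basis \<Longrightarrow> \<bar>heat_iter \<sigma> bs f x\<bar> \<le> gauss_moment TYPE('a) ^ length bs * N * \<sigma> powr ((\<alpha> - real (length bs)) / 2)"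
proof (induction bs arbitrary: x)
  case (Cons b bs)
  show ?case
  proof (cases "bs = []")
    case True
    then show ?thesis using heat_grad_bound_holder[OF f h al N _ s] Cons.prems by simp
  next
    case False
    have "\<bar>heat_grad b \<sigma> (heat_iter \<sigma> bs f) x\<bar> \<le> gauss_moment TYPE('a) * (gauss_moment TYPE('a) ^ length bs * N * \<sigma> powr ((\<alpha> - real (length bs)) / 2)) * \<sigma> powr (- (1/2))"
      using Cons False by (intro heat_grad_bound s) auto
    also have "\<dots> = gauss_moment TYPE('a) ^ length (b # bs) * N * (\<sigma> powr ((\<alpha> - real (length bs)) / 2) * \<sigma> powr (- (1/2)))"
      by simp
    also have "\<dots> = gauss_moment TYPE('a) ^ length (b # bs) * N * \<sigma> powr ((\<alpha> - real (length (b # bs))) / 2)"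
      by (simp add: powr_add[symmetric] add_divide_distrib diff_divide_distrib algebra_simps)
    finally show ?thesis by simp
  qed
qed simp

text \<open>The power of k + 1, for k the number of derivatives, converts the share \<sigma>/(k+1)
  back into the full time \<sigma>.\<close>

lemma iter_deriv_heat_flow_bound:
  fixes f :: "'a::euclidean_space \<Rightarrow> real"
  assumes f: "f \<in> bcontfun" and h: "\<And>x h. \<bar>f (x + h) - f x\<bar> \<le> 2 * N * norm h powr \<alpha>" and al: "0 \<le> \<alpha>" "\<alpha> < 1"
    and N: "0 \<le> N" and s: "0 < \<sigma>" and bs: "bs \<noteq> []" "set bs \<subseteq> Basis"
  shows "\<bar>iter_deriv bs (heat_flow \<sigma> f) x\<bar> \<le> gauss_moment TYPE('a) ^ length bs * (real (length bs) + 1) powr ((real (length bs) - \<alpha>) / 2) * N * \<sigma> powr ((\<alpha> - real (length bs)) / 2)"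
proof -
  let ?k = "real (length bs)"
  define \<epsilon> where "\<epsilon> = \<sigma> / (?k + 1)"
  have e: "\<epsilon> > 0" using s by (simp add: \<epsilon>_def)
  have "\<bar>iter_deriv bs (heat_flow \<sigma> f) x\<bar> \<le> gauss_moment TYPE('a) ^ length bs * N * \<epsilon> powr ((\<alpha> - ?k) / 2)"
    unfolding iter_deriv_heat_flow_step[OF f s bs(2)] \<epsilon>_def[symmetric]
    by (intro heat_flow_bound heat_iter_bound assms e)
  also have "\<epsilon> powr ((\<alpha> - ?k) / 2) = \<sigma> powr ((\<alpha> - ?k) / 2) * (?k + 1) powr ((?k - \<alpha>) / 2)"
  proof -
    have "(?k - \<alpha>) / 2 = - ((\<alpha> - ?k) / 2)" by (simp add: field_simps)
    then have "(?k + 1) powr ((?k - \<alpha>) / 2) = inverse ((?k + 1) powr ((\<alpha> - ?k) / 2))" by (simp only: powr_minus)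
    moreover have "\<epsilon> powr ((\<alpha> - ?k) / 2) = \<sigma> powr ((\<alpha> - ?k) / 2) / (?k + 1) powr ((\<alpha> - ?k) / 2)"
      unfolding \<epsilon>_def by (rule powr_divide)
    ultimately show ?thesis by (simp only: divide_inverse)
  qed
  finally show ?thesis by (simp add: mult_ac)
qed

section \<open>The resolvent and the generator\<close>

lemma heat_flow_joint_continuous:
  fixes f :: "'a::euclidean_space \<Rightarrow> real"
  assumes f: "f \<in> bcontfun"
  shows "continuous_on UNIV (\<lambda>p. heat_flow (fst p) f (snd p))"
proof -
  obtain B where B: "\<And>x. \<bar>f x\<bar> \<le> B" using bcontfunD(3)[OF f] by auto
  note [measurable] = bcontfunD(2)[OF f]
  show ?thesis unfolding heat_flow_def
    by (rule continuous_param_integral[OF gauss_integral(1) bcontfunD(1)[OF f] B]) (auto intro!: continuous_intros)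
qed

locale fractional_order =
  fixes s :: real
  assumes s: "0 < s" "s < 1"
begin

text \<open>Extension by 0 turns integrals over the half-line into integrals over the line, so that
  supports are handled through the single fact \<open>weight_pos\<close>.\<close>

definition weight :: "real \<Rightarrow> real \<Rightarrow> real" where
  "weight lam \<sigma> = indicator {0<..} \<sigma> * resolvent_density s lam \<sigma>"

lemma weight_int: "0 < lam \<Longrightarrow> integrable lborel (weight lam)"
  using resolvent_density_integrable[OF s] by (simp add: weight_def[abs_def] set_integrable_def)

lemma weight_laplace: "0 < lam \<Longrightarrow> 0 < m \<Longrightarrow> (LINT \<sigma>|lborel. exp (- m * \<sigma>) * weight lam \<sigma>) = 1 / (lam + m powr s)"
  using resolvent_density_laplace[OF s, of lam m] by (simp add: weight_def set_lebesgue_integral_def mult_ac)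

lemma weight_pos: "weight lam \<sigma> \<noteq> 0 \<Longrightarrow> 0 < \<sigma>" by (auto simp: weight_def indicator_def split: if_splits)

definition resolvent_op :: "real \<Rightarrow> ('a::euclidean_space \<Rightarrow> real) \<Rightarrow> 'a \<Rightarrow> real" where
  "resolvent_op lam f x = (LINT \<sigma>|lborel. weight lam \<sigma> * heat_flow \<sigma> f x)"

definition weight_norm :: "real \<Rightarrow> real" where
  "weight_norm lam = (LINT \<sigma>|lborel. \<bar>weight lam \<sigma>\<bar>)"

lemma resolvent_op_int:
  assumes lam: "0 < lam" and f: "f \<in> bcontfun"
  shows "integrable lborel (\<lambda>\<sigma>. weight lam \<sigma> * heat_flow \<sigma> f x)"
proof -
  obtain B where B: "\<And>x. \<bar>f x\<bar> \<le> B" using bcontfunD(3)[OF f] by auto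
  note [measurable] = bcontfunD(2)[OF f]
  show ?thesis by (rule weight_integrable[OF weight_int[OF lam]]) (use heat_flow_bound[OF B] in auto)
qed

lemma resolvent_op_bound:
  assumes lam: "0 < lam" and B: "\<And>x. \<bar>f x\<bar> \<le> B"
  shows "\<bar>resolvent_op lam f x\<bar> \<le> weight_norm lam * B"
proof -
  have "norm (resolvent_op lam f x) \<le> (LINT \<sigma>|lborel. \<bar>weight lam \<sigma>\<bar> * B)"
    unfolding resolvent_op_def
    by (rule norm_integral_le) (use weight_int[OF lam] heat_flow_bound[OF B] in \<open>auto simp: abs_mult intro!: mult_left_mono\<close>)
  then show ?thesis by (simp add: weight_norm_def)
qed

lemma resolvent_op_bcontfun:
  fixes f :: "'a::euclidean_space \<Rightarrow> real"
  assumes lam: "0 < lam" and f: "f \<in> bcontfun"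
  shows "resolvent_op lam f \<in> bcontfun"
proof -
  obtain B where B: "\<And>x. \<bar>f x\<bar> \<le> B" using bcontfunD(3)[OF f] by auto
  note [measurable] = bcontfunD(2)[OF f]
  have "continuous_on UNIV (\<lambda>x. LINT \<sigma>|lborel. weight lam \<sigma> * (\<lambda>p. heat_flow (fst p) f (snd p)) (\<sigma>, x))"
    by (rule continuous_param_integral[OF weight_int[OF lam] heat_flow_joint_continuous[OF f]])
       (use heat_flow_bound[OF B] in \<open>auto intro!: continuous_intros\<close>)
  then have "continuous_on UNIV (resolvent_op lam f)" by (simp add: resolvent_op_def[abs_def])
  then show ?thesis by (rule bcontfunI) (use resolvent_op_bound[OF lam B] in auto)
qed

text \<open>On the quadrant of pairs (t, \<sigma>), the density exp(-\<lambda>t) times the stable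
  density projects to a signed measure in \<sigma> with the same transform as
  \<open>weight lam\<close>. Uniqueness of the transform, tested on
  \<open>heat_flow \<sigma> f x\<close>, identifies the integrals without any formula relating the
  two densities.\<close>

lemma resolvent_op_subordination:
  fixes f :: "'a::euclidean_space \<Rightarrow> real"
  assumes lam: "0 < lam" and f: "f \<in> bcontfun"
  shows "set_integrable lborel {0<..} (\<lambda>t. exp (- lam * t) * frac_heat s t f x)"
    and "(LINT t:{0<..}|lborel. exp (- lam * t) * frac_heat s t f x) = resolvent_op lam f x"
proof -
  obtain B where B: "\<And>x. \<bar>f x\<bar> \<le> B" using bcontfunD(3)[OF f] by auto
  note [measurable] = bcontfunD(2)[OF f]
  let ?g = "\<lambda>\<sigma>. heat_flow \<sigma> f x"
  define h where "h t \<sigma> = indicator {0<..} t * exp (- lam * t) * (indicator {0<..} \<sigma> * stable_density s t \<sigma>)" for t \<sigma> :: real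
  have [measurable]: "(\<lambda>(t, \<sigma>). h t \<sigma>) \<in> borel_measurable (lborel \<Otimes>\<^sub>M lborel)" unfolding h_def by measurable
  obtain K where K: "\<And>t. 0 < t \<Longrightarrow> set_integrable lborel {0<..} (stable_density s t)"
    "\<And>t. 0 < t \<Longrightarrow> (LINT \<sigma>:{0<..}|lborel. \<bar>stable_density s t \<sigma>\<bar>) \<le> K"
    using stable_density_integrable[OF s] by metis
  have hi: "integrable lborel (h t)" for t
    using K(1)[of t] unfolding h_def[abs_def] set_integrable_def by (cases "t > 0") auto
  have K0: "K \<ge> 0"
  proof -
    have "0 \<le> (LINT \<sigma>:{0<..}|lborel. \<bar>stable_density s 1 \<sigma>\<bar>)"
      unfolding set_lebesgue_integral_def by (intro Bochner_Integration.integral_nonneg) auto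
    then show ?thesis using K(2)[of 1] by linarith
  qed
  have eint: "integrable lborel (\<lambda>t. K * (indicator {0<..} t * exp (- lam * t)))"
    using integral_exp_real(1)[OF lam] by (simp add: set_integrable_def)
  have hint: "integrable (lborel \<Otimes>\<^sub>M lborel) (\<lambda>(t, \<sigma>). h t \<sigma>)"
  proof (rule lborel_pair.Fubini_integrable)
    show "integrable lborel (\<lambda>t. LINT \<sigma>|lborel. norm (case (t, \<sigma>) of (t, \<sigma>) \<Rightarrow> h t \<sigma>))"
    proof (rule Bochner_Integration.integrable_bound[OF eint])
      have "norm (LINT \<sigma>|lborel. norm (h t \<sigma>)) \<le> norm (K * (indicator {0<..} t * exp (- lam * t)))" for t
      proof (cases "t > 0")
        case True
        have "(LINT \<sigma>|lborel. norm (h t \<sigma>)) = exp (- lam * t) * (LINT \<sigma>:{0<..}|lborel. \<bar>stable_density s t \<sigma>\<bar>)"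
          using True by (simp add: h_def abs_mult set_lebesgue_integral_def)
        also have "\<dots> \<le> exp (- lam * t) * K" using K(2)[OF True] by (intro mult_left_mono) auto
        finally have "(LINT \<sigma>|lborel. norm (h t \<sigma>)) \<le> exp (- lam * t) * K" .
        moreover have "0 \<le> (LINT \<sigma>|lborel. norm (h t \<sigma>))" by (intro Bochner_Integration.integral_nonneg) auto
        ultimately show ?thesis using True K0 by (simp add: mult.commute)
      qed (simp add: h_def)
      then show "AE t in lborel. norm (LINT \<sigma>|lborel. norm (case (t, \<sigma>) of (t, \<sigma>) \<Rightarrow> h t \<sigma>)) \<le> norm (K * (indicator {0<..} t * exp (- lam * t)))"
        by simp
    qed measurable
  qed (use hi in auto)
  \<comment> \<open>Integrating over \<sigma> first leaves exp(-(\<lambda> + m^s)t), whose integral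
    over t > 0 is the transform of the resolvent density.\<close>
  have lap: "(LINT p|(lborel \<Otimes>\<^sub>M lborel). exp (- m * snd p) * (case p of (t, \<sigma>) \<Rightarrow> h t \<sigma>)) = 1 / (lam + m powr s)" if m: "0 < m" for m
  proof -
    have "integrable (lborel \<Otimes>\<^sub>M lborel) (\<lambda>p. exp (- m * snd p) * (case p of (t, \<sigma>) \<Rightarrow> h t \<sigma>))"
      by (rule integrable_bounded_mult[OF hint, where B=1]) (use m in \<open>auto simp: h_def indicator_def split: if_splits\<close>)
    from lborel_pair.integral_fst'[OF this]
    have "(LINT p|(lborel \<Otimes>\<^sub>M lborel). exp (- m * snd p) * (case p of (t, \<sigma>) \<Rightarrow> h t \<sigma>)) = (LINT t|lborel. LINT \<sigma>|lborel. exp (- m * \<sigma>) * h t \<sigma>)"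
      by simp
    also have "\<dots> = (LINT t:{0<..}|lborel. exp (- (lam + m powr s) * t))"
      unfolding set_lebesgue_integral_def
    proof (intro Bochner_Integration.integral_cong refl)
      fix t :: real
      show "(LINT \<sigma>|lborel. exp (- m * \<sigma>) * h t \<sigma>) = indicator {0<..} t *\<^sub>R exp (- (lam + m powr s) * t)"
      proof (cases "t > 0")
        case True
        have "(LINT \<sigma>|lborel. exp (- m * \<sigma>) * h t \<sigma>) = exp (- lam * t) * (LINT \<sigma>:{0<..}|lborel. exp (- m * \<sigma>) * stable_density s t \<sigma>)"
          unfolding set_lebesgue_integral_def integral_mult_right_zero[symmetric]
          using True by (intro Bochner_Integration.integral_cong) (auto simp: h_def)
        also have "(LINT \<sigma>:{0<..}|lborel. exp (- m * \<sigma>) * stable_density s t \<sigma>) = exp (- t * m powr s)"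
          using stable_density_laplace[OF s True] m by (simp add: is_inverse_laplace_def)
        finally show ?thesis using True by (simp add: exp_add[symmetric] algebra_simps)
      qed (simp add: h_def)
    qed
    also have "\<dots> = 1 / (lam + m powr s)" using lam by (intro integral_exp_real(2)) (simp add: add_pos_nonneg)
    finally show ?thesis .
  qed
  have gint: "integrable (lborel \<Otimes>\<^sub>M lborel) (\<lambda>p. ?g (snd p) * (case p of (t, \<sigma>) \<Rightarrow> h t \<sigma>))"
    by (rule integrable_bounded_mult[OF hint, where B=B]) (use heat_flow_bound[OF B] in auto)
  have inner: "(LINT \<sigma>|lborel. ?g \<sigma> * h t \<sigma>) = indicator {0<..} t *\<^sub>R (exp (- lam * t) * frac_heat s t f x)" for t
  proof (cases "t > 0")
    case True
    have "frac_heat s t f x = (LINT \<sigma>:{0<..}|lborel. ?g \<sigma> * stable_density s t \<sigma>)"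
      using True unfolding frac_heat_def
      by (auto intro!: set_lebesgue_integral_cong simp: heat_eq_flow[OF _ f] subord_density_eq[OF s True])
    moreover have "(LINT \<sigma>|lborel. ?g \<sigma> * h t \<sigma>) = exp (- lam * t) * (LINT \<sigma>:{0<..}|lborel. ?g \<sigma> * stable_density s t \<sigma>)"
      unfolding set_lebesgue_integral_def integral_mult_right_zero[symmetric]
      using True by (intro Bochner_Integration.integral_cong) (auto simp: h_def)
    ultimately show ?thesis using True by simp
  qed (simp add: h_def)
  show "set_integrable lborel {0<..} (\<lambda>t. exp (- lam * t) * frac_heat s t f x)"
    using lborel_pair.integrable_fst'[OF gint] by (simp add: inner set_integrable_def)
  have "(LINT t:{0<..}|lborel. exp (- lam * t) * frac_heat s t f x) = (LINT p|(lborel \<Otimes>\<^sub>M lborel). ?g (snd p) * (case p of (t, \<sigma>) \<Rightarrow> h t \<sigma>))"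
    using lborel_pair.integral_fst'[OF gint] by (simp add: inner set_lebesgue_integral_def)
  also have "\<dots> = (LINT \<sigma>|lborel. ?g \<sigma> * weight lam \<sigma>)"
    by (rule laplace_unique[where g="?g" and B=B, OF hint _ _ weight_int[OF lam]])
       (use lap weight_laplace[OF lam] weight_pos heat_flow_continuous_time[OF f] heat_flow_bound[OF B] in
         \<open>auto simp: h_def less_imp_le indicator_def split: if_splits\<close>)
  finally show "(LINT t:{0<..}|lborel. exp (- lam * t) * frac_heat s t f x) = resolvent_op lam f x"
    by (simp add: resolvent_op_def mult.commute)
qed

text \<open>Fubini and the semigroup law. For negative \<tau>, where the law is not at hand, the
  weight makes both integrands vanish.\<close>

lemma heat_flow_resolvent_op:
  fixes f :: "'a::euclidean_space \<Rightarrow> real"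
  assumes mu: "0 < mu" and f: "f \<in> bcontfun" and sg: "0 \<le> \<sigma>"
  shows "heat_flow \<sigma> (resolvent_op mu f) x = (LINT \<tau>|lborel. weight mu \<tau> * heat_flow (\<sigma> + \<tau>) f x)"
proof -
  obtain B where B: "\<And>x. \<bar>f x\<bar> \<le> B" using bcontfunD(3)[OF f] by auto
  note [measurable] = bcontfunD(2)[OF f] borel_measurable_integrable[OF weight_int[OF mu]]
  have i0: "integrable (lborel \<Otimes>\<^sub>M lborel) (\<lambda>(z::'a, \<tau>). gauss z * weight mu \<tau>)"
    using gauss_integral(1) weight_int[OF mu] by (intro lborel_pair.Fubini_integrable) (auto simp: abs_mult)
  have "integrable (lborel \<Otimes>\<^sub>M lborel) (\<lambda>p. heat_flow (snd p) f (x + sqrt \<sigma> *\<^sub>R fst p) * (case p of (z, \<tau>) \<Rightarrow> gauss z * weight mu \<tau>))"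
    by (rule integrable_bounded_mult[OF i0, where B=B]) (use heat_flow_bound[OF B] in auto)
  then have int: "integrable (lborel \<Otimes>\<^sub>M lborel) (\<lambda>(z, \<tau>). gauss z * (weight mu \<tau> * heat_flow \<tau> f (x + sqrt \<sigma> *\<^sub>R z)))"
    by (simp add: case_prod_beta' mult_ac)
  have "heat_flow \<sigma> (resolvent_op mu f) x = (LINT z|lborel. LINT \<tau>|lborel. gauss z * (weight mu \<tau> * heat_flow \<tau> f (x + sqrt \<sigma> *\<^sub>R z)))"
    by (simp add: heat_flow_def[of \<sigma>] resolvent_op_def)
  also have "\<dots> = (LINT \<tau>|lborel. LINT z|lborel. gauss z * (weight mu \<tau> * heat_flow \<tau> f (x + sqrt \<sigma> *\<^sub>R z)))"
    by (rule lborel_pair.Fubini_integral[OF int, symmetric])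
  also have "\<dots> = (LINT \<tau>|lborel. weight mu \<tau> * heat_flow \<sigma> (heat_flow \<tau> f) x)"
    by (simp add: heat_flow_def[of \<sigma>] mult.left_commute[of "gauss _"])
  also have "\<dots> = (LINT \<tau>|lborel. weight mu \<tau> * heat_flow (\<sigma> + \<tau>) f x)"
  proof (intro Bochner_Integration.integral_cong refl)
    fix \<tau>
    show "weight mu \<tau> * heat_flow \<sigma> (heat_flow \<tau> f) x = weight mu \<tau> * heat_flow (\<sigma> + \<tau>) f x"
      using heat_flow_semigroup[OF f sg, of \<tau> x] weight_pos[of mu \<tau>] by (cases "weight mu \<tau> = 0") auto
  qed
  finally show ?thesis .
qed

text \<open>With q = m^s the transforms satisfy the partial fraction identity 1/(\<lambda> + q) -
  1/(\<mu> + q) = (\<mu> - \<lambda>)/((\<lambda> + q)(\<mu> + q)). The product on the right belongs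
  to the convolution of the weights, represented by the map (\<sigma>, \<tau>) to \<sigma> + \<tau>
  on the product space.\<close>

lemma resolvent_identity:
  fixes f :: "'a::euclidean_space \<Rightarrow> real"
  assumes lam: "0 < lam" and mu: "0 < mu" and f: "f \<in> bcontfun"
  shows "resolvent_op lam f x - resolvent_op mu f x = (mu - lam) * resolvent_op lam (resolvent_op mu f) x"
proof -
  obtain B where B: "\<And>x. \<bar>f x\<bar> \<le> B" using bcontfunD(3)[OF f] by auto
  note [measurable] = bcontfunD(2)[OF f] borel_measurable_integrable[OF weight_int[OF mu]] borel_measurable_integrable[OF weight_int[OF lam]]
  let ?g = "\<lambda>\<sigma>. heat_flow \<sigma> f x"
  let ?h = "\<lambda>p. (mu - lam) * (weight lam (fst p) * weight mu (snd p))"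
  have hint: "integrable (lborel \<Otimes>\<^sub>M lborel) ?h"
    using weight_int[OF lam] weight_int[OF mu] by (intro integrable_mult_right lborel_pair.Fubini_integrable) (auto simp: abs_mult)
  have lap: "(LINT p|(lborel \<Otimes>\<^sub>M lborel). exp (- m * (fst p + snd p)) * ?h p) = (LINT \<sigma>|lborel. exp (- m * \<sigma>) * (weight lam \<sigma> - weight mu \<sigma>))" if m: "0 < m" for m
  proof -
    have "integrable (lborel \<Otimes>\<^sub>M lborel) (\<lambda>p. exp (- m * (fst p + snd p)) * ?h p)"
      by (rule integrable_bounded_mult[OF hint, where B=1]) (use m in \<open>auto dest!: weight_pos\<close>)
    from lborel_pair.integral_fst'[OF this, symmetric]
    have "(LINT p|(lborel \<Otimes>\<^sub>M lborel). exp (- m * (fst p + snd p)) * ?h p) = (LINT \<sigma>|lborel. LINT \<tau>|lborel. exp (- m * (\<sigma> + \<tau>)) * ((mu - lam) * (weight lam \<sigma> * weight mu \<tau>)))"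
      unfolding fst_conv snd_conv .
    also have "\<dots> = (LINT \<sigma>|lborel. LINT \<tau>|lborel. (mu - lam) * (exp (- m * \<sigma>) * weight lam \<sigma>) * (exp (- m * \<tau>) * weight mu \<tau>))"
      by (simp only: distrib_left exp_add mult_ac)
    also have "\<dots> = (mu - lam) * (1 / (lam + m powr s)) * (1 / (mu + m powr s))"
      unfolding integral_mult_right_zero integral_mult_left_zero weight_laplace[OF mu m] weight_laplace[OF lam m] by simp
    also have "\<dots> = 1 / (lam + m powr s) - 1 / (mu + m powr s)"
      using lam mu powr_ge_zero[of m s] by (simp add: field_simps add_nonneg_eq_0_iff add_pos_nonneg)
    also have "\<dots> = (LINT \<sigma>|lborel. exp (- m * \<sigma>) * (weight lam \<sigma> - weight mu \<sigma>))"
    proof -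
      have i: "integrable lborel (\<lambda>\<sigma>. exp (- m * \<sigma>) * weight l \<sigma>)" if l: "0 < l" for l
        by (rule integrable_bounded_mult[OF weight_int[OF l], where B=1]) (use m in \<open>auto dest!: weight_pos\<close>)
      show ?thesis unfolding right_diff_distrib Bochner_Integration.integral_diff[OF i[OF lam] i[OF mu]]
          weight_laplace[OF mu m] weight_laplace[OF lam m] ..
    qed
    finally show ?thesis .
  qed
  have gint: "integrable (lborel \<Otimes>\<^sub>M lborel) (\<lambda>p. ?g (fst p + snd p) * ?h p)"
    by (rule integrable_bounded_mult[OF hint, where B=B]) (use heat_flow_bound[OF B] in auto)
  have "resolvent_op lam f x - resolvent_op mu f x = (LINT \<sigma>|lborel. ?g \<sigma> * (weight lam \<sigma> - weight mu \<sigma>))"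
    unfolding resolvent_op_def
    by (subst Bochner_Integration.integral_diff[symmetric, OF resolvent_op_int[OF lam f] resolvent_op_int[OF mu f]]) (simp add: algebra_simps)
  also have "\<dots> = (LINT p|(lborel \<Otimes>\<^sub>M lborel). ?g (fst p + snd p) * ?h p)"
  proof (rule laplace_unique[where g="?g" and B=B and ?S1.0="\<lambda>x. x", OF _ _ _ hint])
    show "integrable lborel (\<lambda>\<sigma>. weight lam \<sigma> - weight mu \<sigma>)" using weight_int[OF lam] weight_int[OF mu] by simp
    show "0 \<le> \<sigma>" if "weight lam \<sigma> - weight mu \<sigma> \<noteq> 0" for \<sigma>
      using that weight_pos[of lam \<sigma>] weight_pos[of mu \<sigma>] by (cases "weight lam \<sigma> = 0") auto
    show "0 \<le> fst p + snd p" if "?h p \<noteq> 0" for p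
      using that weight_pos[of lam "fst p"] weight_pos[of mu "snd p"] by auto
    show "(LINT \<sigma>|lborel. exp (- m * \<sigma>) * (weight lam \<sigma> - weight mu \<sigma>)) = (LINT p|(lborel \<Otimes>\<^sub>M lborel). exp (- m * (fst p + snd p)) * ?h p)"
      if "0 < m" for m by (rule lap[OF that, symmetric])
    show "continuous_on UNIV ?g" by (rule heat_flow_continuous_time[OF f])
    show "\<bar>?g \<sigma>\<bar> \<le> B" for \<sigma> by (rule heat_flow_bound[OF B])
  qed auto
  also have "\<dots> = (LINT \<sigma>|lborel. LINT \<tau>|lborel. ?g (\<sigma> + \<tau>) * ((mu - lam) * (weight lam \<sigma> * weight mu \<tau>)))"
    using lborel_pair.integral_fst'[OF gint] by simp
  also have "\<dots> = (LINT \<sigma>|lborel. (mu - lam) * (weight lam \<sigma> * (LINT \<tau>|lborel. weight mu \<tau> * ?g (\<sigma> + \<tau>))))"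
    unfolding integral_mult_right_zero[symmetric] by (simp only: mult_ac)
  also have "\<dots> = (LINT \<sigma>|lborel. (mu - lam) * (weight lam \<sigma> * heat_flow \<sigma> (resolvent_op mu f) x))"
  proof (intro Bochner_Integration.integral_cong refl)
    fix \<sigma>
    show "(mu - lam) * (weight lam \<sigma> * (LINT \<tau>|lborel. weight mu \<tau> * ?g (\<sigma> + \<tau>))) = (mu - lam) * (weight lam \<sigma> * heat_flow \<sigma> (resolvent_op mu f) x)"
      using heat_flow_resolvent_op[OF mu f, of \<sigma> x] weight_pos[of lam \<sigma>] by (cases "weight lam \<sigma> = 0") auto
  qed
  also have "\<dots> = (mu - lam) * resolvent_op lam (resolvent_op mu f) x" by (simp add: resolvent_op_def)
  finally show ?thesis .
qed

text \<open>The total mass is the transform at m = 0, which lies outside the range of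
  \<open>weight_laplace\<close> and is reached as a limit.\<close>

lemma weight_total: "(LINT \<sigma>|lborel. weight 1 \<sigma>) = 1"
proof -
  \<comment> \<open>The absolute value bounds the exponential for all real p and \<sigma>, so
    continuity at p = 0 follows by dominated convergence; for p > 0 it changes nothing on the
    support of the weight.\<close>
  let ?F = "\<lambda>p. LINT \<sigma>|lborel. weight 1 \<sigma> * exp (- \<bar>p * \<sigma>\<bar>)"
  have "continuous_on UNIV ?F"
    by (rule continuous_param_integral[where B=1 and f="\<lambda>x. exp (- \<bar>x\<bar>)", OF weight_int]) (auto intro!: continuous_intros)
  then have lim: "(\<lambda>n. ?F (1 / real (Suc n))) \<longlonglongrightarrow> ?F 0"
    by (rule continuous_on_tendsto_compose) (simp_all, real_asymp)
  have Fm: "?F m = 1 / (1 + m powr s)" if m: "0 < m" for m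
  proof -
    have "?F m = (LINT \<sigma>|lborel. exp (- m * \<sigma>) * weight 1 \<sigma>)"
    proof (intro Bochner_Integration.integral_cong refl)
      fix \<sigma>
      show "weight 1 \<sigma> * exp (- \<bar>m * \<sigma>\<bar>) = exp (- m * \<sigma>) * weight 1 \<sigma>"
        using m weight_pos[of 1 \<sigma>] by (cases "weight 1 \<sigma> = 0") auto
    qed
    then show ?thesis using weight_laplace[of 1 m] m by simp
  qed
  have "?F (1 / real (Suc n)) = 1 / (1 + (1 / real (Suc n)) powr s)" for n by (rule Fm) simp
  with lim have "(\<lambda>n. 1 / (1 + (1 / real (Suc n)) powr s)) \<longlonglongrightarrow> ?F 0" by (simp only:)
  moreover have "(\<lambda>n. 1 / (1 + (1 / real (Suc n)) powr s)) \<longlonglongrightarrow> 1" using s by real_asymp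
  ultimately show ?thesis using LIMSEQ_unique by fastforce
qed

text \<open>The transform \<mu>/(\<mu> + m^s) shows that \<mu> times the density at \<mu> is the
  density at 1 dilated by p = \<mu>^(-1/s). Thus \<mu>R(\<mu>)f(x) is the average of
  T_(p\<sigma>)f(x) over that fixed density, and p tending to 0 recovers f(x), the total mass being
  1.\<close>

lemma resolvent_op_injective:
  fixes f :: "'a::euclidean_space \<Rightarrow> real"
  assumes f: "f \<in> bcontfun" and z: "\<And>mu. 0 < mu \<Longrightarrow> resolvent_op mu f x = 0"
  shows "f x = 0"
proof -
  obtain B where B: "\<And>x. \<bar>f x\<bar> \<le> B" using bcontfunD(3)[OF f] by auto
  note [measurable] = bcontfunD(2)[OF f]
  let ?g = "\<lambda>\<sigma>. heat_flow \<sigma> f x"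
  let ?F = "\<lambda>p. LINT \<sigma>|lborel. weight 1 \<sigma> * ?g (p * \<sigma>)"
  have F0: "?F p = 0" if p: "0 < p" for p
  proof -
    define mu where "mu = p powr (- s)"
    have mu: "0 < mu" using p by (simp add: mu_def)
    have "(LINT \<sigma>|lborel. ?g \<sigma> * (mu * weight mu \<sigma>)) = (LINT \<sigma>|lborel. ?g (p * \<sigma>) * weight 1 \<sigma>)"
    proof (rule laplace_unique[where g="?g" and B=B and ?S1.0="\<lambda>x. x"])
      fix m :: real assume m: "0 < m"
      have "(LINT \<sigma>|lborel. exp (- m * \<sigma>) * (mu * weight mu \<sigma>)) = mu * (1 / (mu + m powr s))"
        unfolding weight_laplace[OF mu m, symmetric] by (simp add: mult.left_commute[of "exp _"])
      also have "\<dots> = 1 / (1 + (m * p) powr s)"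
        using p m by (simp add: mu_def powr_mult powr_minus field_simps)
      also have "\<dots> = (LINT \<sigma>|lborel. exp (- (m * p) * \<sigma>) * weight 1 \<sigma>)"
        using m p by (subst weight_laplace) auto
      finally show "(LINT \<sigma>|lborel. exp (- m * \<sigma>) * (mu * weight mu \<sigma>)) = (LINT \<sigma>|lborel. exp (- m * (p * \<sigma>)) * weight 1 \<sigma>)"
        by (simp add: mult.assoc)
    qed (use mu p weight_int weight_pos heat_flow_continuous_time[OF f] heat_flow_bound[OF B] in \<open>auto simp: less_imp_le\<close>)
    moreover have "(LINT \<sigma>|lborel. ?g \<sigma> * (mu * weight mu \<sigma>)) = mu * resolvent_op mu f x"
      by (simp add: resolvent_op_def mult_ac)
    ultimately show ?thesis using z[OF mu] by (simp add: mult.commute)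
  qed
  have "continuous_on UNIV ?F"
    by (rule continuous_param_integral[where B=B, OF weight_int heat_flow_continuous_time[OF f]])
       (use heat_flow_bound[OF B] in \<open>auto intro!: continuous_intros\<close>)
  then have "(\<lambda>n. ?F (1 / real (Suc n))) \<longlonglongrightarrow> ?F 0"
    by (rule continuous_on_tendsto_compose) (simp_all, real_asymp)
  moreover have "?F (1 / real (Suc n)) = 0" for n by (rule F0) simp
  ultimately have "(\<lambda>n. 0) \<longlonglongrightarrow> ?F 0" by (simp only:)
  then have "?F 0 = 0" by (simp only: LIMSEQ_const_iff)
  then show ?thesis using weight_total by (simp add: heat_flow_0)
qed

section \<open>The generator reconstructed from its resolvent\<close>

definition resolvent_bc :: "real \<Rightarrow> ('a::euclidean_space \<Rightarrow>\<^sub>C real) \<Rightarrow> 'a \<Rightarrow>\<^sub>C real" where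
  "resolvent_bc lam f = Bcontfun (resolvent_op lam (apply_bcontfun f))"

lemma apply_resolvent_bc: "0 < lam \<Longrightarrow> apply_bcontfun (resolvent_bc lam f) = resolvent_op lam (apply_bcontfun f)"
  unfolding resolvent_bc_def by (intro Bcontfun_inverse resolvent_op_bcontfun apply_bcontfun)

lemma heat_flow_linear:
  fixes f g :: "'a::euclidean_space \<Rightarrow> real"
  assumes "f \<in> bcontfun" "g \<in> bcontfun"
  shows "heat_flow \<sigma> (\<lambda>x. f x + g x) x = heat_flow \<sigma> f x + heat_flow \<sigma> g x"
    "heat_flow \<sigma> (\<lambda>x. c * f x) x = c * heat_flow \<sigma> f x"
  using heat_flow_integrable[OF assms(1)] heat_flow_integrable[OF assms(2)]
  by (simp_all add: heat_flow_def distrib_left mult.left_commute[of "gauss _"])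

lemma bounded_linear_resolvent_bc:
  assumes lam: "0 < lam"
  shows "bounded_linear (resolvent_bc lam)"
proof (rule bounded_linear_intro)
  note ap = apply_resolvent_bc[OF lam]
  fix f g :: "'a \<Rightarrow>\<^sub>C real" and r :: real
  note b = apply_bcontfun[of f] apply_bcontfun[of g]
  show "resolvent_bc lam (f + g) = resolvent_bc lam f + resolvent_bc lam g"
    using resolvent_op_int[OF lam b(1)] resolvent_op_int[OF lam b(2)]
    by (intro bcontfun_eqI) (simp add: ap plus_bcontfun.rep_eq resolvent_op_def heat_flow_linear(1)[OF b] distrib_left)
  show "resolvent_bc lam (r *\<^sub>R f) = r *\<^sub>R resolvent_bc lam f"
    by (intro bcontfun_eqI) (simp add: ap scaleR_bcontfun.rep_eq resolvent_op_def heat_flow_linear(2)[OF b] mult.left_commute[of "weight _ _"])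
  have "\<bar>apply_bcontfun f x\<bar> \<le> norm f" for x using norm_bounded[of f x] by simp
  from resolvent_op_bound[OF lam this] show "norm (resolvent_bc lam f) \<le> norm f * weight_norm lam"
    by (intro norm_bound) (simp add: ap mult.commute)
qed

lemma resolvent_bc_identity:
  assumes "0 < lam" "0 < mu"
  shows "resolvent_bc lam f - resolvent_bc mu f = (mu - lam) *\<^sub>R resolvent_bc lam (resolvent_bc mu f)"
  using resolvent_identity[OF assms apply_bcontfun]
  by (intro bcontfun_eqI) (simp add: minus_bcontfun.rep_eq scaleR_bcontfun.rep_eq apply_resolvent_bc assms)

text \<open>The graph of I - R(1)^(-1), written without the inverse: closedness and linearity can be
  read off the defining equation before injectivity is known. The choice \<lambda> = 1 is arbitrary,
  as the resolvent identity shows.\<close>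

definition generator :: "(('a::euclidean_space \<Rightarrow>\<^sub>C real) \<times> ('a \<Rightarrow>\<^sub>C real)) set" where
  "generator = {(u, g). resolvent_bc 1 (u - g) = u}"

text \<open>By the resolvent identity everything in the kernel of R(1) is in the kernel of each
  R(\<mu>), which is the hypothesis of \<open>resolvent_op_injective\<close>.\<close>

lemma resolvent_bc_eq_0:
  fixes f :: "'a::euclidean_space \<Rightarrow>\<^sub>C real"
  assumes "resolvent_bc 1 f = 0"
  shows "f = 0"
proof (rule bcontfun_eqI)
  fix x
  have "resolvent_bc mu f = 0" if mu: "0 < mu" for mu
  proof -
    interpret R: bounded_linear "resolvent_bc mu :: ('a \<Rightarrow>\<^sub>C real) \<Rightarrow> _" by (rule bounded_linear_resolvent_bc[OF mu])
    show ?thesis using resolvent_bc_identity[OF mu, of 1 f] assms by (simp add: R.zero)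
  qed
  then have "resolvent_op mu (apply_bcontfun f) x = 0" if "0 < mu" for mu
    using that by (metis apply_resolvent_bc zero_bcontfun.rep_eq)
  then have "apply_bcontfun f x = 0" by (rule resolvent_op_injective[OF apply_bcontfun])
  then show "apply_bcontfun f x = apply_bcontfun 0 x" by simp
qed

lemma single_valued_generator: "single_valued (generator :: (('a::euclidean_space \<Rightarrow>\<^sub>C real) \<times> ('a \<Rightarrow>\<^sub>C real)) set)"
proof (rule single_valuedI)
  fix u g g' :: "'a \<Rightarrow>\<^sub>C real"
  interpret R: bounded_linear "resolvent_bc 1 :: ('a \<Rightarrow>\<^sub>C real) \<Rightarrow> _" by (rule bounded_linear_resolvent_bc) simp
  assume "(u, g) \<in> generator" "(u, g') \<in> generator"
  then have "resolvent_bc 1 ((u - g) - (u - g')) = 0" by (subst R.diff) (simp add: generator_def)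
  then have "(u - g) - (u - g') = 0" by (rule resolvent_bc_eq_0)
  then show "g = g'" by simp
qed

lemma closed_operator_generator: "closed_operator (generator :: (('a::euclidean_space \<Rightarrow>\<^sub>C real) \<times> ('a \<Rightarrow>\<^sub>C real)) set)"
  unfolding closed_operator_def
proof (intro conjI single_valued_generator)
  interpret R: bounded_linear "resolvent_bc 1 :: ('a \<Rightarrow>\<^sub>C real) \<Rightarrow> _" by (rule bounded_linear_resolvent_bc) simp
  have "closed {p :: ('a \<Rightarrow>\<^sub>C real) \<times> _. resolvent_bc 1 (fst p - snd p) = fst p}"
    by (intro closed_Collect_eq continuous_intros R.continuous_on)
  then show "closed (generator :: (('a \<Rightarrow>\<^sub>C real) \<times> ('a \<Rightarrow>\<^sub>C real)) set)" by (simp add: generator_def case_prod_beta')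
  show "subspace (generator :: (('a \<Rightarrow>\<^sub>C real) \<times> ('a \<Rightarrow>\<^sub>C real)) set)"
  proof (rule subspaceI)
    show "(0 :: _ \<times> ('a \<Rightarrow>\<^sub>C real)) \<in> generator" by (simp add: generator_def zero_prod_def R.zero)
    fix p q :: "('a \<Rightarrow>\<^sub>C real) \<times> ('a \<Rightarrow>\<^sub>C real)" and c :: real
    assume "p \<in> generator"
    then have p: "resolvent_bc 1 (fst p - snd p) = fst p" by (auto simp: generator_def)
    then show "c *\<^sub>R p \<in> generator"
      using R.scaleR[of c "fst p - snd p"] by (simp add: generator_def case_prod_beta' scaleR_diff_right)
    assume "q \<in> generator"
    then have "resolvent_bc 1 (fst q - snd q) = fst q" by (auto simp: generator_def)
    then show "p + q \<in> generator"
      using p R.add[of "fst p - snd p" "fst q - snd q"] by (simp add: generator_def case_prod_beta' algebra_simps)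
  qed
qed

text \<open>Both requirements are the resolvent identity between 1 and \<lambda>, read in the two
  possible orders; the partner of R(\<lambda>)f in the graph is \<lambda>R(\<lambda>)f - f.\<close>

lemma is_resolvent_generator:
  assumes lam: "0 < lam"
  shows "is_resolvent (generator :: (('a::euclidean_space \<Rightarrow>\<^sub>C real) \<times> ('a \<Rightarrow>\<^sub>C real)) set) lam (resolvent_bc lam)"
  unfolding is_resolvent_def
proof (intro conjI allI)
  interpret R: bounded_linear "resolvent_bc lam :: ('a \<Rightarrow>\<^sub>C real) \<Rightarrow> _" by (rule bounded_linear_resolvent_bc[OF lam])
  interpret R1: bounded_linear "resolvent_bc 1 :: ('a \<Rightarrow>\<^sub>C real) \<Rightarrow> _" by (rule bounded_linear_resolvent_bc) simp
  show "bounded_linear (resolvent_bc lam)" by (rule bounded_linear_resolvent_bc[OF lam])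
  fix f :: "'a \<Rightarrow>\<^sub>C real"
  have "resolvent_bc 1 (resolvent_bc lam f - (lam *\<^sub>R resolvent_bc lam f - f)) = resolvent_bc lam f"
    using resolvent_bc_identity[OF zero_less_one lam, of f] by (simp add: R1.add R1.diff R1.scaleR algebra_simps)
  then show "\<exists>g. (resolvent_bc lam f, g) \<in> generator \<and> lam *\<^sub>R resolvent_bc lam f - g = f"
    by (intro exI[of _ "lam *\<^sub>R resolvent_bc lam f - f"]) (simp add: generator_def)
next
  interpret R: bounded_linear "resolvent_bc lam :: ('a \<Rightarrow>\<^sub>C real) \<Rightarrow> _" by (rule bounded_linear_resolvent_bc[OF lam])
  show "\<forall>(u, g)\<in>(generator :: (('a \<Rightarrow>\<^sub>C real) \<times> ('a \<Rightarrow>\<^sub>C real)) set). resolvent_bc lam (lam *\<^sub>R u - g) = u"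
  proof safe
    fix u g :: "'a \<Rightarrow>\<^sub>C real" assume "(u, g) \<in> generator"
    then have u: "resolvent_bc 1 (u - g) = u" by (simp add: generator_def)
    have "resolvent_bc lam (u - g) - u = (1 - lam) *\<^sub>R resolvent_bc lam u"
      using resolvent_bc_identity[OF lam zero_less_one, of "u - g"] by (simp add: u)
    then show "resolvent_bc lam (lam *\<^sub>R u - g) = u"
      by (simp add: R.diff R.scaleR algebra_simps)
  qed
qed

lemma is_frac_generator_generator: "is_frac_generator s (generator :: (('a::euclidean_space \<Rightarrow>\<^sub>C real) \<times> ('a \<Rightarrow>\<^sub>C real)) set)"
  unfolding is_frac_generator_def
proof (intro conjI closed_operator_generator allI impI)
  fix lam :: real assume lam: "0 < lam"
  show "\<exists>R. is_resolvent (generator :: (('a \<Rightarrow>\<^sub>C real) \<times> ('a \<Rightarrow>\<^sub>C real)) set) lam R \<and>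
      (\<forall>f x. set_integrable lborel {0<..} (\<lambda>t. exp (- lam * t) * frac_heat s t (apply_bcontfun f) x) \<and>
        apply_bcontfun (R f) x = (LINT t:{0<..}|lborel. exp (- lam * t) * frac_heat s t (apply_bcontfun f) x))"
  proof (intro exI[of _ "resolvent_bc lam"] conjI allI is_resolvent_generator[OF lam])
    fix f :: "'a \<Rightarrow>\<^sub>C real" and x
    note sub = resolvent_op_subordination[OF lam apply_bcontfun, of f x]
    show "set_integrable lborel {0<..} (\<lambda>t. exp (- lam * t) * frac_heat s t (apply_bcontfun f) x)" by (rule sub(1))
    show "apply_bcontfun (resolvent_bc lam f) x = (LINT t:{0<..}|lborel. exp (- lam * t) * frac_heat s t (apply_bcontfun f) x)"
      by (simp only: sub(2) apply_resolvent_bc[OF lam])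
  qed
qed

text \<open>A competing graph is already determined at \<lambda> = 1: the pointwise integral fixes
  its resolvent R, and being a resolvent forces the graph to consist of the pairs with R(u - g) =
  u.\<close>

lemma frac_generator_eq: "frac_generator s = (generator :: (('a::euclidean_space \<Rightarrow>\<^sub>C real) \<times> ('a \<Rightarrow>\<^sub>C real)) set)"
  unfolding frac_generator_def
proof (rule the_equality)
  show "is_frac_generator s (generator :: (('a \<Rightarrow>\<^sub>C real) \<times> ('a \<Rightarrow>\<^sub>C real)) set)" by (rule is_frac_generator_generator)
  fix G :: "(('a \<Rightarrow>\<^sub>C real) \<times> ('a \<Rightarrow>\<^sub>C real)) set"
  assume "is_frac_generator s G"
  then obtain R where R: "is_resolvent G 1 R"
    and Rf: "\<And>f x. apply_bcontfun (R f) x = (LINT t:{0<..}|lborel. exp (- 1 * t) * frac_heat s t (apply_bcontfun f) x)"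
    unfolding is_frac_generator_def by (metis zero_less_one)
  have RR: "R f = resolvent_bc 1 f" for f
    by (rule bcontfun_eqI) (use Rf resolvent_op_subordination(2)[OF zero_less_one apply_bcontfun] in \<open>simp add: apply_resolvent_bc\<close>)
  show "G = (generator :: (('a \<Rightarrow>\<^sub>C real) \<times> ('a \<Rightarrow>\<^sub>C real)) set)"
  proof safe
    fix u g assume "(u, g) \<in> G"
    then have "R (1 *\<^sub>R u - g) = u" using R unfolding is_resolvent_def by blast
    then show "(u, g) \<in> generator" by (simp add: RR generator_def)
  next
    fix u g :: "'a \<Rightarrow>\<^sub>C real" assume "(u, g) \<in> generator"
    then have u: "R (u - g) = u" by (simp add: RR generator_def)
    obtain g' where g': "(R (u - g), g') \<in> G" "1 *\<^sub>R R (u - g) - g' = u - g"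
      using R unfolding is_resolvent_def by blast
    then show "(u, g) \<in> G" by (simp add: u)
  qed
qed

text \<open>This gives existence and uniqueness at once and reduces the theorem to estimates of the
  explicit integral operator \<open>resolvent_op\<close>.\<close>

lemma is_solution_iff:
  fixes f u :: "'a::euclidean_space \<Rightarrow>\<^sub>C real"
  assumes lam: "0 < lam"
  shows "is_solution s lam f u \<longleftrightarrow> u = resolvent_bc lam f"
proof
  have sol: "is_solution s lam f u \<longleftrightarrow> lam *\<^sub>R u - g = f" if "(u, g) \<in> generator" for u g :: "'a \<Rightarrow>\<^sub>C real"
  proof -
    have "(THE g. (u, g) \<in> generator) = g" using that single_valued_generator by (auto dest: single_valuedD)
    then show ?thesis using that by (auto simp: is_solution_def frac_laplacian_dom_def frac_laplacian_def frac_generator_eq)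
  qed
  note R = is_resolvent_generator[OF lam, where 'a='a, unfolded is_resolvent_def, THEN conjunct2]
  have R1: "\<exists>g. (resolvent_bc lam f, g) \<in> generator \<and> lam *\<^sub>R resolvent_bc lam f - g = f" using R by blast
  have R2: "resolvent_bc lam (lam *\<^sub>R u - g) = u" if "(u, g) \<in> generator" for u g :: "'a \<Rightarrow>\<^sub>C real" using R that by blast
  show "u = resolvent_bc lam f" if A: "is_solution s lam f u"
  proof -
    obtain g where g: "(u, g) \<in> generator"
      using A by (auto simp: is_solution_def frac_laplacian_dom_def frac_generator_eq)
    then have "resolvent_bc lam (lam *\<^sub>R u - g) = u" by (rule R2)
    then show ?thesis using sol[OF g] A by simp
  qed
  show "is_solution s lam f u" if "u = resolvent_bc lam f"
  proof -
    obtain g where "(resolvent_bc lam f, g) \<in> generator" "lam *\<^sub>R resolvent_bc lam f - g = f" using R1 by blast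
    then show ?thesis using sol that by blast
  qed
qed

end

section \<open>Regularity of the resolvent\<close>

lemma directional_limit:
  fixes f :: "'a::euclidean_space \<Rightarrow> real"
  assumes f: "(f has_derivative grad_form D) (at x)" and b: "b \<in> Basis"
  shows "(\<lambda>n. (f (x + (1 / real (Suc n)) *\<^sub>R b) - f x) / (1 / real (Suc n))) \<longlonglongrightarrow> D b"
proof -
  have "((\<lambda>t. x + t *\<^sub>R b) has_derivative (\<lambda>t. t *\<^sub>R b)) (at 0)" by (auto intro!: derivative_eq_intros)
  moreover have "(f has_derivative grad_form D) (at (x + 0 *\<^sub>R b))" using f by simp
  ultimately have "((\<lambda>t. f (x + t *\<^sub>R b)) has_derivative (\<lambda>t. grad_form D (t *\<^sub>R b))) (at 0)"
    by (rule has_derivative_compose)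
  also have "(\<lambda>t. grad_form D (t *\<^sub>R b)) = (\<lambda>t. D b * t)"
    by (rule ext) (simp add: linear_scale[OF bounded_linear.linear[OF bounded_linear_grad_form]] grad_form_Basis[OF b])
  finally have "((\<lambda>t. f (x + t *\<^sub>R b)) has_field_derivative D b) (at 0)" by (simp add: has_field_derivative_def)
  then have "((\<lambda>h. (f (x + h *\<^sub>R b) - f x) / h) \<longlongrightarrow> D b) (at 0)" by (simp add: DERIV_def)
  then show ?thesis unfolding tendsto_at_iff_sequentially o_def
  proof (elim allE impE)
    show "\<forall>i. 1 / real (Suc i) \<in> UNIV - {0}" by simp
    show "(\<lambda>n. 1 / real (Suc n)) \<longlonglongrightarrow> 0" by real_asymp
  qed
qed

text \<open>Each derivative in x is a limit of difference quotients of functions measurable in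
  \<sigma>. The indicator removes \<sigma> <= 0, where the flow is not known to smooth and the
  quotients may fail to converge.\<close>

lemma iter_deriv_heat_flow_measurable:
  fixes f :: "'a::euclidean_space \<Rightarrow> real"
  assumes f: "f \<in> bcontfun"
  shows "set bs \<subseteq> Basis \<Longrightarrow> (\<lambda>\<sigma>. indicator {0<..} \<sigma> * iter_deriv bs (heat_flow \<sigma> f) x) \<in> borel_measurable borel"
proof (induction bs arbitrary: x)
  case Nil
  note [measurable] = bcontfunD(2)[OF f]
  show ?case unfolding iter_deriv.simps by measurable
next
  case (Cons b bs)
  let ?I = "\<lambda>x \<sigma>. indicator {0<..} \<sigma> * iter_deriv bs (heat_flow \<sigma> f) x :: real"
  have b: "b \<in> Basis" "set bs \<subseteq> Basis" using Cons.prems by auto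
  show ?case
  proof (rule borel_measurable_LIMSEQ_real[where u="\<lambda>n \<sigma>. (?I (x + (1 / real (Suc n)) *\<^sub>R b) \<sigma> - ?I x \<sigma>) / (1 / real (Suc n))"])
    fix \<sigma> :: real
    show "(\<lambda>n. (?I (x + (1 / real (Suc n)) *\<^sub>R b) \<sigma> - ?I x \<sigma>) / (1 / real (Suc n))) \<longlonglongrightarrow> indicator {0<..} \<sigma> * iter_deriv (b # bs) (heat_flow \<sigma> f) x"
    proof (cases "0 < \<sigma>")
      case True
      from directional_limit[OF iter_deriv_heat_flow_has_derivative[OF f True b(2)] b(1), of x] True
      show ?thesis by (simp del: iter_deriv.simps of_nat_Suc)
    qed simp
  next
    fix n
    show "(\<lambda>\<sigma>. (?I (x + (1 / real (Suc n)) *\<^sub>R b) \<sigma> - ?I x \<sigma>) / (1 / real (Suc n))) \<in> borel_measurable borel"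
      using Cons.IH[OF b(2)] by (intro borel_measurable_divide borel_measurable_diff) auto
  qed
qed

lemma tensor_norm_le:
  fixes T :: "'a::euclidean_space list \<Rightarrow> real"
  assumes "\<And>bs. bs \<in> multi_indices n \<Longrightarrow> \<bar>T bs\<bar> \<le> M"
  shows "tensor_norm n T \<le> real (card (multi_indices n :: 'a list set)) * M"
proof -
  have "tensor_norm n T \<le> (\<Sum>bs\<in>multi_indices n. \<bar>T bs\<bar>)" unfolding tensor_norm_def by (rule L2_set_le_sum_abs)
  also have "\<dots> \<le> of_nat (card (multi_indices n :: 'a list set)) * M" by (rule sum_bounded_above) (rule assms)
  finally show ?thesis by simp
qed

text \<open>The common mechanism of all difference estimates, with H = |h|. The condition q1 < s
  gives integrability at 0 and s < q2 at infinity; the two balance conditions express parabolic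
  scaling and make both sides of the split point produce the same power of H.\<close>

lemma powr_split_bound:
  fixes r d :: "real \<Rightarrow> real"
  assumes m: "set_borel_measurable lborel {0<..} (\<lambda>\<sigma>. r \<sigma> * d \<sigma>)"
    and r: "\<And>\<sigma>. 0 < \<sigma> \<Longrightarrow> \<bar>r \<sigma>\<bar> \<le> K * \<sigma> powr (s - 1)" and K: "0 < K" and H: "0 < H"
    and d1: "\<And>\<sigma>. 0 < \<sigma> \<Longrightarrow> \<sigma> \<le> H\<^sup>2 \<Longrightarrow> \<bar>d \<sigma>\<bar> \<le> a1 * H powr e1 * \<sigma> powr (- q1)"
    and d2: "\<And>\<sigma>. H\<^sup>2 < \<sigma> \<Longrightarrow> \<bar>d \<sigma>\<bar> \<le> a2 * H powr e2 * \<sigma> powr (- q2)"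
    and q: "q1 < s" "s < q2" and e: "e1 - 2 * q1 = \<beta>" "e2 - 2 * q2 = \<beta>"
  shows "\<bar>LINT \<sigma>:{0<..}|lborel. r \<sigma> * d \<sigma>\<bar> \<le> K * (a1 / (s - q1) + a2 / (q2 - s)) * H powr (\<beta> + 2 * s)"
proof -
  have H2: "0 < H\<^sup>2" using H by simp
  have p: "(H\<^sup>2) powr y = H powr (2 * y)" for y using H by (simp add: powr_powr flip: powr_numeral)
  have mult: "\<bar>r \<sigma> * d \<sigma>\<bar> \<le> K * (a * H powr e) * \<sigma> powr (s - 1 - q)"
    if "0 < \<sigma>" "\<bar>d \<sigma>\<bar> \<le> a * H powr e * \<sigma> powr (- q)" for \<sigma> a e q
  proof -
    have "\<bar>r \<sigma> * d \<sigma>\<bar> \<le> (K * \<sigma> powr (s - 1)) * (a * H powr e * \<sigma> powr (- q))"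
      unfolding abs_mult using r[OF that(1)] that(2) K by (intro mult_mono) auto
    also have "\<dots> = K * (a * H powr e) * (\<sigma> powr (s - 1) * \<sigma> powr (- q))" by (simp only: mult_ac)
    also have "\<sigma> powr (s - 1) * \<sigma> powr (- q) = \<sigma> powr (s - 1 - q)" by (simp add: powr_add[symmetric])
    finally show ?thesis .
  qed
  have "\<bar>LINT \<sigma>:{0<..}|lborel. r \<sigma> * d \<sigma>\<bar> \<le> K * (a1 * H powr e1) * (H\<^sup>2) powr ((s - 1 - q1) + 1) / ((s - 1 - q1) + 1)
      + K * (a2 * H powr e2) * (H\<^sup>2) powr (1 - (1 - s + q2)) / ((1 - s + q2) - 1)"
  proof (rule split_power_bound(3)[OF m H2])
    show "\<bar>r \<sigma> * d \<sigma>\<bar> \<le> K * (a1 * H powr e1) * \<sigma> powr (s - 1 - q1)" if "0 < \<sigma>" "\<sigma> \<le> H\<^sup>2" for \<sigma>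
      by (rule mult[OF that(1) d1[OF that]])
    show "\<bar>r \<sigma> * d \<sigma>\<bar> \<le> K * (a2 * H powr e2) * \<sigma> powr (- (1 - s + q2))" if "H\<^sup>2 < \<sigma>" for \<sigma>
      using mult[OF less_trans[OF H2 that] d2[OF that]] by (simp add: algebra_simps)
  qed (use q in auto)
  also have "\<dots> = K * (a1 * (H powr e1 * H powr (2 * (s - q1)))) / (s - q1) + K * (a2 * (H powr e2 * H powr (2 * (s - q2)))) / (q2 - s)"
    unfolding p by (simp add: mult_ac)
  also have "H powr e1 * H powr (2 * (s - q1)) = H powr (\<beta> + 2 * s)"
    unfolding powr_add[symmetric] e(1)[symmetric] by (simp add: algebra_simps)
  also have "H powr e2 * H powr (2 * (s - q2)) = H powr (\<beta> + 2 * s)"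
    unfolding powr_add[symmetric] e(2)[symmetric] by (simp add: algebra_simps)
  finally show ?thesis by (simp add: algebra_simps)
qed

section \<open>Differences and derivatives of the resolvent\<close>

locale fractional_resolvent = fractional_order +
  fixes lam \<alpha> :: real
  assumes lam: "0 < lam" and al: "0 \<le> \<alpha>" "\<alpha> < 1"
begin

text \<open>One number N bounds both the size and the increments. For \<alpha> = 0 and h nonzero the
  second condition is just the triangle inequality, which explains the factor 2.\<close>

definition holder_data :: "('a::euclidean_space \<Rightarrow> real) \<Rightarrow> real \<Rightarrow> bool" where
  "holder_data f N \<longleftrightarrow> f \<in> bcontfun \<and> (\<forall>x. \<bar>f x\<bar> \<le> N) \<and> (\<forall>x h. \<bar>f (x + h) - f x\<bar> \<le> 2 * N * norm h powr \<alpha>)"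

lemma holder_dataD:
  assumes "holder_data f N"
  shows "f \<in> bcontfun" "\<bar>f x\<bar> \<le> N" "\<bar>f (x + h) - f x\<bar> \<le> 2 * N * norm h powr \<alpha>" "0 \<le> N"
  using assms abs_ge_zero[of "f undefined"] by (auto simp: holder_data_def intro: order_trans[OF abs_ge_zero])

definition heat_const :: "'a::euclidean_space itself \<Rightarrow> nat \<Rightarrow> real" where
  "heat_const _ k = gauss_moment TYPE('a) ^ k * (real k + 1) powr ((real k - \<alpha>) / 2)"

lemma heat_const_nonneg: "0 \<le> heat_const TYPE('a::euclidean_space) k"
  unfolding heat_const_def by (intro mult_nonneg_nonneg zero_le_power gauss_moment_nonneg) simp

lemma heat_deriv_bound:
  fixes f :: "'a::euclidean_space \<Rightarrow> real"
  assumes f: "holder_data f N" and s: "0 < \<sigma>" and bs: "bs \<in> multi_indices k" "0 < k"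
  shows "\<bar>iter_deriv bs (heat_flow \<sigma> f) x\<bar> \<le> heat_const TYPE('a) k * N * \<sigma> powr ((\<alpha> - real k) / 2)"
  using iter_deriv_heat_flow_bound[OF holder_dataD(1)[OF f] holder_dataD(3)[OF f] al holder_dataD(4)[OF f] s, of bs x] bs
  by (auto simp: multi_indices_def heat_const_def)

definition weight_moment :: "nat \<Rightarrow> real" where
  "weight_moment k = (LINT \<sigma>|lborel. \<bar>weight lam \<sigma>\<bar> * \<sigma> powr ((\<alpha> - real k) / 2))"

text \<open>Near 0 the integrand is at most of order \<sigma>^(s-1+(\<alpha>-k)/2), integrable
  because k < \<alpha> + 2s. Beyond 1 the power is at most 1, since k >= 1 > \<alpha>, and the decay
  of the density takes over.\<close>

lemma weight_moment_integrable:
  assumes k: "0 < k" "real k < \<alpha> + 2 * s"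
  shows "integrable lborel (\<lambda>\<sigma>. \<bar>weight lam \<sigma>\<bar> * \<sigma> powr ((\<alpha> - real k) / 2))"
proof -
  obtain K where K: "0 < K" "\<And>\<sigma>. 0 < \<sigma> \<Longrightarrow> \<bar>resolvent_density s lam \<sigma>\<bar> \<le> K * \<sigma> powr (s - 1)"
    "\<And>\<sigma>. 0 < \<sigma> \<Longrightarrow> \<bar>resolvent_density s lam \<sigma>\<bar> \<le> K * \<sigma> powr (- 1 - s)"
    using resolvent_density_bounds[OF s lam] by metis
  note [measurable] = borel_measurable_integrable[OF weight_int[OF lam]]
  let ?h = "\<lambda>\<sigma>. \<bar>resolvent_density s lam \<sigma>\<bar> * \<sigma> powr ((\<alpha> - real k) / 2)"
  have eq: "indicator {0<..} \<sigma> *\<^sub>R ?h \<sigma> = \<bar>weight lam \<sigma>\<bar> * \<sigma> powr ((\<alpha> - real k) / 2)" for \<sigma>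
    by (simp add: weight_def abs_mult)
  have "set_integrable lborel {0<..} ?h"
  proof (rule split_power_bound(1))
    show "set_borel_measurable lborel {0<..} ?h" unfolding set_borel_measurable_def eq by measurable
    show "\<bar>?h \<sigma>\<bar> \<le> K * \<sigma> powr (s - 1 + (\<alpha> - real k) / 2)" if "0 < \<sigma>" for \<sigma>
      using K(2)[OF that] by (simp add: abs_mult powr_add mult_right_mono flip: mult.assoc)
    show "\<bar>?h \<sigma>\<bar> \<le> K * \<sigma> powr (- (1 + s))" if "1 < \<sigma>" for \<sigma>
    proof -
      have "\<sigma> powr ((\<alpha> - real k) / 2) \<le> \<sigma> powr 0" using that k al by (intro powr_mono) auto
      then have "\<bar>?h \<sigma>\<bar> \<le> \<bar>resolvent_density s lam \<sigma>\<bar> * 1" using that by (simp add: abs_mult mult_left_le)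
      then show ?thesis using K(3)[of \<sigma>] that by simp
    qed
  qed (use k s in \<open>auto simp: field_simps\<close>)
  then show ?thesis unfolding set_integrable_def eq .
qed

lemma weight_moment_nonneg: "0 \<le> weight_moment k"
  unfolding weight_moment_def by (intro Bochner_Integration.integral_nonneg) auto

lemma weight_deriv_measurable:
  assumes f: "holder_data f N" and bs: "bs \<in> multi_indices k"
  shows "(\<lambda>\<sigma>. weight lam \<sigma> * iter_deriv bs (heat_flow \<sigma> f) x) \<in> borel_measurable lborel"
proof -
  have "weight lam \<sigma> * iter_deriv bs (heat_flow \<sigma> f) x = weight lam \<sigma> * (indicator {0<..} \<sigma> * iter_deriv bs (heat_flow \<sigma> f) x)" for \<sigma>
    by (simp add: weight_def indicator_def)
  then have eq: "(\<lambda>\<sigma>. weight lam \<sigma> * iter_deriv bs (heat_flow \<sigma> f) x) = (\<lambda>\<sigma>. weight lam \<sigma> * (indicator {0<..} \<sigma> * iter_deriv bs (heat_flow \<sigma> f) x))"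
    by (rule ext)
  show ?thesis unfolding eq
    using borel_measurable_times[OF borel_measurable_integrable[OF weight_int[OF lam]], of "\<lambda>\<sigma>. indicator {0<..} \<sigma> * iter_deriv bs (heat_flow \<sigma> f) x"]
      iter_deriv_heat_flow_measurable[OF holder_dataD(1)[OF f], of bs x] bs by (simp add: multi_indices_def)
qed

lemma weight_deriv_bound:
  fixes f :: "'a::euclidean_space \<Rightarrow> real"
  assumes f: "holder_data f N" and bs: "bs \<in> multi_indices k" "0 < k"
  shows "\<bar>weight lam \<sigma> * iter_deriv bs (heat_flow \<sigma> f) x\<bar> \<le> (\<bar>weight lam \<sigma>\<bar> * \<sigma> powr ((\<alpha> - real k) / 2)) * (heat_const TYPE('a) k * N)"
proof (cases "weight lam \<sigma> = 0")
  case False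
  then have "0 < \<sigma>" by (rule weight_pos)
  from mult_left_mono[OF heat_deriv_bound[OF f this bs, of x] abs_ge_zero[of "weight lam \<sigma>"]]
  show ?thesis unfolding abs_mult by (simp only: mult_ac)
qed simp

definition deriv_int :: "('a::euclidean_space \<Rightarrow> real) \<Rightarrow> 'a list \<Rightarrow> 'a \<Rightarrow> real" where
  "deriv_int f bs x = (LINT \<sigma>|lborel. weight lam \<sigma> * iter_deriv bs (heat_flow \<sigma> f) x)"

lemma weight_deriv_integrable:
  fixes f :: "'a::euclidean_space \<Rightarrow> real"
  assumes f: "holder_data f N" and bs: "bs \<in> multi_indices k" and k: "real k < \<alpha> + 2 * s"
  shows "integrable lborel (\<lambda>\<sigma>. weight lam \<sigma> * iter_deriv bs (heat_flow \<sigma> f) x)"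
proof (cases "k = 0")
  case True
  then have "bs = []" using bs by (simp add: multi_indices_def)
  then show ?thesis using resolvent_op_int[OF lam holder_dataD(1)[OF f]] by simp
next
  case False
  then have k0: "0 < k" by simp
  show ?thesis
  proof (rule Bochner_Integration.integrable_bound[OF integrable_mult_left[OF weight_moment_integrable[OF k0 k], of "heat_const TYPE('a) k * N"] weight_deriv_measurable[OF f bs]])
    show "AE \<sigma> in lborel. norm (weight lam \<sigma> * iter_deriv bs (heat_flow \<sigma> f) x) \<le> norm (\<bar>weight lam \<sigma>\<bar> * \<sigma> powr ((\<alpha> - real k) / 2) * (heat_const TYPE('a) k * N))"
      using weight_deriv_bound[OF f bs k0] by (intro AE_I2) (metis abs_ge_self order_trans real_norm_def)
  qed
qed

text \<open>At order 0 there is no smoothing to exploit, so the sup bound of the data and the total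
  mass of the weight take the place of the moment.\<close>

definition deriv_const :: "'a::euclidean_space itself \<Rightarrow> nat \<Rightarrow> real" where
  "deriv_const T k = (if k = 0 then weight_norm lam else weight_moment k * heat_const T k)"

lemma deriv_const_nonneg: "0 \<le> deriv_const TYPE('a::euclidean_space) k"
proof -
  have "0 \<le> weight_norm lam" unfolding weight_norm_def by (intro Bochner_Integration.integral_nonneg) auto
  then show ?thesis unfolding deriv_const_def by (auto intro!: mult_nonneg_nonneg weight_moment_nonneg heat_const_nonneg)
qed

lemma deriv_int_bound:
  fixes f :: "'a::euclidean_space \<Rightarrow> real"
  assumes f: "holder_data f N" and bs: "bs \<in> multi_indices k" and k: "real k < \<alpha> + 2 * s"
  shows "\<bar>deriv_int f bs x\<bar> \<le> deriv_const TYPE('a) k * N"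
proof (cases "k = 0")
  case True
  then have "bs = []" using bs by (simp add: multi_indices_def)
  then show ?thesis using resolvent_op_bound[OF lam holder_dataD(2)[OF f]] True
    by (simp add: deriv_int_def deriv_const_def resolvent_op_def)
next
  case False
  then have k0: "0 < k" by simp
  have "norm (deriv_int f bs x) \<le> (LINT \<sigma>|lborel. (\<bar>weight lam \<sigma>\<bar> * \<sigma> powr ((\<alpha> - real k) / 2)) * (heat_const TYPE('a) k * N))"
    unfolding deriv_int_def
    by (rule norm_integral_le[OF integrable_mult_left[OF weight_moment_integrable[OF k0 k]]]) (use weight_deriv_bound[OF f bs k0] in simp)
  then show ?thesis using False unfolding integral_mult_left_zero real_norm_def
    by (simp add: deriv_const_def weight_moment_def mult.assoc[of _ "heat_const _ _"])
qed

lemma multi_indices_Cons: "b # bs \<in> multi_indices (Suc k) \<longleftrightarrow> b \<in> Basis \<and> bs \<in> multi_indices k"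
  by (auto simp: multi_indices_def)

text \<open>The moment of order k + 1 supplies a majorant independent of x, so differentiation under
  the integral continues as long as the order stays below \<alpha> + 2s.\<close>

lemma deriv_int_has_derivative:
  fixes f :: "'a::euclidean_space \<Rightarrow> real"
  assumes f: "holder_data f N" and bs: "bs \<in> multi_indices k" and k: "real (Suc k) < \<alpha> + 2 * s"
  shows "(deriv_int f bs has_derivative grad_form (\<lambda>b. deriv_int f (b # bs) x)) (at x)"
  unfolding deriv_int_def[of f bs, abs_def] deriv_int_def[of f "_ # bs"]
proof (rule has_derivative_integral[where r=1 and m="\<lambda>\<sigma>. (\<bar>weight lam \<sigma>\<bar> * \<sigma> powr ((\<alpha> - real (Suc k)) / 2)) * (heat_const TYPE('a) (Suc k) * N)"])
  show "integrable lborel (\<lambda>\<sigma>. weight lam \<sigma> * iter_deriv bs (heat_flow \<sigma> f) y)" for y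
    using weight_deriv_integrable[OF f bs] k by simp
  show "integrable lborel (\<lambda>\<sigma>. (\<bar>weight lam \<sigma>\<bar> * \<sigma> powr ((\<alpha> - real (Suc k)) / 2)) * (heat_const TYPE('a) (Suc k) * N))"
    by (rule integrable_mult_left[OF weight_moment_integrable[OF zero_less_Suc k]])
  fix b :: 'a assume b: "b \<in> Basis"
  then have bb: "b # bs \<in> multi_indices (Suc k)" using bs by (simp add: multi_indices_Cons)
  show "(\<lambda>\<sigma>. weight lam \<sigma> * iter_deriv (b # bs) (heat_flow \<sigma> f) x) \<in> borel_measurable lborel"
    by (rule weight_deriv_measurable[OF f bb])
  show "\<bar>weight lam \<sigma> * iter_deriv (b # bs) (heat_flow \<sigma> f) y\<bar> \<le> (\<bar>weight lam \<sigma>\<bar> * \<sigma> powr ((\<alpha> - real (Suc k)) / 2)) * (heat_const TYPE('a) (Suc k) * N)" for \<sigma> y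
    by (rule weight_deriv_bound[OF f bb zero_less_Suc])
next
  fix \<sigma> :: real and y :: 'a
  show "((\<lambda>y. weight lam \<sigma> * iter_deriv bs (heat_flow \<sigma> f) y) has_derivative grad_form (\<lambda>b. weight lam \<sigma> * iter_deriv (b # bs) (heat_flow \<sigma> f) y)) (at y)"
  proof (cases "weight lam \<sigma> = 0")
    case True
    have "grad_form (\<lambda>b. 0 :: real) = (\<lambda>h::'a. 0)" by (rule ext) (simp add: grad_form_def)
    then show ?thesis by (simp add: True del: iter_deriv.simps)
  next
    case False
    have "(iter_deriv bs (heat_flow \<sigma> f) has_derivative grad_form (\<lambda>b. iter_deriv (b # bs) (heat_flow \<sigma> f) y)) (at y)"
      using bs by (intro iter_deriv_heat_flow_has_derivative holder_dataD(1)[OF f] weight_pos[OF False]) (simp add: multi_indices_def)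
    from has_derivative_mult_right[OF this, of "weight lam \<sigma>"] show ?thesis
      unfolding grad_form_def by (simp add: sum_distrib_left mult.left_commute del: iter_deriv.simps)
  qed
qed simp

lemma deriv_int_continuous:
  fixes f :: "'a::euclidean_space \<Rightarrow> real"
  assumes f: "holder_data f N" and bs: "bs \<in> multi_indices k" and k: "real k < \<alpha> + 2 * s"
  shows "continuous_on UNIV (deriv_int f bs)"
proof (cases "k = 0")
  case True
  then have "bs = []" using bs by (simp add: multi_indices_def)
  then have "deriv_int f bs = resolvent_op lam f" by (auto simp: deriv_int_def resolvent_op_def)
  then show ?thesis using bcontfunD(1)[OF resolvent_op_bcontfun[OF lam holder_dataD(1)[OF f]]] by simp
next
  case False
  then have k0: "0 < k" by simp
  show ?thesis unfolding continuous_on_sequentially o_def deriv_int_def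
  proof safe
    fix X :: "nat \<Rightarrow> 'a" and x assume X: "X \<longlonglongrightarrow> x"
    show "(\<lambda>n. LINT \<sigma>|lborel. weight lam \<sigma> * iter_deriv bs (heat_flow \<sigma> f) (X n)) \<longlonglongrightarrow> (LINT \<sigma>|lborel. weight lam \<sigma> * iter_deriv bs (heat_flow \<sigma> f) x)"
    proof (rule integral_dominated_convergence[OF _ _ integrable_mult_left[OF weight_moment_integrable[OF k0 k]]])
      show "AE \<sigma> in lborel. (\<lambda>n. weight lam \<sigma> * iter_deriv bs (heat_flow \<sigma> f) (X n)) \<longlonglongrightarrow> weight lam \<sigma> * iter_deriv bs (heat_flow \<sigma> f) x"
      proof (intro AE_I2)
        fix \<sigma>
        show "(\<lambda>n. weight lam \<sigma> * iter_deriv bs (heat_flow \<sigma> f) (X n)) \<longlonglongrightarrow> weight lam \<sigma> * iter_deriv bs (heat_flow \<sigma> f) x"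
        proof (cases "weight lam \<sigma> = 0")
          case False
          have "continuous_on UNIV (iter_deriv bs (heat_flow \<sigma> f))"
            using bs by (intro bcontfunD(1)[OF iter_deriv_heat_flow_bcontfun[OF holder_dataD(1)[OF f] weight_pos[OF False]]]) (simp add: multi_indices_def)
          then show ?thesis by (intro tendsto_intros continuous_on_tendsto_compose[OF _ X]) auto
        qed simp
      qed
      show "AE \<sigma> in lborel. norm (weight lam \<sigma> * iter_deriv bs (heat_flow \<sigma> f) (X n)) \<le> (\<bar>weight lam \<sigma>\<bar> * \<sigma> powr ((\<alpha> - real k) / 2)) * (heat_const TYPE('a) k * N)" for n
        using weight_deriv_bound[OF f bs k0] by (intro AE_I2) simp
    qed (rule weight_deriv_measurable[OF f bs])+
  qed
qed

lemma iter_deriv_resolvent: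
  fixes f :: "'a::euclidean_space \<Rightarrow> real"
  assumes f: "holder_data f N"
  shows "bs \<in> multi_indices k \<Longrightarrow> real k < \<alpha> + 2 * s \<Longrightarrow> iter_deriv bs (resolvent_op lam f) = deriv_int f bs"
proof (induction bs arbitrary: k)
  case Nil
  then show ?case by (auto simp: deriv_int_def resolvent_op_def)
next
  case (Cons b bs)
  then obtain j where k: "k = Suc j" by (auto simp: multi_indices_def)
  have b: "b \<in> Basis" and bs: "bs \<in> multi_indices j" using Cons.prems(1) unfolding k multi_indices_Cons by auto
  have "iter_deriv bs (resolvent_op lam f) = deriv_int f bs" using Cons.IH[OF bs] Cons.prems(2) k by simp
  then show ?case
    using frechet_grad_form(2)[OF deriv_int_has_derivative[OF f bs Cons.prems(2)[unfolded k]] b] by auto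
qed

lemma resolvent_Cn_space:
  fixes f :: "'a::euclidean_space \<Rightarrow> real"
  assumes f: "holder_data f N" and n: "real n < \<alpha> + 2 * s"
  shows "resolvent_op lam f \<in> Cn_space n"
    and "Cn_norm n (resolvent_op lam f) \<le> (\<Sum>k\<le>n. real (card (multi_indices k :: 'a list set)) * deriv_const TYPE('a) k) * N"
proof -
  have D: "iter_deriv bs (resolvent_op lam f) = deriv_int f bs" if "bs \<in> multi_indices k" "k \<le> n" for k bs
    using that n by (intro iter_deriv_resolvent[OF f that(1)]) auto
  show "resolvent_op lam f \<in> Cn_space n"
    unfolding Cn_space_def
  proof (safe)
    fix k and bs :: "'a list" and x :: 'a assume "k < n" and bs: "bs \<in> multi_indices k"
    then have "real (Suc k) < \<alpha> + 2 * s" using n by linarith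
    then show "iter_deriv bs (resolvent_op lam f) differentiable at x"
      using frechet_grad_form(1)[OF deriv_int_has_derivative[OF f bs]] D[OF bs] \<open>k < n\<close> by simp
  next
    fix k and bs :: "'a list" assume "k \<le> n" and bs: "bs \<in> multi_indices k"
    then have k: "real k < \<alpha> + 2 * s" using n by linarith
    show "continuous_on UNIV (iter_deriv bs (resolvent_op lam f))"
      unfolding D[OF bs \<open>k \<le> n\<close>] by (rule deriv_int_continuous[OF f bs k])
    show "bounded (range (iter_deriv bs (resolvent_op lam f)))"
      unfolding D[OF bs \<open>k \<le> n\<close>] bounded_iff using deriv_int_bound[OF f bs k] by auto
  qed
  have "(SUP x. tensor_norm k (\<lambda>bs. iter_deriv bs (resolvent_op lam f) x)) \<le> real (card (multi_indices k :: 'a list set)) * deriv_const TYPE('a) k * N" if "k \<le> n" for k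
  proof (rule cSUP_least)
    fix x :: 'a
    have "tensor_norm k (\<lambda>bs. iter_deriv bs (resolvent_op lam f) x) \<le> real (card (multi_indices k :: 'a list set)) * (deriv_const TYPE('a) k * N)"
      by (rule tensor_norm_le) (use deriv_int_bound[OF f] D that n in auto)
    then show "tensor_norm k (\<lambda>bs. iter_deriv bs (resolvent_op lam f) x) \<le> real (card (multi_indices k :: 'a list set)) * deriv_const TYPE('a) k * N"
      by (simp add: mult.assoc)
  qed simp
  then show "Cn_norm n (resolvent_op lam f) \<le> (\<Sum>k\<le>n. real (card (multi_indices k :: 'a list set)) * deriv_const TYPE('a) k) * N"
    unfolding Cn_norm_def sum_distrib_right by (intro sum_mono) auto
qed

lemma heat_flow_diff:
  fixes f :: "'a::euclidean_space \<Rightarrow> real"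
  assumes f: "holder_data f N"
  shows "\<bar>heat_flow \<sigma> f (x + h) - heat_flow \<sigma> f x\<bar> \<le> 2 * N * norm h powr \<alpha>"
proof -
  note i = heat_flow_integrable[OF holder_dataD(1)[OF f]]
  have "heat_flow \<sigma> f (x + h) - heat_flow \<sigma> f x = (LINT z|lborel. gauss z * (f ((x + sqrt \<sigma> *\<^sub>R z) + h) - f (x + sqrt \<sigma> *\<^sub>R z)))"
  proof -
    have "x + sqrt \<sigma> *\<^sub>R z + h = (x + h) + sqrt \<sigma> *\<^sub>R z" for z by (simp add: add_ac)
    then show ?thesis unfolding heat_flow_def right_diff_distrib
      by (simp only: Bochner_Integration.integral_diff[OF i i])
  qed
  also have "norm \<dots> \<le> (LINT z|lborel. gauss (z::'a) * (2 * N * norm h powr \<alpha>))"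
  proof (rule norm_integral_le)
    show "integrable lborel (\<lambda>z::'a. gauss z * (2 * N * norm h powr \<alpha>))" using gauss_integral(1) by auto
    show "norm (gauss z * (f ((x + sqrt \<sigma> *\<^sub>R z) + h) - f (x + sqrt \<sigma> *\<^sub>R z))) \<le> gauss z * (2 * N * norm h powr \<alpha>)" for z
      using holder_dataD(3)[OF f] gauss_pos[of z] by (simp add: abs_mult mult_left_mono)
  qed
  finally show ?thesis by (simp add: gauss_integral(2))
qed

text \<open>Below the scale \<open>\<sigma> = \<bar>h\<bar>\<^sup>2\<close> first differences are controlled by the size of the derivative, or for
  \<open>n = 0\<close> by the regularity of the data; above it by the derivative of the next order.\<close>

definition near_const :: "'a::euclidean_space itself \<Rightarrow> nat \<Rightarrow> real" where
  "near_const T n = (if n = 0 then 2 else 2 * heat_const T n)"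

definition near_e :: "nat \<Rightarrow> real" where "near_e n = (if n = 0 then \<alpha> else 0)"

definition near_q :: "nat \<Rightarrow> real" where "near_q n = (if n = 0 then 0 else (real n - \<alpha>) / 2)"

lemma near_diff:
  fixes f :: "'a::euclidean_space \<Rightarrow> real"
  assumes f: "holder_data f N" and bs: "bs \<in> multi_indices n" and sg: "0 < \<sigma>"
  shows "\<bar>iter_deriv bs (heat_flow \<sigma> f) (x + h) - iter_deriv bs (heat_flow \<sigma> f) x\<bar> \<le> near_const TYPE('a) n * N * norm h powr near_e n * \<sigma> powr (- near_q n)"
proof (cases "n = 0")
  case True
  then have "bs = []" using bs by (simp add: multi_indices_def)
  then show ?thesis using heat_flow_diff[OF f] True sg by (simp add: near_const_def near_e_def near_q_def)
next
  case False
  then have n: "0 < n" by simp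
  have p: "(\<alpha> - real n) / 2 = - ((real n - \<alpha>) / 2)" by (simp add: field_simps)
  show ?thesis
  \<comment> \<open>The exponent \<open>near_e n\<close> is 0 here and \<open>0 powr 0\<close> is 0,
    so for h = 0 the right-hand side vanishes and the sup bound is useless; the left-hand side
    vanishes as well.\<close>
  proof (cases "h = 0")
    case True
    then show ?thesis using heat_const_nonneg holder_dataD(4)[OF f] by (simp add: near_const_def near_e_def)
  next
    case False
    then show ?thesis using heat_deriv_bound[OF f sg bs n, of x] heat_deriv_bound[OF f sg bs n, of "x + h"] n
      unfolding p by (simp add: near_const_def near_e_def near_q_def)
  qed
qed

lemma far_diff:
  fixes f :: "'a::euclidean_space \<Rightarrow> real"
  assumes f: "holder_data f N" and bs: "bs \<in> multi_indices n" and sg: "0 < \<sigma>"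
  shows "\<bar>iter_deriv bs (heat_flow \<sigma> f) (x + h) - iter_deriv bs (heat_flow \<sigma> f) x\<bar>
     \<le> real DIM('a) * heat_const TYPE('a) (Suc n) * N * norm h * \<sigma> powr (- ((real n + 1 - \<alpha>) / 2))"
proof -
  have p: "(\<alpha> - real (Suc n)) / 2 = - ((real n + 1 - \<alpha>) / 2)" by (simp add: field_simps)
  have "\<bar>iter_deriv bs (heat_flow \<sigma> f) (x + h) - iter_deriv bs (heat_flow \<sigma> f) x\<bar>
     \<le> real DIM('a) * (heat_const TYPE('a) (Suc n) * N * \<sigma> powr ((\<alpha> - real (Suc n)) / 2)) * norm (x + h - x)"
  proof (rule mean_value_bound[where S=UNIV and D="\<lambda>y b. iter_deriv (b # bs) (heat_flow \<sigma> f) y"])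
    show "(iter_deriv bs (heat_flow \<sigma> f) has_derivative grad_form (\<lambda>b. iter_deriv (b # bs) (heat_flow \<sigma> f) y)) (at y)" for y
      using bs by (intro iter_deriv_heat_flow_has_derivative holder_dataD(1)[OF f] sg) (simp add: multi_indices_def)
    show "\<bar>iter_deriv (b # bs) (heat_flow \<sigma> f) y\<bar> \<le> heat_const TYPE('a) (Suc n) * N * \<sigma> powr ((\<alpha> - real (Suc n)) / 2)" if "b \<in> Basis" for y b
      using bs that by (intro heat_deriv_bound[OF f sg]) (auto simp: multi_indices_Cons)
  qed auto
  then show ?thesis unfolding p by (simp add: mult_ac)
qed

text \<open>The second difference is the first difference of v(y) = w(y + h) - w(y), and the partial
  derivatives of v are themselves first differences, bounded by \<open>far_diff\<close> one order
  higher. The two mean value steps account for the square of the dimension.\<close>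

lemma far_second_diff:
  fixes f :: "'a::euclidean_space \<Rightarrow> real"
  assumes f: "holder_data f N" and bs: "bs \<in> multi_indices n" and sg: "0 < \<sigma>"
  shows "\<bar>iter_deriv bs (heat_flow \<sigma> f) (x + 2 *\<^sub>R h) - 2 * iter_deriv bs (heat_flow \<sigma> f) (x + h) + iter_deriv bs (heat_flow \<sigma> f) x\<bar>
     \<le> (real DIM('a))\<^sup>2 * heat_const TYPE('a) (Suc (Suc n)) * N * (norm h)\<^sup>2 * \<sigma> powr (- ((real n + 2 - \<alpha>) / 2))"
proof -
  let ?w = "\<lambda>bs. iter_deriv bs (heat_flow \<sigma> f)"
  let ?v = "\<lambda>y. ?w bs (y + h) - ?w bs y"
  let ?M = "real DIM('a) * heat_const TYPE('a) (Suc (Suc n)) * N * norm h * \<sigma> powr (- ((real (Suc n) + 1 - \<alpha>) / 2))"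
  have "\<bar>?v (x + h) - ?v x\<bar> \<le> real DIM('a) * ?M * norm (x + h - x)"
  proof (rule mean_value_bound[where S=UNIV and D="\<lambda>y b. ?w (b # bs) (y + h) - ?w (b # bs) y"])
    have d: "(?w bs has_derivative grad_form (\<lambda>b. ?w (b # bs) y)) (at y)" for y
      using bs by (intro iter_deriv_heat_flow_has_derivative holder_dataD(1)[OF f] sg) (simp add: multi_indices_def)
    show "(?v has_derivative grad_form (\<lambda>b. ?w (b # bs) (y + h) - ?w (b # bs) y)) (at y)" for y
    proof -
      have "((\<lambda>y. y + h) has_derivative (\<lambda>k. k)) (at y)" by (auto intro!: derivative_eq_intros)
      from has_derivative_diff[OF has_derivative_compose[OF this d] d]
      show ?thesis unfolding grad_form_def by (simp add: right_diff_distrib sum_subtractf del: iter_deriv.simps)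
    qed
    show "\<bar>?w (b # bs) (y + h) - ?w (b # bs) y\<bar> \<le> ?M" if "b \<in> Basis" for y b
      using bs that by (intro far_diff[OF f _ sg]) (simp add: multi_indices_Cons)
  qed auto
  moreover have "?v (x + h) - ?v x = ?w bs (x + 2 *\<^sub>R h) - 2 * ?w bs (x + h) + ?w bs x"
  proof -
    have e: "x + h + h = x + 2 *\<^sub>R h" by (simp add: scaleR_2 add.assoc)
    show ?thesis unfolding e by simp
  qed
  moreover have "real DIM('a) * ?M * norm (x + h - x) = (real DIM('a))\<^sup>2 * heat_const TYPE('a) (Suc (Suc n)) * N * (norm h)\<^sup>2 * \<sigma> powr (- ((real n + 2 - \<alpha>) / 2))"
  proof -
    have "real (Suc n) + 1 - \<alpha> = real n + 2 - \<alpha>" by simp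
    then show ?thesis by (simp only: add_diff_cancel_left' power2_eq_square mult_ac)
  qed
  ultimately show ?thesis by (simp only:)
qed

text \<open>Below the split the exponent condition is n < \<alpha> + 2s for either kind of
  difference. Above it, first differences need \<alpha> + 2s < n + 1 and second differences only
  \<alpha> + 2s < n + 2, so the second kind reaches the integer value n + 1.\<close>

lemma difference_bound:
  obtains C where "0 < C"
    "\<And>(f :: 'a::euclidean_space \<Rightarrow> real) N bs x h. holder_data f N \<Longrightarrow> bs \<in> multi_indices n \<Longrightarrow> real n < \<alpha> + 2 * s \<Longrightarrow> h \<noteq> 0 \<Longrightarrow>
       \<alpha> + 2 * s < real n + 1 \<Longrightarrow> \<bar>deriv_int f bs (x + h) - deriv_int f bs x\<bar> \<le> C * N * norm h powr (\<alpha> + 2 * s - real n)"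
    "\<And>(f :: 'a::euclidean_space \<Rightarrow> real) N bs x h. holder_data f N \<Longrightarrow> bs \<in> multi_indices n \<Longrightarrow> real n < \<alpha> + 2 * s \<Longrightarrow> h \<noteq> 0 \<Longrightarrow>
       \<alpha> + 2 * s < real n + 2 \<Longrightarrow> \<bar>deriv_int f bs (x + 2 *\<^sub>R h) - 2 * deriv_int f bs (x + h) + deriv_int f bs x\<bar> \<le> C * N * norm h powr (\<alpha> + 2 * s - real n)"
proof -
  obtain K where K: "0 < K" "\<And>\<sigma>. 0 < \<sigma> \<Longrightarrow> \<bar>resolvent_density s lam \<sigma>\<bar> \<le> K * \<sigma> powr (s - 1)"
    using resolvent_density_bounds[OF s lam] by metis
  let ?T = "TYPE('a)"
  \<comment> \<open>These are the constants of \<open>powr_split_bound\<close> with N taken out.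
    They are fixed before the upper bound on \<alpha> + 2s is known and may then be negative or
    meaningless, hence the absolute values in \<open>C\<close>.\<close>
  define c1 where "c1 = K * (near_const ?T n / (s - near_q n) + real DIM('a) * heat_const ?T (Suc n) / ((real n + 1 - \<alpha>) / 2 - s))"
  define c2 where "c2 = K * (2 * near_const ?T n / (s - near_q n) + (real DIM('a))\<^sup>2 * heat_const ?T (Suc (Suc n)) / ((real n + 2 - \<alpha>) / 2 - s))"
  define C where "C = 1 + \<bar>c1\<bar> + \<bar>c2\<bar>"
  have nq: "near_q n < s" if "real n < \<alpha> + 2 * s" using that s by (auto simp: near_q_def)
  have ne: "near_e n - 2 * near_q n = \<alpha> - real n" by (auto simp: near_e_def near_q_def diff_divide_distrib)
  show ?thesis
  proof
    show "0 < C" by (simp add: C_def)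
    fix f :: "'a \<Rightarrow> real" and N and bs :: "'a list" and x h :: 'a
    assume f: "holder_data f N" and bs: "bs \<in> multi_indices n" and n: "real n < \<alpha> + 2 * s" and h: "h \<noteq> 0"
    have H: "0 < norm h" using h by simp
    let ?w = "\<lambda>\<sigma>. iter_deriv bs (heat_flow \<sigma> f)"
    note int = weight_deriv_integrable[OF f bs n]
    have pos: "a \<le> C * N * norm h powr (\<alpha> + 2 * s - real n)" if "a \<le> (c * N) * norm h powr (\<alpha> + 2 * s - real n)" "c \<le> C" for a c
      using that holder_dataD(4)[OF f] by (meson mult_right_mono order_trans powr_ge_zero)
    {
      assume n1: "\<alpha> + 2 * s < real n + 1"
      let ?d = "\<lambda>\<sigma>. ?w \<sigma> (x + h) - ?w \<sigma> x"
      have i: "integrable lborel (\<lambda>\<sigma>. weight lam \<sigma> * ?d \<sigma>)" using int by (simp add: right_diff_distrib)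
      have "deriv_int f bs (x + h) - deriv_int f bs x = (LINT \<sigma>|lborel. weight lam \<sigma> * ?d \<sigma>)"
        unfolding deriv_int_def right_diff_distrib by (rule Bochner_Integration.integral_diff[symmetric, OF int int])
      then have eq: "deriv_int f bs (x + h) - deriv_int f bs x = (LINT \<sigma>:{0<..}|lborel. resolvent_density s lam \<sigma> * ?d \<sigma>)"
        by (simp add: weight_def set_lebesgue_integral_def mult.assoc)
      have "\<bar>deriv_int f bs (x + h) - deriv_int f bs x\<bar> \<le> K * (near_const ?T n * N / (s - near_q n) + real DIM('a) * heat_const ?T (Suc n) * N / ((real n + 1 - \<alpha>) / 2 - s)) * norm h powr ((\<alpha> - real n) + 2 * s)"
        unfolding eq
      proof (rule powr_split_bound[OF _ K(2) K(1) H _ _ nq[OF n] _ ne])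
        show "set_borel_measurable lborel {0<..} (\<lambda>\<sigma>. resolvent_density s lam \<sigma> * ?d \<sigma>)"
          using borel_measurable_integrable[OF i] by (simp add: set_borel_measurable_def weight_def mult.assoc)
        show "\<bar>?d \<sigma>\<bar> \<le> near_const ?T n * N * norm h powr near_e n * \<sigma> powr (- near_q n)" if "0 < \<sigma>" for \<sigma>
          by (rule near_diff[OF f bs that])
        show "\<bar>?d \<sigma>\<bar> \<le> real DIM('a) * heat_const ?T (Suc n) * N * norm h powr 1 * \<sigma> powr (- ((real n + 1 - \<alpha>) / 2))" if "(norm h)\<^sup>2 < \<sigma>" for \<sigma>
          using far_diff[OF f bs, of \<sigma> x h] that less_trans[OF zero_less_power[OF H] that] by simp
      qed (use n1 in \<open>auto simp: field_simps\<close>)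
      also have "\<dots> = (c1 * N) * norm h powr (\<alpha> + 2 * s - real n)"
        by (simp add: c1_def algebra_simps)
      finally show "\<bar>deriv_int f bs (x + h) - deriv_int f bs x\<bar> \<le> C * N * norm h powr (\<alpha> + 2 * s - real n)"
        by (rule pos) (simp add: C_def)
    }
    {
      assume n2: "\<alpha> + 2 * s < real n + 2"
      let ?d = "\<lambda>\<sigma>. ?w \<sigma> (x + 2 *\<^sub>R h) - 2 * ?w \<sigma> (x + h) + ?w \<sigma> x"
      have i: "integrable lborel (\<lambda>\<sigma>. weight lam \<sigma> * ?w \<sigma> (x + 2 *\<^sub>R h) - 2 * (weight lam \<sigma> * ?w \<sigma> (x + h)) + weight lam \<sigma> * ?w \<sigma> x)"
        using int by simp
      have d: "weight lam \<sigma> * ?w \<sigma> (x + 2 *\<^sub>R h) - 2 * (weight lam \<sigma> * ?w \<sigma> (x + h)) + weight lam \<sigma> * ?w \<sigma> x = weight lam \<sigma> * ?d \<sigma>" for \<sigma>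
        by (simp add: algebra_simps)
      have "deriv_int f bs (x + 2 *\<^sub>R h) - 2 * deriv_int f bs (x + h) + deriv_int f bs x
          = (LINT \<sigma>|lborel. weight lam \<sigma> * ?w \<sigma> (x + 2 *\<^sub>R h) - 2 * (weight lam \<sigma> * ?w \<sigma> (x + h)) + weight lam \<sigma> * ?w \<sigma> x)"
        unfolding deriv_int_def using int by simp
      then have eq: "deriv_int f bs (x + 2 *\<^sub>R h) - 2 * deriv_int f bs (x + h) + deriv_int f bs x = (LINT \<sigma>:{0<..}|lborel. resolvent_density s lam \<sigma> * ?d \<sigma>)"
        unfolding d by (simp add: weight_def set_lebesgue_integral_def mult.assoc)
      have "\<bar>deriv_int f bs (x + 2 *\<^sub>R h) - 2 * deriv_int f bs (x + h) + deriv_int f bs x\<bar> \<le> K * (2 * near_const ?T n * N / (s - near_q n) + (real DIM('a))\<^sup>2 * heat_const ?T (Suc (Suc n)) * N / ((real n + 2 - \<alpha>) / 2 - s)) * norm h powr ((\<alpha> - real n) + 2 * s)"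
        unfolding eq
      proof (rule powr_split_bound[OF _ K(2) K(1) H _ _ nq[OF n] _ ne])
        show "set_borel_measurable lborel {0<..} (\<lambda>\<sigma>. resolvent_density s lam \<sigma> * ?d \<sigma>)"
          using borel_measurable_integrable[OF i[unfolded d]] by (simp add: set_borel_measurable_def weight_def mult.assoc)
        show "\<bar>?d \<sigma>\<bar> \<le> 2 * near_const ?T n * N * norm h powr near_e n * \<sigma> powr (- near_q n)" if "0 < \<sigma>" for \<sigma>
        proof -
          have e: "x + h + h = x + 2 *\<^sub>R h" by (simp add: scaleR_2 add.assoc)
          \<comment> \<open>Below the split a second difference is treated as two first differences,
            which doubles the near constant.\<close>
          have "?d \<sigma> = (?w \<sigma> (x + h + h) - ?w \<sigma> (x + h)) - (?w \<sigma> (x + h) - ?w \<sigma> x)" unfolding e by simp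
          then show ?thesis using near_diff[OF f bs that, of "x + h" h] near_diff[OF f bs that, of x h] by simp
        qed
        show "\<bar>?d \<sigma>\<bar> \<le> (real DIM('a))\<^sup>2 * heat_const ?T (Suc (Suc n)) * N * norm h powr 2 * \<sigma> powr (- ((real n + 2 - \<alpha>) / 2))" if "(norm h)\<^sup>2 < \<sigma>" for \<sigma>
          using far_second_diff[OF f bs, of \<sigma> x h] H that less_trans[OF zero_less_power[OF H] that] by simp
      qed (use n2 in \<open>auto simp: field_simps\<close>)
      also have "\<dots> = (c2 * N) * norm h powr (\<alpha> + 2 * s - real n)"
        by (simp add: c2_def algebra_simps)
      finally show "\<bar>deriv_int f bs (x + 2 *\<^sub>R h) - 2 * deriv_int f bs (x + h) + deriv_int f bs x\<bar> \<le> C * N * norm h powr (\<alpha> + 2 * s - real n)"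
        by (rule pos) (simp add: C_def)
    }
  qed
qed

end

section \<open>Holder and Zygmund norms of the solution\<close>

lemma tensor_norm_0:
  fixes T :: "'a::euclidean_space list \<Rightarrow> real"
  shows "tensor_norm 0 T = \<bar>T []\<bar>"
proof -
  have "multi_indices 0 = {[] :: 'a list}" by (auto simp: multi_indices_def)
  then show ?thesis by (simp add: tensor_norm_def)
qed

text \<open>It keeps the sets of quotients nonempty, so that their \<open>Sup\<close> is a genuine
  supremum.\<close>

lemma exists_nonzero: "\<exists>h::'a::euclidean_space. h \<noteq> 0"
  using nonempty_Basis nonzero_Basis by blast

lemma tensor_quotient_le:
  fixes T :: "'a::euclidean_space list \<Rightarrow> real"
  assumes "\<And>bs. bs \<in> multi_indices n \<Longrightarrow> \<bar>T bs\<bar> \<le> M * d" "0 < d"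
  shows "tensor_norm n T / d \<le> real (card (multi_indices n :: 'a list set)) * M"
  using tensor_norm_le[of n T "M * d"] assms by (simp add: divide_le_eq mult.assoc)

lemma bdd_Sup_le:
  fixes S :: "real set"
  assumes "S \<noteq> {}" "\<And>q. q \<in> S \<Longrightarrow> q \<le> M"
  shows "bdd_above S" "Sup S \<le> M"
  using assms by (auto intro: cSup_least simp: bdd_above_def)

context fractional_resolvent
begin

lemma holder_regularity:
  assumes "\<alpha> + 2 * s \<noteq> 1" "\<alpha> + 2 * s \<noteq> 2"
  shows "\<exists>C>0. \<forall>(f :: 'a::euclidean_space \<Rightarrow> real) N. holder_data f N \<longrightarrow>
    resolvent_op lam f \<in> holder_space (\<alpha> + 2 * s) \<and> holder_norm (\<alpha> + 2 * s) (resolvent_op lam f) \<le> C * N"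
proof -
  define \<theta> where "\<theta> = \<alpha> + 2 * s"
  define n where "n = nat \<lfloor>\<theta>\<rfloor>"
  \<comment> \<open>Since \<alpha> < 1 and s < 1, the integers that \<alpha> + 2s could equal are 1
    and 2, exactly those excluded; so the integer part lies strictly below.\<close>
  have th: "0 < \<theta>" "\<theta> < 3" using s al by (auto simp: \<theta>_def)
  then have n0: "real n = of_int \<lfloor>\<theta>\<rfloor>" by (simp add: n_def)
  have fr: "frac \<theta> = \<theta> - real n" by (simp add: frac_def n0)
  have le: "real n \<le> \<theta>" "\<theta> < real n + 1" unfolding n0 by linarith+
  have "real n \<noteq> \<theta>"
  proof
    assume eq: "real n = \<theta>"
    then have "n < 3" "0 < n" using th by linarith+
    then have "n = 1 \<or> n = 2" by linarith
    then show False using eq assms by (auto simp: \<theta>_def)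
  qed
  with le have lt: "real n < \<theta>" by simp
  obtain C where C: "0 < C" and D: "\<And>(f :: 'a \<Rightarrow> real) N bs x h. holder_data f N \<Longrightarrow> bs \<in> multi_indices n \<Longrightarrow> real n < \<alpha> + 2 * s \<Longrightarrow> h \<noteq> 0 \<Longrightarrow>
       \<alpha> + 2 * s < real n + 1 \<Longrightarrow> \<bar>deriv_int f bs (x + h) - deriv_int f bs x\<bar> \<le> C * N * norm h powr (\<alpha> + 2 * s - real n)"
    using difference_bound[where 'a='a and n=n] by metis
  let ?c = "real (card (multi_indices n :: 'a list set))"
  let ?M = "(\<Sum>k\<le>n. real (card (multi_indices k :: 'a list set)) * deriv_const TYPE('a) k)"
  have M: "0 \<le> ?M" by (intro sum_nonneg mult_nonneg_nonneg deriv_const_nonneg) auto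
  show ?thesis
  proof (intro exI[of _ "1 + ?M + ?c * C"] conjI allI impI)
    show "0 < 1 + ?M + ?c * C" using M C by (simp add: add_pos_nonneg)
    fix f :: "'a \<Rightarrow> real" and N assume f: "holder_data f N"
    note Cn = resolvent_Cn_space[OF f lt[unfolded \<theta>_def]]
    let ?Q = "holder_quotients n (frac \<theta>) (resolvent_op lam f)"
    have Q0: "?Q \<noteq> {}" using exists_nonzero unfolding holder_quotients_def by blast
    have "q \<le> ?c * (C * N)" if qQ: "q \<in> ?Q" for q
    proof -
      obtain x h :: 'a where q: "q = tensor_norm n (\<lambda>bs. iter_deriv bs (resolvent_op lam f) (x + h) - iter_deriv bs (resolvent_op lam f) x) / norm h powr frac \<theta>" and h: "h \<noteq> 0"
        using qQ unfolding holder_quotients_def by blast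
      show ?thesis unfolding q
      proof (rule tensor_quotient_le)
        fix bs :: "'a list" assume bs: "bs \<in> multi_indices n"
        show "\<bar>iter_deriv bs (resolvent_op lam f) (x + h) - iter_deriv bs (resolvent_op lam f) x\<bar> \<le> C * N * norm h powr frac \<theta>"
          unfolding iter_deriv_resolvent[OF f bs lt[unfolded \<theta>_def]] fr
          using D[OF f bs _ h] lt le by (simp add: \<theta>_def)
      qed (use h in simp)
    qed
    note Q = bdd_Sup_le[OF Q0 this]
    show "resolvent_op lam f \<in> holder_space (\<alpha> + 2 * s)"
      using Cn(1) Q(1) by (simp add: holder_space_def n_def \<theta>_def)
    have "holder_norm (\<alpha> + 2 * s) (resolvent_op lam f) \<le> ?M * N + ?c * (C * N)"
      unfolding holder_norm_def \<theta>_def[symmetric] n_def[symmetric] by (rule add_mono[OF Cn(2) Q(2)])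
    also have "\<dots> \<le> (1 + ?M + ?c * C) * N" using holder_dataD(4)[OF f] by (simp add: algebra_simps)
    finally show "holder_norm (\<alpha> + 2 * s) (resolvent_op lam f) \<le> (1 + ?M + ?c * C) * N" .
  qed
qed

text \<open>For n = k - 1 the exponent \<alpha> + 2s - n equals 1, so the second-difference estimate
  is precisely the Zygmund condition on the derivatives of order n.\<close>

lemma zygmund_regularity:
  assumes k: "\<alpha> + 2 * s = real k" "0 < k"
  shows "\<exists>C>0. \<forall>(f :: 'a::euclidean_space \<Rightarrow> real) N. holder_data f N \<longrightarrow>
    resolvent_op lam f \<in> zygmund_space k \<and> zygmund_norm k (resolvent_op lam f) \<le> C * N"
proof -
  define n where "n = k - 1"
  have kn: "real k = real n + 1" using k by (simp add: n_def)
  have lt: "real n < \<alpha> + 2 * s" using k kn by simp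
  obtain C where C: "0 < C" and D: "\<And>(f :: 'a \<Rightarrow> real) N bs x h. holder_data f N \<Longrightarrow> bs \<in> multi_indices n \<Longrightarrow> real n < \<alpha> + 2 * s \<Longrightarrow> h \<noteq> 0 \<Longrightarrow>
       \<alpha> + 2 * s < real n + 2 \<Longrightarrow> \<bar>deriv_int f bs (x + 2 *\<^sub>R h) - 2 * deriv_int f bs (x + h) + deriv_int f bs x\<bar> \<le> C * N * norm h powr (\<alpha> + 2 * s - real n)"
    using difference_bound[where 'a='a and n=n] by metis
  let ?c = "real (card (multi_indices n :: 'a list set))"
  let ?M = "(\<Sum>k\<le>n. real (card (multi_indices k :: 'a list set)) * deriv_const TYPE('a) k)"
  have M: "0 \<le> ?M" by (intro sum_nonneg mult_nonneg_nonneg deriv_const_nonneg) auto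
  show ?thesis
  proof (intro exI[of _ "1 + ?M + ?c * C"] conjI allI impI)
    show "0 < 1 + ?M + ?c * C" using M C by (simp add: add_pos_nonneg)
    fix f :: "'a \<Rightarrow> real" and N assume f: "holder_data f N"
    note Cn = resolvent_Cn_space[OF f lt]
    let ?Q = "zygmund_quotients n (resolvent_op lam f)"
    have Q0: "?Q \<noteq> {}" using exists_nonzero unfolding zygmund_quotients_def by blast
    have "q \<le> ?c * (C * N)" if qQ: "q \<in> ?Q" for q
    proof -
      obtain x h :: 'a where q: "q = tensor_norm n (\<lambda>bs. iter_deriv bs (resolvent_op lam f) (x + 2 *\<^sub>R h) - 2 * iter_deriv bs (resolvent_op lam f) (x + h)
          + iter_deriv bs (resolvent_op lam f) x) / norm h" and h: "h \<noteq> 0"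
        using qQ unfolding zygmund_quotients_def by blast
      show ?thesis unfolding q
      proof (rule tensor_quotient_le)
        fix bs :: "'a list" assume bs: "bs \<in> multi_indices n"
        show "\<bar>iter_deriv bs (resolvent_op lam f) (x + 2 *\<^sub>R h) - 2 * iter_deriv bs (resolvent_op lam f) (x + h) + iter_deriv bs (resolvent_op lam f) x\<bar> \<le> C * N * norm h"
          unfolding iter_deriv_resolvent[OF f bs lt]
          using D[OF f bs lt h, of x] h k kn by simp
      qed (use h in simp)
    qed
    note Q = bdd_Sup_le[OF Q0 this]
    show "resolvent_op lam f \<in> zygmund_space k"
      using Cn(1) Q(1) by (simp add: zygmund_space_def n_def)
    have "zygmund_norm k (resolvent_op lam f) \<le> ?M * N + ?c * (C * N)"
      unfolding zygmund_norm_def n_def[symmetric] by (rule add_mono[OF Cn(2) Q(2)])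
    also have "\<dots> \<le> (1 + ?M + ?c * C) * N" using holder_dataD(4)[OF f] by (simp add: algebra_simps)
    finally show "zygmund_norm k (resolvent_op lam f) \<le> (1 + ?M + ?c * C) * N" .
  qed
qed

lemma holder_data_bounded:
  assumes "\<alpha> = 0"
  shows "holder_data (apply_bcontfun f) (norm f)"
proof -
  have b: "\<bar>apply_bcontfun f x\<bar> \<le> norm f" for x using norm_bounded[of f x] by simp
  have "\<bar>apply_bcontfun f (x + h) - apply_bcontfun f x\<bar> \<le> 2 * norm f * norm h powr 0" for x h
    using b[of "x + h"] b[of x] by (cases "h = 0") auto
  then show ?thesis unfolding holder_data_def using b apply_bcontfun[of f] by (simp add: assms)
qed

text \<open>The Holder norm is the sum of the sup norm and the seminorm, both nonnegative, so it
  dominates each and can serve as N.\<close>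

lemma holder_data_holder:
  assumes a: "0 < \<alpha>" and f: "apply_bcontfun f \<in> holder_space \<alpha>"
  shows "holder_data (apply_bcontfun f) (holder_norm \<alpha> (apply_bcontfun f))"
proof -
  let ?f = "apply_bcontfun f" and ?Q = "holder_quotients 0 \<alpha> (apply_bcontfun f)"
  have fl: "nat \<lfloor>\<alpha>\<rfloor> = 0" "frac \<alpha> = \<alpha>" using a al by (simp_all add: floor_eq_iff frac_eq)
  have Q: "bdd_above ?Q" using f by (simp add: holder_space_def fl)
  have N: "holder_norm \<alpha> ?f = (SUP x. \<bar>?f x\<bar>) + Sup ?Q"
    by (simp add: holder_norm_def fl Cn_norm_def tensor_norm_0)
  have mem: "\<bar>?f (x + h) - ?f x\<bar> / norm h powr \<alpha> \<in> ?Q" if "h \<noteq> 0" for x h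
    using that unfolding holder_quotients_def tensor_norm_0 iter_deriv.simps by blast
  have q: "\<bar>?f (x + h) - ?f x\<bar> / norm h powr \<alpha> \<le> Sup ?Q" if "h \<noteq> 0" for x h
    by (rule cSup_upper[OF mem[OF that] Q])
  obtain h0 :: 'a where "h0 \<noteq> 0" using exists_nonzero by blast
  have Q0: "0 \<le> Sup ?Q" by (rule order_trans[OF _ q[OF \<open>h0 \<noteq> 0\<close>, of 0]]) simp
  have "bdd_above (range (\<lambda>x. \<bar>?f x\<bar>))" using norm_bounded[of f] by (intro bdd_aboveI[of _ "norm f"]) auto
  then have S: "\<bar>?f x\<bar> \<le> (SUP x. \<bar>?f x\<bar>)" for x by (rule cSUP_upper[rotated]) simp
  then have S0: "0 \<le> (SUP x. \<bar>?f x\<bar>)" by (rule order_trans[OF abs_ge_zero])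
  have "\<bar>?f (x + h) - ?f x\<bar> \<le> 2 * holder_norm \<alpha> ?f * norm h powr \<alpha>" for x h
  proof (cases "h = 0")
    case False
    then have "\<bar>?f (x + h) - ?f x\<bar> \<le> Sup ?Q * norm h powr \<alpha>" using q[OF False, of x] by (simp add: divide_le_eq)
    also have "\<dots> \<le> 2 * holder_norm \<alpha> ?f * norm h powr \<alpha>" using Q0 S0 N by (intro mult_right_mono) auto
    finally show ?thesis .
  qed simp
  moreover have "\<bar>?f x\<bar> \<le> holder_norm \<alpha> ?f" for x using S[of x] Q0 N by simp
  ultimately show ?thesis using apply_bcontfun[of f] by (simp add: holder_data_def)
qed

end

theorem theorem4p1:
  fixes s lam :: real
  assumes "0 < lam" and "0 < s" and "s < 1"
  shows
    "(s \<noteq> 1/2 \<longrightarrow>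
        (\<forall>f :: 'a::euclidean_space \<Rightarrow>\<^sub>C real. \<exists>!u. is_solution s lam f u) \<and>
        (\<exists>C>0. \<forall>(f :: 'a \<Rightarrow>\<^sub>C real) u. is_solution s lam f u \<longrightarrow>
           apply_bcontfun u \<in> holder_space (2 * s) \<and>
           holder_norm (2 * s) (apply_bcontfun u) \<le> C * norm f))
   \<and> (s = 1/2 \<longrightarrow>
        (\<forall>f :: 'a \<Rightarrow>\<^sub>C real. \<exists>!u. is_solution s lam f u) \<and>
        (\<exists>C>0. \<forall>(f :: 'a \<Rightarrow>\<^sub>C real) u. is_solution s lam f u \<longrightarrow>
           apply_bcontfun u \<in> zygmund_space 1 \<and>
           zygmund_norm 1 (apply_bcontfun u) \<le> C * norm f))
   \<and> (\<forall>\<alpha>. 0 < \<alpha> \<and> \<alpha> < 1 \<and> \<alpha> + 2 * s \<notin> {1, 2} \<longrightarrow>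
        (\<exists>C>0. \<forall>(f :: 'a \<Rightarrow>\<^sub>C real) u.
           apply_bcontfun f \<in> holder_space \<alpha> \<and> is_solution s lam f u \<longrightarrow>
           apply_bcontfun u \<in> holder_space (\<alpha> + 2 * s) \<and>
           holder_norm (\<alpha> + 2 * s) (apply_bcontfun u) \<le> C * holder_norm \<alpha> (apply_bcontfun f)))
   \<and> (\<forall>\<alpha>. \<forall>k \<in> {1, 2 :: nat}. 0 < \<alpha> \<and> \<alpha> < 1 \<and> \<alpha> + 2 * s = real k \<longrightarrow>
        (\<exists>C>0. \<forall>(f :: 'a \<Rightarrow>\<^sub>C real) u.
           apply_bcontfun f \<in> holder_space \<alpha> \<and> is_solution s lam f u \<longrightarrow>
           apply_bcontfun u \<in> zygmund_space k \<and>
           zygmund_norm k (apply_bcontfun u) \<le> C * holder_norm \<alpha> (apply_bcontfun f)))"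
proof -
  interpret F: fractional_order s by unfold_locales (use assms in auto)
  have R: "fractional_resolvent s lam \<alpha>" if "0 \<le> \<alpha>" "\<alpha> < 1" for \<alpha>
    by unfold_locales (use assms that in auto)
  interpret Z: fractional_resolvent s lam 0 by (rule R) auto
  have sol: "apply_bcontfun u = F.resolvent_op lam (apply_bcontfun f)" if "is_solution s lam f u" for f u :: "'a \<Rightarrow>\<^sub>C real"
    using that F.is_solution_iff[OF assms(1)] F.apply_resolvent_bc[OF assms(1)] by metis
  have ex1: "\<exists>!u. is_solution s lam f u" for f :: "'a \<Rightarrow>\<^sub>C real"
    unfolding F.is_solution_iff[OF assms(1)] by simp
  note data0 = Z.holder_data_bounded[OF refl]
  have "\<exists>C>0. \<forall>(f :: 'a \<Rightarrow>\<^sub>C real) u. is_solution s lam f u \<longrightarrow>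
           apply_bcontfun u \<in> holder_space (2 * s) \<and>
           holder_norm (2 * s) (apply_bcontfun u) \<le> C * norm f" if "s \<noteq> 1/2"
  proof -
    have "0 + 2 * s \<noteq> 1" "0 + 2 * s \<noteq> 2" using that assms by auto
    from Z.holder_regularity[OF this, where 'a='a] obtain C where "C > 0" and
      C: "\<And>(f :: 'a \<Rightarrow> real) N. Z.holder_data f N \<Longrightarrow> F.resolvent_op lam f \<in> holder_space (2 * s) \<and> holder_norm (2 * s) (F.resolvent_op lam f) \<le> C * N"
      unfolding add_0 by blast
    have "apply_bcontfun u \<in> holder_space (2 * s) \<and> holder_norm (2 * s) (apply_bcontfun u) \<le> C * norm f"
      if "is_solution s lam f u" for f u :: "'a \<Rightarrow>\<^sub>C real"
      unfolding sol[OF that] by (rule C[OF data0])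
    with \<open>C > 0\<close> show ?thesis by blast
  qed
  moreover have "\<exists>C>0. \<forall>(f :: 'a \<Rightarrow>\<^sub>C real) u. is_solution s lam f u \<longrightarrow>
           apply_bcontfun u \<in> zygmund_space 1 \<and>
           zygmund_norm 1 (apply_bcontfun u) \<le> C * norm f" if "s = 1/2"
  proof -
    have "0 + 2 * s = real 1" using that by simp
    from Z.zygmund_regularity[OF this zero_less_one, where 'a='a] obtain C where "C > 0" and
      C: "\<And>(f :: 'a \<Rightarrow> real) N. Z.holder_data f N \<Longrightarrow> F.resolvent_op lam f \<in> zygmund_space 1 \<and> zygmund_norm 1 (F.resolvent_op lam f) \<le> C * N"
      by blast
    have "apply_bcontfun u \<in> zygmund_space 1 \<and> zygmund_norm 1 (apply_bcontfun u) \<le> C * norm f"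
      if "is_solution s lam f u" for f u :: "'a \<Rightarrow>\<^sub>C real"
      unfolding sol[OF that] by (rule C[OF data0])
    with \<open>C > 0\<close> show ?thesis by blast
  qed
  moreover have "\<exists>C>0. \<forall>(f :: 'a \<Rightarrow>\<^sub>C real) u.
           apply_bcontfun f \<in> holder_space \<alpha> \<and> is_solution s lam f u \<longrightarrow>
           apply_bcontfun u \<in> holder_space (\<alpha> + 2 * s) \<and>
           holder_norm (\<alpha> + 2 * s) (apply_bcontfun u) \<le> C * holder_norm \<alpha> (apply_bcontfun f)"
    if "0 < \<alpha>" "\<alpha> < 1" "\<alpha> + 2 * s \<notin> {1, 2}" for \<alpha>
  proof -
    \<comment> \<open>\<open>F.resolvent_op\<close> depends on s and \<lambda> alone, so every
      \<alpha> speaks about the same solution; only the constants change with it.\<close>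
    interpret A: fractional_resolvent s lam \<alpha> by (rule R) (use that in auto)
    have "\<alpha> + 2 * s \<noteq> 1" "\<alpha> + 2 * s \<noteq> 2" using that(3) by auto
    from A.holder_regularity[OF this, where 'a='a] obtain C where "C > 0" and
      C: "\<And>(f :: 'a \<Rightarrow> real) N. A.holder_data f N \<Longrightarrow> F.resolvent_op lam f \<in> holder_space (\<alpha> + 2 * s) \<and> holder_norm (\<alpha> + 2 * s) (F.resolvent_op lam f) \<le> C * N"
      by blast
    have "apply_bcontfun u \<in> holder_space (\<alpha> + 2 * s) \<and> holder_norm (\<alpha> + 2 * s) (apply_bcontfun u) \<le> C * holder_norm \<alpha> (apply_bcontfun f)"
      if f: "apply_bcontfun f \<in> holder_space \<alpha>" and u: "is_solution s lam f u" for f u :: "'a \<Rightarrow>\<^sub>C real"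
      unfolding sol[OF u] by (rule C[OF A.holder_data_holder[OF \<open>0 < \<alpha>\<close> f]])
    with \<open>C > 0\<close> show ?thesis by blast
  qed
  moreover have "\<exists>C>0. \<forall>(f :: 'a \<Rightarrow>\<^sub>C real) u.
           apply_bcontfun f \<in> holder_space \<alpha> \<and> is_solution s lam f u \<longrightarrow>
           apply_bcontfun u \<in> zygmund_space k \<and>
           zygmund_norm k (apply_bcontfun u) \<le> C * holder_norm \<alpha> (apply_bcontfun f)"
    if "0 < \<alpha>" "\<alpha> < 1" "\<alpha> + 2 * s = real k" "k \<in> {1, 2}" for \<alpha> k
  proof -
    interpret A: fractional_resolvent s lam \<alpha> by (rule R) (use that in auto)
    have "0 < k" using that by auto
    from A.zygmund_regularity[OF that(3) this, where 'a='a] obtain C where "C > 0" and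
      C: "\<And>(f :: 'a \<Rightarrow> real) N. A.holder_data f N \<Longrightarrow> F.resolvent_op lam f \<in> zygmund_space k \<and> zygmund_norm k (F.resolvent_op lam f) \<le> C * N"
      by blast
    have "apply_bcontfun u \<in> zygmund_space k \<and> zygmund_norm k (apply_bcontfun u) \<le> C * holder_norm \<alpha> (apply_bcontfun f)"
      if f: "apply_bcontfun f \<in> holder_space \<alpha>" and u: "is_solution s lam f u" for f u :: "'a \<Rightarrow>\<^sub>C real"
      unfolding sol[OF u] by (rule C[OF A.holder_data_holder[OF \<open>0 < \<alpha>\<close> f]])
    with \<open>C > 0\<close> show ?thesis by blast
  qed
  ultimately show ?thesis using ex1 by blast
qed

end
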